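(* Let $G$ be an abelian group and $\mathbb{K}$ an algebraically closed field of characteristic zero. Let $A=UT(d_1,\dots,d_m)$ and $A'=UT(d_1',\dots,d_m')$ be upper block-triangular matrix algebras over $\mathbb{K}$ with elementary $G$-gradings induced by tuples ${\bf g}\in G^n$ and ${\bf g}'$ of elements of $G$, respectively. Let $K$ be a finitely generated subgroup of $G$, and let $B$ and $B'$ be $K$-graded division algebras over $\mathbb{K}$ that satisfy an ordinary polynomial identity and have the same p.i. degree. Let $R=A\otimes B$ and $R'=A'\otimes B'$, let $H=\mathrm{supp}\,B$ and let $\alpha:G\to G/H$ be the canonical epimorphism. Assume that $A$ has either at most two block components, or finitely many block components but at least one of them has trivial invariance subgroup for ${}^{\alpha}A$. Then $R$ and $R'$ are isomorphic as $G$-graded algebras if and only if $Id_G(R)=Id_G(R')$.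
   Context: A $G$-grading on an algebra $A$ is a vector space decomposition $A=\bigoplus_{g\in G}A_g$ with $A_gA_h\subseteq A_{gh}$; $\mathrm{supp}\,A=\{g\in G: A_g\neq0\}$. An isomorphism of graded algebras is an algebra isomorphism $f$ with $f(A_g)\subseteq B_g$ for all $g$. An algebra graded by a subgroup $K$ of $G$ is regarded as $G$-graded. $UT(d_1,\dots,d_m)$ ($d_i$ positive integers, $n=d_1+\cdots+d_m$) is the subalgebra of $M_n(\mathbb{K})$ of block matrices $(A_{ij})_{1\le i,j\le m}$, with $A_{ij}$ of size $d_i\times d_j$ and $A_{ij}=0$ for $i>j$; its block components are the $m$ diagonal blocks $M_{d_i}(\mathbb{K})$. The elementary grading induced by $(g_1,\dots,g_n)\in G^n$ is the one in which each matrix unit $e_{ij}$ of the algebra is homogeneous of degree $g_ig_j^{-1}$. If $B$ is $G$-graded, then $(A\otimes B)_g$ is spanned by the $e_{ij}\otimes b$ with $b\in B$ homogeneous and $g_i(\deg_G b)g_j^{-1}=g$. A grading on a unital algebra $B$ is a division grading (and $B$ is a graded division algebra) if every nonzero homogeneous element is invertible. Convention: over the algebraically closed field $\mathbb{K}$ a graded division algebra is (isomorphic to) a twisted group algebra of its support, which is a subgroup; i.e. every nonzero homogeneous component is one-dimensional. For a homomorphism $\alpha:G\to Q$ and a $G$-graded algebra $A$, ${}^{\alpha}A$ denotes $A$ with the $Q$-grading $A_q=\bigoplus_{g\in\alpha^{-1}(q)}A_g$; if $A$ has the elementary grading induced by $(g_1,\dots,g_n)$, then ${}^{\alpha}A$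 has the elementary grading induced by $(\alpha(g_1),\dots,\alpha(g_n))$. Invariance subgroup: for $M_k(\mathbb{K})$ with the elementary grading by a group $Q$ induced by $(q_1,\dots,q_k)$, let $\omega(q)$ be the number of indices $i$ with $q_i=q$; the invariance subgroup is $\{h\in Q:\omega(hq)=\omega(q)\text{ for all }q\in Q\}$. For a block component of an algebra with an elementary grading it is computed from the part of the inducing tuple corresponding to that diagonal block. $Id_G(R)$ is the set of polynomials in the free $G$-graded associative algebra $\mathbb{K}\langle X_G\rangle$ (variables $x_i^g$ of degree $g$, $i\ge1$, $g\in G$) that vanish under every substitution of the variables $x_i^g$ by elements of $R_g$. The p.i. degree of a p.i. algebra $D$ is the largest $d$ such that every multilinear identity of $D$ is an identity of $M_d(\mathbb{K})$; for a graded division algebra $D$ as here it is the natural number $t$ such that $D$ and $M_t(\mathbb{K})$ satisfy the same ordinary identities. *)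

theory Defs
  imports
    "Jordan_Normal_Form.Matrix"
    "HOL-Algebra.Coset"
    "HOL-Algebra.QuotRing"
    "HOL-Algebra.Generated_Groups"
    "HOL-Library.Poly_Mapping"
    "HOL-Computational_Algebra.Polynomial"
begin

hide_const (open) Polynomial.smult

section \<open>Algebras\<close>

text \<open>
  The ground field is a type \<open>'k\<close>. The coefficient algebras live on a whole type \<open>'b\<close> of
  class \<^class>\<open>ring_1\<close>, with an explicit scalar multiplication. All algebras are also viewed as
  records \<open>('k, 'a) module\<close>, so that matrix algebras, whose carrier is a proper subset
  of a type, can be treated in the same way.
\<close>

locale unital_algebra = vector_space scale
  for scale :: "'k::field \<Rightarrow> 'b::ring_1 \<Rightarrow> 'b" +
  assumes scale_mult_left: "scale c (x * y) = scale c x * y"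
    and scale_mult_right: "scale c (x * y) = x * scale c y"

definition alg_of :: "('k \<Rightarrow> 'b \<Rightarrow> 'b) \<Rightarrow> ('k, 'b::ring_1) module" where
  "alg_of s = \<lparr>carrier = UNIV, mult = (*), one = 1, zero = 0, add = (+), smult = s\<rparr>"

definition mat_alg :: "('k \<Rightarrow> 'b \<Rightarrow> 'b) \<Rightarrow> nat \<Rightarrow> ('k, 'b::ring_1 mat) module" where
  "mat_alg s n = \<lparr>carrier = carrier_mat n n, mult = (*), one = 1\<^sub>m n, zero = 0\<^sub>m n n,
     add = (+), smult = (\<lambda>c. map_mat (s c))\<rparr>"

definition field_rec :: "'k::field ring" where
  "field_rec = \<lparr>carrier = UNIV, mult = (*), one = 1, zero = 0, add = (+)\<rparr>"

definition lin_span :: "('k::field, 'a) module \<Rightarrow> 'a set \<Rightarrow> 'a set" where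
  "lin_span A S = \<Inter> {N. submodule N field_rec A \<and> S \<subseteq> N}"


section \<open>Gradings\<close>

text \<open>
  A family of components is a function on the type \<open>'g\<close>; only its values on \<open>carrier G\<close>
  are relevant.
\<close>

definition is_grading ::
  "'g monoid \<Rightarrow> ('k::field, 'a) module \<Rightarrow> ('g \<Rightarrow> 'a set) \<Rightarrow> bool" where
  "is_grading G A \<Gamma> \<longleftrightarrow>
     (\<forall>g\<in>carrier G. submodule (\<Gamma> g) field_rec A) \<and>
     (\<forall>g\<in>carrier G. \<forall>h\<in>carrier G. \<forall>x\<in>\<Gamma> g. \<forall>y\<in>\<Gamma> h. x \<otimes>\<^bsub>A\<^esub> y \<in> \<Gamma> (g \<otimes>\<^bsub>G\<^esub> h)) \<and>
     (\<forall>x\<in>carrier A. \<exists>!c.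
        (\<forall>g\<in>carrier G. c g \<in> \<Gamma> g) \<and> (\<forall>g. g \<notin> carrier G \<longrightarrow> c g = \<zero>\<^bsub>A\<^esub>) \<and>
        finite {g. c g \<noteq> \<zero>\<^bsub>A\<^esub>} \<and> x = finsum A c {g. c g \<noteq> \<zero>\<^bsub>A\<^esub>})"

definition supp :: "'g monoid \<Rightarrow> ('k, 'a) module \<Rightarrow> ('g \<Rightarrow> 'a set) \<Rightarrow> 'g set" where
  "supp G A \<Gamma> = {g \<in> carrier G. \<Gamma> g \<noteq> {\<zero>\<^bsub>A\<^esub>}}"

text \<open>A grading by a subgroup \<open>K\<close>, regarded as a grading by the whole group.\<close>

definition extend_grading :: "'g set \<Rightarrow> ('k, 'a) module \<Rightarrow> ('g \<Rightarrow> 'a set) \<Rightarrow> 'g \<Rightarrow> 'a set" where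
  "extend_grading K A \<Gamma> g = (if g \<in> K then \<Gamma> g else {\<zero>\<^bsub>A\<^esub>})"

text \<open>
  The last conjunct is the convention that a graded division algebra is a twisted group algebra
  of its support. It is not automatic for infinite-dimensional algebras.
\<close>

definition graded_division_algebra ::
  "'g monoid \<Rightarrow> ('k::field \<Rightarrow> 'b::ring_1 \<Rightarrow> 'b) \<Rightarrow> ('g \<Rightarrow> 'b set) \<Rightarrow> bool" where
  "graded_division_algebra G s \<Gamma> \<longleftrightarrow>
     unital_algebra s \<and> is_grading G (alg_of s) \<Gamma> \<and>
     (\<forall>g\<in>carrier G. \<forall>x\<in>\<Gamma> g. x \<noteq> 0 \<longrightarrow> x \<in> Units (alg_of s)) \<and>
     (\<forall>g\<in>supp G (alg_of s) \<Gamma>. vector_space.dim s (\<Gamma> g) = 1)"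

definition graded_isomorphic ::
  "'g monoid \<Rightarrow> ('k, 'a) module \<Rightarrow> ('g \<Rightarrow> 'a set) \<Rightarrow> ('k, 'b) module \<Rightarrow> ('g \<Rightarrow> 'b set) \<Rightarrow> bool" where
  "graded_isomorphic G A \<Gamma> B \<Delta> \<longleftrightarrow>
     (\<exists>f\<in>ring_iso A B.
        (\<forall>c. \<forall>x\<in>carrier A. f (c \<odot>\<^bsub>A\<^esub> x) = c \<odot>\<^bsub>B\<^esub> f x) \<and>
        (\<forall>g\<in>carrier G. f ` \<Gamma> g \<subseteq> \<Delta> g))"


section \<open>Block-triangular matrices and tensor products\<close>

text \<open>
  \<open>block ds i\<close> is the (zero-based) index of the block containing the row or column \<open>i\<close>.
\<close>

definition block :: "nat list \<Rightarrow> nat \<Rightarrow> nat" where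
  "block ds i = (LEAST k. i < sum_list (take (Suc k) ds))"

definition UT :: "nat list \<Rightarrow> ('k, 'k::field mat) module" where
  "UT ds = (mat_alg (*) (sum_list ds))\<lparr>carrier :=
     {M \<in> carrier_mat (sum_list ds) (sum_list ds).
        \<forall>i<sum_list ds. \<forall>j<sum_list ds. block ds j < block ds i \<longrightarrow> M $$ (i, j) = 0}\<rparr>"

definition mat_unit :: "nat \<Rightarrow> nat \<Rightarrow> nat \<Rightarrow> 'k::field mat" where
  "mat_unit n i j = mat n n (\<lambda>p. if p = (i, j) then 1 else 0)"

text \<open>
  The tensor product of a subalgebra of \<open>M\<^sub>n(K)\<close> with \<open>B\<close> is realised inside
  \<open>M\<^sub>n(B) = M\<^sub>n(K) \<otimes> B\<close>: the pure tensor of \<open>a\<close> and \<open>b\<close> is the matrix with entries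
  \<open>a\<^sub>i\<^sub>j b\<close>, and \<open>UT(ds) \<otimes> B\<close> is the span of the pure tensors. The lemmas below show that
  pure tensors are bilinear and multiply as they should, and that every element of
  \<open>UT(ds) \<otimes> B\<close> has unique coordinates in \<open>B\<close> with respect to the matrix units of \<open>UT(ds)\<close>.
\<close>

definition pure_tensor :: "('k \<Rightarrow> 'b \<Rightarrow> 'b) \<Rightarrow> 'k mat \<Rightarrow> 'b \<Rightarrow> 'b mat" where
  "pure_tensor s a b = map_mat (\<lambda>c. s c b) a"

definition UT_tensor ::
  "nat list \<Rightarrow> ('k::field \<Rightarrow> 'b::ring_1 \<Rightarrow> 'b) \<Rightarrow> ('k, 'b mat) module" where
  "UT_tensor ds s = (mat_alg s (sum_list ds))\<lparr>carrier :=
     lin_span (mat_alg s (sum_list ds)) {pure_tensor s a b | a b. a \<in> carrier (UT ds)}\<rparr>"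

text \<open>
  The grading of \<open>UT(ds) \<otimes> B\<close> when \<open>UT(ds)\<close> carries the elementary grading induced by
  \<open>gs\<close>, in which the matrix unit \<open>e\<^sub>i\<^sub>j\<close> has degree \<open>g\<^sub>i g\<^sub>j\<^sup>-\<^sup>1\<close>.
\<close>

definition tensor_grading ::
  "'g monoid \<Rightarrow> nat list \<Rightarrow> 'g list \<Rightarrow> ('k::field \<Rightarrow> 'b::ring_1 \<Rightarrow> 'b) \<Rightarrow> ('g \<Rightarrow> 'b set) \<Rightarrow>
     'g \<Rightarrow> 'b mat set" where
  "tensor_grading G ds gs s \<Gamma> g = lin_span (mat_alg s (sum_list ds))
     {pure_tensor s (mat_unit (sum_list ds) i j) b | i j h b.
        i < sum_list ds \<and> j < sum_list ds \<and> mat_unit (sum_list ds) i j \<in> carrier (UT ds :: ('k, 'k mat) module) \<and>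
        h \<in> carrier G \<and> b \<in> \<Gamma> h \<and> gs ! i \<otimes>\<^bsub>G\<^esub> h \<otimes>\<^bsub>G\<^esub> inv\<^bsub>G\<^esub> (gs ! j) = g}"

lemma (in unital_algebra) pure_tensor_bilinear:
  assumes "a \<in> carrier_mat n n" "a' \<in> carrier_mat n n"
  shows "pure_tensor scale (a + a') b = pure_tensor scale a b + pure_tensor scale a' b"
    and "pure_tensor scale a (b + b') = pure_tensor scale a b + pure_tensor scale a b'"
    and "pure_tensor scale (c \<cdot>\<^sub>m a) b = map_mat (scale c) (pure_tensor scale a b)"
    and "pure_tensor scale a (scale c b) = map_mat (scale c) (pure_tensor scale a b)"
  using assms
  by (auto intro!: eq_matI
      simp: pure_tensor_def scale_left_distrib scale_right_distrib mult.commute)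

lemma (in unital_algebra) pure_tensor_mult:
  assumes "a \<in> carrier_mat n n" "a' \<in> carrier_mat n n"
  shows "pure_tensor scale a b * pure_tensor scale a' b' = pure_tensor scale (a * a') (b * b')"
proof -
  have eq: "scale c b * scale d b' = scale (c * d) (b * b')" for c d
    by (simp flip: scale_mult_left scale_mult_right)
  show ?thesis
    using assms
    by (auto intro!: eq_matI sum.cong simp: pure_tensor_def scalar_prod_def scale_sum_left eq)
qed

lemma (in unital_algebra) carrier_UT_tensor:
  "carrier (UT_tensor ds scale) = {M \<in> carrier_mat (sum_list ds) (sum_list ds).
     \<forall>i<sum_list ds. \<forall>j<sum_list ds. block ds j < block ds i \<longrightarrow> M $$ (i, j) = 0}"
  (is "_ = ?C")
proof -
  let ?n = "sum_list ds" and ?M = "mat_alg scale (sum_list ds)"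
  let ?S = "{pure_tensor scale a b | a b. a \<in> carrier (UT ds)}"
  have "comm_group (add_monoid ?M)"
  proof (rule comm_groupI; simp add: mat_alg_def)
    fix x :: "'b mat" assume x: "x \<in> carrier_mat ?n ?n"
    show "\<exists>y\<in>carrier_mat ?n ?n. y + x = 0\<^sub>m ?n ?n"
      using x by (intro bexI[of _ "-x"]) auto
  qed (auto simp: comm_add_mat)
  then interpret G: comm_group "add_monoid ?M" .
  have inv: "inv\<^bsub>add_monoid ?M\<^esub> x = - x" if "x \<in> carrier_mat ?n ?n" for x
    using that by (intro G.inv_equality) (auto simp: mat_alg_def)
  have sub: "submodule ?C field_rec ?M"
    unfolding submodule_def submodule_axioms_def
  proof (intro conjI G.subgroupI allI impI)
    show "?C \<noteq> {}" by (auto intro!: exI[of _ "0\<^sub>m ?n ?n"])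
    show "inv\<^bsub>add_monoid ?M\<^esub> x \<in> ?C" if "x \<in> ?C" for x
      using that by (auto simp: inv)
  qed (auto simp: mat_alg_def)
  have "N \<supseteq> ?C" if N: "submodule N field_rec ?M" "?S \<subseteq> N" for N
  proof
    fix M assume M: "M \<in> ?C"
    have grp: "subgroup N (add_monoid ?M)" using N(1) by (simp add: submodule_def)
    have add: "x + y \<in> N" if "x \<in> N" "y \<in> N" for x y
      using subgroup.m_closed[OF grp that] by (simp add: mat_alg_def)
    have zero: "0\<^sub>m ?n ?n \<in> N"
      using subgroup.one_closed[OF grp] by (simp add: mat_alg_def)
    have "mat ?n ?n (\<lambda>p. if p \<in> P then M $$ p else 0) \<in> N"
      if "finite P" "P \<subseteq> {..<?n} \<times> {..<?n}" for P
      using that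
    proof (induction P)
      case empty
      have "mat ?n ?n (\<lambda>p. if p \<in> {} then M $$ p else 0) = 0\<^sub>m ?n ?n" by auto
      with zero show ?case by simp
    next
      case (insert p P)
      obtain i j where p: "p = (i, j)" "i < ?n" "j < ?n" using insert by (cases p) auto
      have "pure_tensor scale (mat_unit ?n i j) (M $$ p) \<in> N"
      proof (cases "block ds j < block ds i")
        case True
        then have "pure_tensor scale (mat_unit ?n i j) (M $$ p) = 0\<^sub>m ?n ?n"
          using M p by (auto intro!: eq_matI simp: pure_tensor_def mat_unit_def)
        with zero show ?thesis by simp
      next
        case False
        then have "mat_unit ?n i j \<in> carrier (UT ds :: ('k, 'k mat) module)"
          by (auto simp: UT_def mat_unit_def)
        with N(2) show ?thesis by blast
      qed
      moreover have "mat ?n ?n (\<lambda>q. if q \<in> insert p P then M $$ q else 0) =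
        pure_tensor scale (mat_unit ?n i j) (M $$ p) +
        mat ?n ?n (\<lambda>q. if q \<in> P then M $$ q else 0)"
        using insert.hyps p by (auto intro!: eq_matI simp: pure_tensor_def mat_unit_def)
      ultimately show ?case using add insert by simp
    qed
    from this[of "{..<?n} \<times> {..<?n}"]
    have "mat ?n ?n (\<lambda>p. if p \<in> {..<?n} \<times> {..<?n} then M $$ p else 0) \<in> N" by simp
    moreover have "mat ?n ?n (\<lambda>p. if p \<in> {..<?n} \<times> {..<?n} then M $$ p else 0) = M"
      using M by auto
    ultimately show "M \<in> N" by simp
  qed
  moreover have "?S \<subseteq> ?C" by (auto simp: UT_def pure_tensor_def)
  ultimately have "lin_span ?M ?S = ?C"
    unfolding lin_span_def using sub by blast
  then show ?thesis by (simp add: UT_tensor_def)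
qed


section \<open>Invariance subgroups\<close>

definition invariance_subgroup :: "'q monoid \<Rightarrow> 'q list \<Rightarrow> 'q set" where
  "invariance_subgroup Q qs =
     {h \<in> carrier Q. \<forall>q\<in>carrier Q. count_list qs (h \<otimes>\<^bsub>Q\<^esub> q) = count_list qs q}"

definition block_part :: "nat list \<Rightarrow> nat \<Rightarrow> 'q list \<Rightarrow> 'q list" where
  "block_part ds k qs = take (ds ! k) (drop (sum_list (take k ds)) qs)"


section \<open>Polynomial identities\<close>

text \<open>
  An element of the free associative algebra over \<open>'k\<close> in variables \<open>'v\<close> is a finitely
  supported function on words. The empty word is allowed; since all variables may be
  evaluated at \<open>0\<close>, an identity of a nonzero unital algebra has no constant term.
\<close>

type_synonym ('k, 'v) free_poly = "'v list \<Rightarrow>\<^sub>0 'k"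

definition eval_poly :: "('k::field, 'a) module \<Rightarrow> ('v \<Rightarrow> 'a) \<Rightarrow> ('k, 'v) free_poly \<Rightarrow> 'a" where
  "eval_poly A \<phi> f = (\<Oplus>\<^bsub>A\<^esub>w\<in>Poly_Mapping.keys f.
     Poly_Mapping.lookup f w \<odot>\<^bsub>A\<^esub> foldr (\<lambda>v p. \<phi> v \<otimes>\<^bsub>A\<^esub> p) w \<one>\<^bsub>A\<^esub>)"

definition identities :: "('k::field, 'a) module \<Rightarrow> ('k, nat) free_poly set" where
  "identities A = {f. \<forall>\<phi>. (\<forall>i. \<phi> i \<in> carrier A) \<longrightarrow> eval_poly A \<phi> f = \<zero>\<^bsub>A\<^esub>}"

text \<open>The variable \<open>x\<^sub>i\<close> of degree \<open>g\<close> is the pair \<open>(i, g)\<close>.\<close>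

definition graded_identities ::
  "'g monoid \<Rightarrow> ('k::field, 'a) module \<Rightarrow> ('g \<Rightarrow> 'a set) \<Rightarrow> ('k, nat \<times> 'g) free_poly set" where
  "graded_identities G A \<Gamma> =
     {f. (\<forall>w\<in>Poly_Mapping.keys f. set w \<subseteq> UNIV \<times> carrier G) \<and>
         (\<forall>\<phi>. (\<forall>i. \<forall>g\<in>carrier G. \<phi> (i, g) \<in> \<Gamma> g) \<longrightarrow> eval_poly A \<phi> f = \<zero>\<^bsub>A\<^esub>)}"

definition multilinear :: "('k::field, 'v) free_poly \<Rightarrow> bool" where
  "multilinear f \<longleftrightarrow> (\<exists>V. \<forall>w\<in>Poly_Mapping.keys f. distinct w \<and> set w = V)"

definition is_pi :: "('k::field, 'a) module \<Rightarrow> bool" where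
  "is_pi A \<longleftrightarrow> (\<exists>f\<in>identities A. f \<noteq> 0)"

text \<open>For a nonzero PI algebra the set of admissible \<open>d\<close> is bounded and the maximum exists.\<close>

definition pi_degree :: "('k::field, 'a) module \<Rightarrow> nat" where
  "pi_degree A = (GREATEST d. \<forall>f\<in>identities A. multilinear f \<longrightarrow>
     f \<in> identities (mat_alg ((*) :: 'k \<Rightarrow> 'k \<Rightarrow> 'k) d))"

end

theory Submission
  imports Defs "HOL-Combinatorics.Permutations"
begin

text \<open>
  A multilinear polynomial can be tested on elements \<open>e\<^sub>i\<^sub>j \<otimes> b\<close> with \<open>b\<close> homogeneous, and a product of
  such elements is nonzero exactly if the indices form a walk that never descends in the order of the
  blocks. Take a walk in \<open>R\<close> all of whose rearrangements within the classes of a partition of its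
  letters, into letters of equal degree, fail to be walks. Then the alternating sum of its word over
  these rearrangements is not an identity of \<open>R\<close>, and if \<open>Id(R') \<subseteq> Id(R)\<close>, it is nonzero on \<open>R'\<close>; there
  alternation forces letters of one class onto distinct edges. Repeating each diagonal block in the
  word more often than \<open>R'\<close> has blocks confines one copy to a diagonal block of \<open>R'\<close>. Such words
  transfer matrix units of \<open>R\<close> injectively to \<open>R'\<close>, and counting them shows that \<open>R\<close> and \<open>R'\<close> have
  the same \<open>H\<close>, the same number of blocks, and in corresponding blocks the same multiset of
  \<open>H\<close>-cosets up to one common shift.

  To compare the commutation factors of \<open>B\<close> and \<open>B'\<close>, a word that alternates over a full matrix block
  with entries in \<open>B\<^sub>t\<close> and again with entries in \<open>B\<^sub>r\<close> is combined with the word in which the two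
  families are exchanged, so that the combination is nilpotent on \<open>R'\<close>; then it is nilpotent on \<open>R\<close>,
  where it has a diagonal entry that vanishes only if \<open>B\<close> has the same commutation factor. Twisted
  group algebras with equal commutation factors differ by a symmetric cocycle, and this is a
  coboundary since the multiplicative group of the field is divisible. Hence \<open>B \<cong> B'\<close>, and with the
  coset multisets this gives the isomorphism \<open>R \<cong> R'\<close>.
\<close>

section \<open>Walks\<close>

text \<open>Graded variables cannot tell apart matrix units of equal degree, and a nonzero value
  does not reveal where it was taken. Alternation supplies the lacking injectivity because, at a
  given position, the entries of a given degree form a space of dimension at most one: two letters
  of one class on one edge carry proportional values. What can be counted is therefore pairs of
  indices, and sizes of cells are recovered as square roots of numbers of pairs. Degrees are
  prescribed as differences of a potential along the test walk, so the cosets met by a transferred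
  walk are determined by its starting point; this is the origin of the common shift. Counting modulo
  cosets makes sense only once the supports agree, so these are compared separately, by an extremal
  argument on largest cells. Commutation factors can only be compared modulo strictly
  block-triangular matrices, since walks between different blocks cannot be excluded; a power of the
  test polynomial removes that part.\<close>

primrec walk :: "('v \<Rightarrow> 'i \<times> 'i) \<Rightarrow> 'i \<Rightarrow> 'v list \<Rightarrow> 'i \<Rightarrow> bool" where
  "walk e p [] q \<longleftrightarrow> p = q"
| "walk e p (x # xs) q \<longleftrightarrow> fst (e x) = p \<and> walk e (snd (e x)) xs q"

lemma walk_append: "walk e p (xs @ ys) q \<longleftrightarrow> (\<exists>r. walk e p xs r \<and> walk e r ys q)"
  by (induction xs arbitrary: p) auto

lemma walk_concat_closed:
  "(\<And>x. x \<in> set xs \<Longrightarrow> walk e p (f x) p) \<Longrightarrow> walk e p (concat (map f xs)) p"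
  by (induction xs) (auto simp: walk_append)

lemma walk_mono:
  fixes h :: "'i \<Rightarrow> nat"
  assumes "walk e p w q" "\<And>v. v \<in> set w \<Longrightarrow> h (fst (e v)) \<le> h (snd (e v))"
  shows "h p \<le> h q"
  using assms
proof (induction w arbitrary: p)
  case (Cons x w)
  have "h (snd (e x)) \<le> h q" by (rule Cons.IH) (use Cons.prems in auto)
  moreover have "h p \<le> h (snd (e x))" using Cons.prems(1) Cons.prems(2)[of x] by auto
  ultimately show ?case by (rule order_trans[rotated])
qed simp

lemma walk_mono_mem:
  fixes h :: "'i \<Rightarrow> nat"
  assumes "walk e p w q" "\<And>v. v \<in> set w \<Longrightarrow> h (fst (e v)) \<le> h (snd (e v))" "x \<in> set w"
  shows "h p \<le> h (fst (e x))" "h (snd (e x)) \<le> h q"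
proof -
  obtain u v where w: "w = u @ x # v" using assms(3) by (meson split_list)
  have "walk e p u (fst (e x))" "walk e (snd (e x)) v q"
    using assms(1) by (auto simp: w walk_append)
  then show "h p \<le> h (fst (e x))" "h (snd (e x)) \<le> h q"
    by (auto intro!: walk_mono[of e _ _ _ h] assms(2) simp: w)
qed

text \<open>Used to carry an invariant of the starting point, such as its coset or its block, to
  every vertex that is visited.\<close>

lemma walk_mem_induct:
  assumes "walk e p w q" "P p" "\<And>v. v \<in> set w \<Longrightarrow> P (fst (e v)) \<Longrightarrow> P (snd (e v))"
  shows "P q \<and> (\<forall>v\<in>set w. P (fst (e v)) \<and> P (snd (e v)))"
  using assms
proof (induction w arbitrary: p)
  case (Cons x w)
  have x: "P (fst (e x))" using Cons.prems(1,2) by simp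
  then have "P (snd (e x))" using Cons.prems(3)[of x] by simp
  moreover have "P q \<and> (\<forall>v\<in>set w. P (fst (e v)) \<and> P (snd (e v)))"
    by (rule Cons.IH) (use Cons.prems(1,3) \<open>P (snd (e x))\<close> in simp_all)
  ultimately show ?case using x by simp
qed simp

lemma distinct_concat_map:
  assumes "distinct xs" "\<And>x. x \<in> set xs \<Longrightarrow> distinct (f x)"
    "\<And>x y. x \<in> set xs \<Longrightarrow> y \<in> set xs \<Longrightarrow> x \<noteq> y \<Longrightarrow> set (f x) \<inter> set (f y) = {}"
  shows "distinct (concat (map f xs))"
  using assms
proof (induction xs)
  case (Cons a xs)
  then have "set (f a) \<inter> set (f y) = {}" if "y \<in> set xs" for y using that by auto
  with Cons show ?case by auto
qed simp

section \<open>Words evaluated in matrices\<close>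

text \<open>The pure tensor of a matrix unit and \<open>b\<close>, as a matrix over the coefficient
  algebra. The position is a pair, so that an edge of a walk can be inserted directly.\<close>

definition munit :: "nat \<Rightarrow> nat \<times> nat \<Rightarrow> 'b \<Rightarrow> 'b::zero mat" where
  "munit n e b = mat n n (\<lambda>p. if p = e then b else 0)"

definition wval :: "nat \<Rightarrow> ('v \<Rightarrow> 'b::ring_1 mat) \<Rightarrow> 'v list \<Rightarrow> 'b mat" where
  "wval n \<phi> w = foldr (\<lambda>v p. \<phi> v * p) w (1\<^sub>m n)"

lemma munit_carrier [simp]: "munit n e b \<in> carrier_mat n n"
  by (simp add: munit_def)

lemma munit_index [simp]:
  "i < n \<Longrightarrow> j < n \<Longrightarrow> munit n e b $$ (i, j) = (if (i, j) = e then b else 0)"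
  by (simp add: munit_def)

lemma wval_Nil [simp]: "wval n \<phi> [] = 1\<^sub>m n"
  and wval_Cons [simp]: "wval n \<phi> (x # w) = \<phi> x * wval n \<phi> w"
  by (simp_all add: wval_def)

lemma wval_carrier [simp]:
  "(\<And>v. v \<in> set w \<Longrightarrow> \<phi> v \<in> carrier_mat n n) \<Longrightarrow> wval n \<phi> w \<in> carrier_mat n n"
  by (induction w) (auto intro!: mult_carrier_mat)

lemma wval_map: "wval n \<phi> (map f w) = wval n (\<phi> \<circ> f) w"
  by (induction w) auto

lemma wval_cong: "(\<And>v. v \<in> set w \<Longrightarrow> \<phi> v = \<psi> v) \<Longrightarrow> wval n \<phi> w = wval n \<psi> w"
  by (induction w) auto

lemma wval_append:
  assumes "\<And>v. v \<in> set (u @ w) \<Longrightarrow> \<phi> v \<in> carrier_mat n n"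
  shows "wval n \<phi> (u @ w) = wval n \<phi> u * wval n \<phi> w"
  using assms
proof (induction u)
  case Nil
  have "wval n \<phi> w \<in> carrier_mat n n" using Nil by simp
  then show ?case by simp
next
  case (Cons x u)
  have "wval n \<phi> u \<in> carrier_mat n n" "wval n \<phi> w \<in> carrier_mat n n" "\<phi> x \<in> carrier_mat n n"
    using Cons.prems by simp_all
  then show ?case using Cons by (simp add: assoc_mult_mat[of _ n n _ n _ n])
qed

lemma mult_mat_index:
  assumes "A \<in> carrier_mat n n" "B \<in> carrier_mat n n" "i < n" "j < n"
  shows "(A * B) $$ (i, j) = (\<Sum>k<n. A $$ (i, k) * B $$ (k, j))"
  using assms by (auto simp: scalar_prod_def atLeast0LessThan intro!: sum.cong)

lemma munit_mult_index:
  assumes "A \<in> carrier_mat n n" "i < n" "j < n" "snd e < n"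
  shows "(munit n e b * A) $$ (i, j) = (if i = fst e then b * A $$ (snd e, j) else 0)"
proof -
  have "(munit n e b * A) $$ (i, j) = (\<Sum>k<n. munit n e b $$ (i, k) * A $$ (k, j))"
    by (rule mult_mat_index) (use assms in auto)
  also have "\<dots> = (\<Sum>k<n. if k = snd e then (if i = fst e then b * A $$ (snd e, j) else 0) else 0)"
    using assms by (intro sum.cong) (auto simp: prod_eq_iff)
  also have "\<dots> = (if i = fst e then b * A $$ (snd e, j) else 0)"
    using assms by simp
  finally show ?thesis .
qed

text \<open>This turns evaluations of words into combinatorics: a product of matrix units survives
  exactly along a walk, and then only the product of the coefficients remains.\<close>

lemma wval_munit:
  assumes "\<And>v. v \<in> set w \<Longrightarrow> \<phi> v = munit n (e v) (b v) \<and> snd (e v) < n" "r < n" "q < n"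
  shows "wval n \<phi> w $$ (r, q) = (if walk e r w q then prod_list (map b w) else 0)"
  using assms
proof (induction w arbitrary: r)
  case (Cons x w)
  have "wval n \<phi> w \<in> carrier_mat n n"
    using Cons.prems(1) by (intro wval_carrier) (metis list.set_intros(2) munit_carrier)
  then have "wval n \<phi> (x # w) $$ (r, q) =
      (if r = fst (e x) then b x * wval n \<phi> w $$ (snd (e x), q) else 0)"
    using Cons.prems by (simp add: munit_mult_index)
  then show ?case using Cons by auto
qed auto

text \<open>The letter \<open>v\<close> occurs exactly once, so the word is linear in
  \<open>\<phi> v\<close>, and this matrix is the sum of its entries at the matrix units.\<close>

lemma wval_expand:
  assumes "distinct w" "v \<in> set w" "r < n" "q < n"
    and "\<And>v. v \<in> set w \<Longrightarrow> \<phi> v \<in> carrier_mat n n"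
  shows "wval n \<phi> w $$ (r, q) =
    (\<Sum>p\<in>{..<n} \<times> {..<n}. wval n (\<phi>(v := munit n p (\<phi> v $$ p))) w $$ (r, q))"
  using assms
proof (induction w arbitrary: r)
  case (Cons x w)
  let ?\<phi> = "\<lambda>p. \<phi>(v := munit n p (\<phi> v $$ p))"
  have W: "wval n \<phi> w \<in> carrier_mat n n" "\<phi> x \<in> carrier_mat n n" using Cons.prems by simp_all
  have W': "wval n (?\<phi> p) w \<in> carrier_mat n n" for p
    using Cons.prems by (intro wval_carrier) auto
  show ?case
  proof (cases "x = v")
    case True
    have eq: "wval n (?\<phi> p) w = wval n \<phi> w" for p
      using True Cons.prems by (intro wval_cong) auto
    have "(\<Sum>p\<in>{..<n} \<times> {..<n}. wval n (?\<phi> p) (x # w) $$ (r, q)) =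
       (\<Sum>p\<in>{..<n} \<times> {..<n}. if r = fst p then \<phi> v $$ p * wval n \<phi> w $$ (snd p, q) else 0)"
      using True W Cons.prems
      by (intro sum.cong refl) (auto simp: eq munit_mult_index)
    also have "\<dots> = (\<Sum>i<n. \<Sum>j<n. if r = i then \<phi> v $$ (i, j) * wval n \<phi> w $$ (j, q) else 0)"
      by (simp add: sum.cartesian_product case_prod_beta cong: if_cong)
    also have "\<dots> = (\<Sum>i<n. if r = i then \<Sum>j<n. \<phi> v $$ (i, j) * wval n \<phi> w $$ (j, q) else 0)"
      by (intro sum.cong) auto
    also have "\<dots> = (\<Sum>j<n. \<phi> v $$ (r, j) * wval n \<phi> w $$ (j, q))"
      using Cons.prems by simp
    also have "\<dots> = wval n \<phi> (x # w) $$ (r, q)"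
      using True W Cons.prems by (simp add: mult_mat_index[of _ n] del: index_mult_mat)
    finally show ?thesis by (rule sym)
  next
    case False
    have IH: "wval n \<phi> w $$ (k, q) = (\<Sum>p\<in>{..<n} \<times> {..<n}. wval n (?\<phi> p) w $$ (k, q))" if "k < n" for k
      by (rule Cons.IH) (use Cons.prems False that in auto)
    have "wval n \<phi> (x # w) $$ (r, q) = (\<Sum>k<n. \<phi> x $$ (r, k) * wval n \<phi> w $$ (k, q))"
      using W Cons.prems by (simp add: mult_mat_index del: index_mult_mat)
    also have "\<dots> = (\<Sum>k<n. \<phi> x $$ (r, k) * (\<Sum>p\<in>{..<n} \<times> {..<n}. wval n (?\<phi> p) w $$ (k, q)))"
      using IH by simp
    also have "\<dots> = (\<Sum>p\<in>{..<n} \<times> {..<n}. \<Sum>k<n. \<phi> x $$ (r, k) * wval n (?\<phi> p) w $$ (k, q))"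
      unfolding sum_distrib_left by (rule sum.swap)
    also have "\<dots> = (\<Sum>p\<in>{..<n} \<times> {..<n}. wval n (?\<phi> p) (x # w) $$ (r, q))"
      using False Cons.prems by (intro sum.cong refl)
        (simp add: mult_mat_index[OF W(2) W'] del: index_mult_mat)
    finally show ?thesis .
  qed
qed simp

section \<open>Evaluations of polynomials\<close>

text \<open>The sum over the words is taken entry by entry, so that no finite sum in a module record
  has to be handled; \<open>eval_poly_eq\<close> makes the link to \<open>eval_poly\<close>.\<close>

definition ev :: "('k::field \<Rightarrow> 'b \<Rightarrow> 'b) \<Rightarrow> nat \<Rightarrow> ('v \<Rightarrow> 'b::ring_1 mat) \<Rightarrow> ('k, 'v) free_poly \<Rightarrow> 'b mat"
  where "ev s n \<phi> f = mat n n (\<lambda>p. \<Sum>w\<in>Poly_Mapping.keys f. s (Poly_Mapping.lookup f w) (wval n \<phi> w $$ p))"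

lemma ev_carrier [simp]: "ev s n \<phi> f \<in> carrier_mat n n"
  by (simp add: ev_def)

lemma ev_index:
  "r < n \<Longrightarrow> q < n \<Longrightarrow> ev s n \<phi> f $$ (r, q) =
     (\<Sum>w\<in>Poly_Mapping.keys f. s (Poly_Mapping.lookup f w) (wval n \<phi> w $$ (r, q)))"
  by (simp add: ev_def)

lemma ev_cong:
  "(\<And>w v. w \<in> Poly_Mapping.keys f \<Longrightarrow> v \<in> set w \<Longrightarrow> \<phi> v = \<psi> v) \<Longrightarrow> ev s n \<phi> f = ev s n \<psi> f"
  unfolding ev_def
  by (intro eq_matI) (auto intro!: sum.cong arg_cong[where f = "\<lambda>A. s _ (A $$ _)"] wval_cong)

context unital_algebra
begin

lemma scale_mult_scale: "scale c x * scale d y = scale (c * d) (x * y)"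
  by (simp flip: scale_mult_left scale_mult_right)

lemma prod_list_scale:
  "prod_list (map (\<lambda>v. scale (\<xi> v) (b v)) w) = scale (prod_list (map \<xi> w)) (prod_list (map b w))"
  by (induction w) (auto simp: scale_mult_scale)

lemma ev_superset:
  assumes "finite S" "Poly_Mapping.keys f \<subseteq> S" "r < n" "q < n"
  shows "ev scale n \<phi> f $$ (r, q) = (\<Sum>w\<in>S. scale (Poly_Mapping.lookup f w) (wval n \<phi> w $$ (r, q)))"
  unfolding ev_index[OF assms(3,4)]
  by (rule sum.mono_neutral_left) (use assms in \<open>auto simp: in_keys_iff\<close>)

lemma ev_add_index:
  assumes "r < n" "q < n"
  shows "ev scale n \<phi> (f + g) $$ (r, q) = ev scale n \<phi> f $$ (r, q) + ev scale n \<phi> g $$ (r, q)"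
proof -
  let ?S = "Poly_Mapping.keys f \<union> Poly_Mapping.keys g"
  have "ev scale n \<phi> h $$ (r, q) = (\<Sum>w\<in>?S. scale (Poly_Mapping.lookup h w) (wval n \<phi> w $$ (r, q)))"
    if "h \<in> {f, g, f + g}" for h
    using that assms by (intro ev_superset) (auto dest: subsetD[OF Poly_Mapping.keys_add])
  then show ?thesis by (simp add: lookup_add scale_left_distrib sum.distrib)
qed

lemma ev_zero_index: "r < n \<Longrightarrow> q < n \<Longrightarrow> ev scale n \<phi> 0 $$ (r, q) = 0"
  by (simp add: ev_index)

lemma ev_single_index:
  "r < n \<Longrightarrow> q < n \<Longrightarrow> ev scale n \<phi> (Poly_Mapping.single w c) $$ (r, q) = scale c (wval n \<phi> w $$ (r, q))"
  by (simp add: ev_index)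

lemma ev_sum_index:
  assumes "r < n" "q < n"
  shows "ev scale n \<phi> (\<Sum>a\<in>A. f a) $$ (r, q) = (\<Sum>a\<in>A. ev scale n \<phi> (f a) $$ (r, q))"
  by (induction A rule: infinite_finite_induct) (simp_all add: assms ev_add_index ev_zero_index)

lemma ev_expand:
  assumes "\<And>w. w \<in> Poly_Mapping.keys f \<Longrightarrow> distinct w \<and> v \<in> set w" "r < n" "q < n"
    and "\<And>w u. w \<in> Poly_Mapping.keys f \<Longrightarrow> u \<in> set w \<Longrightarrow> \<phi> u \<in> carrier_mat n n"
  shows "ev scale n \<phi> f $$ (r, q) =
    (\<Sum>p\<in>{..<n} \<times> {..<n}. ev scale n (\<phi>(v := munit n p (\<phi> v $$ p))) f $$ (r, q))"
proof -
  have "ev scale n \<phi> f $$ (r, q) = (\<Sum>w\<in>Poly_Mapping.keys f. scale (Poly_Mapping.lookup f w)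
      (\<Sum>p\<in>{..<n} \<times> {..<n}. wval n (\<phi>(v := munit n p (\<phi> v $$ p))) w $$ (r, q)))"
    unfolding ev_index[OF assms(2,3)]
    by (intro sum.cong refl arg_cong2[where f = scale] wval_expand) (use assms in auto)
  also have "\<dots> = (\<Sum>p\<in>{..<n} \<times> {..<n}. ev scale n (\<phi>(v := munit n p (\<phi> v $$ p))) f $$ (r, q))"
    unfolding scale_sum_right ev_index[OF assms(2,3)] by (rule sum.swap)
  finally show ?thesis .
qed

end

text \<open>The product of the free algebra. It serves to form powers, by which a polynomial with
  strictly block-triangular values becomes an identity.\<close>

definition fmul :: "('k::field, 'v) free_poly \<Rightarrow> ('k, 'v) free_poly \<Rightarrow> ('k, 'v) free_poly" where
  "fmul f g = (\<Sum>u\<in>Poly_Mapping.keys f. \<Sum>w\<in>Poly_Mapping.keys g.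
     Poly_Mapping.single (u @ w) (Poly_Mapping.lookup f u * Poly_Mapping.lookup g w))"

primrec fpow :: "('k::field, 'v) free_poly \<Rightarrow> nat \<Rightarrow> ('k, 'v) free_poly" where
  "fpow f 0 = Poly_Mapping.single [] 1"
| "fpow f (Suc N) = fmul f (fpow f N)"

lemma keys_sum_subset:
  "Poly_Mapping.keys (\<Sum>a\<in>A. f a) \<subseteq> (\<Union>a\<in>A. Poly_Mapping.keys (f a))"
proof (induction A rule: infinite_finite_induct)
  case (insert x F)
  then show ?case using Poly_Mapping.keys_add[of "f x" "\<Sum>a\<in>F. f a"] by auto
qed auto

lemma keys_fmul: 
  assumes "x \<in> Poly_Mapping.keys (fmul f g)"
  obtains u w where "u \<in> Poly_Mapping.keys f" "w \<in> Poly_Mapping.keys g" "x = u @ w"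
proof -
  let ?s = "\<lambda>u w. Poly_Mapping.single (u @ w) (Poly_Mapping.lookup f u * Poly_Mapping.lookup g w)"
  obtain u where u: "u \<in> Poly_Mapping.keys f" "x \<in> Poly_Mapping.keys (\<Sum>w\<in>Poly_Mapping.keys g. ?s u w)"
    using subsetD[OF keys_sum_subset assms[unfolded fmul_def]] by (elim UN_E)
  obtain w where w: "w \<in> Poly_Mapping.keys g" "x \<in> Poly_Mapping.keys (?s u w)"
    using subsetD[OF keys_sum_subset u(2)] by (elim UN_E)
  have "x = u @ w" using w(2) by (simp split: if_splits)
  with u(1) w(1) show ?thesis by (rule that)
qed

lemma keys_fpow:
  assumes "w \<in> Poly_Mapping.keys (fpow f N)" "\<And>w. w \<in> Poly_Mapping.keys f \<Longrightarrow> set w \<subseteq> S"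
  shows "set w \<subseteq> S"
  using assms(1)
proof (induction N arbitrary: w)
  case (Suc N)
  then obtain u v where "u \<in> Poly_Mapping.keys f" "v \<in> Poly_Mapping.keys (fpow f N)" "w = u @ v"
    by (auto elim: keys_fmul)
  then show ?case using Suc.IH assms(2) by auto
qed (auto split: if_splits)

lemma (in unital_algebra) ev_fmul:
  assumes "\<And>w v. w \<in> Poly_Mapping.keys f \<union> Poly_Mapping.keys g \<Longrightarrow> v \<in> set w \<Longrightarrow> \<phi> v \<in> carrier_mat n n"
  shows "ev scale n \<phi> (fmul f g) = ev scale n \<phi> f * ev scale n \<phi> g"
proof (rule eq_matI)
  fix r q assume "r < dim_row (ev scale n \<phi> f * ev scale n \<phi> g)" "q < dim_col (ev scale n \<phi> f * ev scale n \<phi> g)"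
  then have rq: "r < n" "q < n" by (simp_all add: ev_def)
  let ?F = "Poly_Mapping.keys f" and ?G = "Poly_Mapping.keys g"
  let ?f = "Poly_Mapping.lookup f" and ?g = "Poly_Mapping.lookup g"
  have w: "wval n \<phi> (u @ w) $$ (r, q) = (\<Sum>k<n. wval n \<phi> u $$ (r, k) * wval n \<phi> w $$ (k, q))"
    if "u \<in> ?F" "w \<in> ?G" for u w
  proof -
    have "wval n \<phi> (u @ w) = wval n \<phi> u * wval n \<phi> w"
      using that assms by (intro wval_append) auto
    moreover have "wval n \<phi> u \<in> carrier_mat n n" "wval n \<phi> w \<in> carrier_mat n n"
      using that assms by (auto intro!: wval_carrier)
    ultimately show ?thesis using rq by (simp add: mult_mat_index del: index_mult_mat)
  qed
  have "ev scale n \<phi> (fmul f g) $$ (r, q) =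
     (\<Sum>u\<in>?F. \<Sum>w\<in>?G. scale (?f u * ?g w) (wval n \<phi> (u @ w) $$ (r, q)))"
    unfolding fmul_def using rq by (simp add: ev_sum_index ev_single_index)
  also have "\<dots> = (\<Sum>u\<in>?F. \<Sum>w\<in>?G. \<Sum>k<n. scale (?f u) (wval n \<phi> u $$ (r, k)) * scale (?g w) (wval n \<phi> w $$ (k, q)))"
    by (intro sum.cong refl) (simp add: w scale_sum_right scale_mult_scale)
  also have "\<dots> = (\<Sum>u\<in>?F. \<Sum>k<n. \<Sum>w\<in>?G. scale (?f u) (wval n \<phi> u $$ (r, k)) * scale (?g w) (wval n \<phi> w $$ (k, q)))"
    by (rule sum.cong[OF refl], rule sum.swap)
  also have "\<dots> = (\<Sum>k<n. \<Sum>u\<in>?F. \<Sum>w\<in>?G. scale (?f u) (wval n \<phi> u $$ (r, k)) * scale (?g w) (wval n \<phi> w $$ (k, q)))"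
    by (rule sum.swap)
  also have "\<dots> = (\<Sum>k<n. ev scale n \<phi> f $$ (r, k) * ev scale n \<phi> g $$ (k, q))"
    using rq by (intro sum.cong refl) (simp add: ev_index sum_product)
  also have "\<dots> = (ev scale n \<phi> f * ev scale n \<phi> g) $$ (r, q)"
    using rq by (intro mult_mat_index[symmetric]) simp_all
  finally show "ev scale n \<phi> (fmul f g) $$ (r, q) = (ev scale n \<phi> f * ev scale n \<phi> g) $$ (r, q)" .
qed (simp_all add: ev_def)

section \<open>Alternating sums\<close>

text \<open>The Young subgroup of the symmetric group of \<open>W\<close> that belongs to the
  partition by \<open>cls\<close>.\<close>

definition class_perms :: "('v \<Rightarrow> 'c) \<Rightarrow> 'v set \<Rightarrow> ('v \<Rightarrow> 'v) set" where
  "class_perms cls W = {\<sigma>. \<sigma> permutes W \<and> (\<forall>v\<in>W. cls (\<sigma> v) = cls v)}"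

lemma finite_class_perms: "finite W \<Longrightarrow> finite (class_perms cls W)"
  unfolding class_perms_def by (rule finite_subset[OF _ finite_permutations]) auto

lemma id_class_perms: "id \<in> class_perms cls W"
  by (auto simp: class_perms_def permutes_id)

lemma class_perms_cls: "\<sigma> \<in> class_perms cls W \<Longrightarrow> v \<in> W \<Longrightarrow> cls (\<sigma> v) = cls v"
  by (simp add: class_perms_def)

lemma class_perms_permutes: "\<sigma> \<in> class_perms cls W \<Longrightarrow> \<sigma> permutes W"
  by (simp add: class_perms_def)

text \<open>Left multiplication by the transposition of two positions of the same class is a
  sign-reversing involution.\<close>

lemma (in unital_algebra) alternating_sum_zero:
  fixes F :: "('v \<Rightarrow> 'v) \<Rightarrow> 'b"
  assumes "(2 :: 'k) \<noteq> 0" "finite W" "x \<in> W" "y \<in> W" "x \<noteq> y" "cls x = cls y"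
    and "\<And>\<sigma>. \<sigma> \<in> class_perms cls W \<Longrightarrow> F (transpose x y \<circ> \<sigma>) = F \<sigma>"
  shows "(\<Sum>\<sigma>\<in>class_perms cls W. scale (of_int (sign \<sigma>)) (F \<sigma>)) = 0" (is "?S = 0")
proof -
  let ?P = "class_perms cls W" and ?t = "transpose x y"
  have tt: "?t \<circ> (?t \<circ> \<sigma>) = \<sigma>" for \<sigma> :: "'v \<Rightarrow> 'v" by (auto simp: fun_eq_iff)
  have cl: "?t \<circ> \<sigma> \<in> ?P" if "\<sigma> \<in> ?P" for \<sigma>
    using that assms permutes_swap_id[of x W y]
    by (auto simp: class_perms_def permutes_compose transpose_def)
  have bij: "bij_betw (\<lambda>\<sigma>. ?t \<circ> \<sigma>) ?P ?P"
    by (rule bij_betw_byWitness[where f' = "\<lambda>\<sigma>. ?t \<circ> \<sigma>"]) (auto simp: tt cl)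
  have sgn: "sign (?t \<circ> \<sigma>) = - sign \<sigma>" if "\<sigma> \<in> ?P" for \<sigma>
    using that assms by (subst sign_compose)
      (auto simp: sign_swap_id permutation_swap_id class_perms_def intro: permutation_permutes[THEN iffD2])
  have "?S = (\<Sum>\<sigma>\<in>?P. scale (of_int (sign (?t \<circ> \<sigma>))) (F (?t \<circ> \<sigma>)))"
    by (rule sum.reindex_bij_betw[OF bij, symmetric])
  also have "\<dots> = (\<Sum>\<sigma>\<in>?P. - scale (of_int (sign \<sigma>)) (F \<sigma>))"
    by (intro sum.cong refl) (simp add: sgn assms(7))
  also have "\<dots> = - ?S" by (simp add: sum_negf)
  finally have "?S + ?S = 0" by (simp only: eq_neg_iff_add_eq_0)
  moreover have "scale 2 ?S = ?S + ?S"
    using scale_left_distrib[of 1 1 ?S] by simp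
  ultimately have "scale 2 ?S = 0" by simp
  then show ?thesis using assms(1) by simp
qed

section \<open>Graded division algebras and their matrix algebras\<close>

text \<open>The direct sum is split into generation and independence of the components, which apply
  to any finite family of homogeneous elements. \<open>H\<close> is the support.\<close>

locale gda = comm_group G + unital_algebra s
  for G :: "'g monoid" (structure) and s :: "'k::field_char_0 \<Rightarrow> 'b::ring_1 \<Rightarrow> 'b" +
  fixes D :: "'g \<Rightarrow> 'b set" and H :: "'g set"
  assumes H_subgroup: "subgroup H G"
    and D_zero: "g \<in> carrier G \<Longrightarrow> 0 \<in> D g"
    and D_add: "g \<in> carrier G \<Longrightarrow> x \<in> D g \<Longrightarrow> y \<in> D g \<Longrightarrow> x + y \<in> D g"
    and D_scale: "g \<in> carrier G \<Longrightarrow> x \<in> D g \<Longrightarrow> s c x \<in> D g"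
    and D_mult: "g \<in> carrier G \<Longrightarrow> h \<in> carrier G \<Longrightarrow> x \<in> D g \<Longrightarrow> y \<in> D h \<Longrightarrow> x * y \<in> D (g \<otimes> h)"
    and D_outside: "g \<in> carrier G \<Longrightarrow> g \<notin> H \<Longrightarrow> x \<in> D g \<Longrightarrow> x = 0"
    and D_nontriv: "h \<in> H \<Longrightarrow> \<exists>x\<in>D h. x \<noteq> 0"
    and D_inverse: "g \<in> carrier G \<Longrightarrow> x \<in> D g \<Longrightarrow> x \<noteq> 0 \<Longrightarrow> \<exists>y\<in>D (inv g). x * y = 1 \<and> y * x = 1"
    and D_one_dim: "g \<in> carrier G \<Longrightarrow> x \<in> D g \<Longrightarrow> y \<in> D g \<Longrightarrow> x \<noteq> 0 \<Longrightarrow> \<exists>c. y = s c x"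
    and D_generate: "\<exists>S z. finite S \<and> S \<subseteq> carrier G \<and> (\<forall>h\<in>S. z h \<in> D h) \<and> x = (\<Sum>h\<in>S. z h)"
    and D_independent: "finite S \<Longrightarrow> S \<subseteq> carrier G \<Longrightarrow> (\<And>h. h \<in> S \<Longrightarrow> z h \<in> D h) \<Longrightarrow>
      (\<Sum>h\<in>S. z h) = 0 \<Longrightarrow> h \<in> S \<Longrightarrow> z h = 0"
begin

lemma H_carrier [simp]: "h \<in> H \<Longrightarrow> h \<in> carrier G"
  using H_subgroup by (rule subgroup.mem_carrier)

lemma one_D: "1 \<in> D \<one>"
proof -
  obtain x where x: "x \<in> D \<one>" "x \<noteq> 0"
    using D_nontriv subgroup.one_closed[OF H_subgroup] by blast
  then obtain y where "y \<in> D (inv \<one>)" "x * y = 1" using D_inverse one_closed by blast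
  with x D_mult[of \<one> "inv \<one>" x y] show ?thesis by simp
qed

lemma D_mult_nonzero:
  assumes "g \<in> carrier G" "x \<in> D g" "x \<noteq> 0" "y \<noteq> 0"
  shows "x * y \<noteq> 0"
proof
  assume "x * y = 0"
  moreover obtain z where "z * x = 1" using D_inverse assms by blast
  ultimately have "y = 0" by (metis mult.assoc mult_1 mult_zero_right)
  with assms show False by simp
qed

lemma prod_list_nonzero:
  assumes "\<And>v. v \<in> set w \<Longrightarrow> d v \<in> carrier G \<and> b v \<in> D (d v) \<and> b v \<noteq> 0"
  shows "prod_list (map b w) \<noteq> 0"
  using assms
proof (induction w)
  case (Cons a w)
  then show ?case using D_mult_nonzero[of "d a" "b a"] by simp
qed simp

end

lemma prod_list_zero_mem: "(0 :: 'b::ring_1) \<in> set xs \<Longrightarrow> prod_list xs = 0"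
  by (induction xs) auto

text \<open>Blocks are given by a surjection \<open>blk\<close> onto \<open>{..<m}\<close>, so
  triangularity refers to the order of the block numbers and not to the order of the
  indices.\<close>

locale utg = gda G s D H
  for G :: "'g monoid" (structure) and s :: "'k::field_char_0 \<Rightarrow> 'b::ring_1 \<Rightarrow> 'b"
    and D :: "'g \<Rightarrow> 'b set" and H :: "'g set" +
  fixes n m :: nat and blk :: "nat \<Rightarrow> nat" and g :: "nat \<Rightarrow> 'g"
  assumes g_carrier [simp]: "i < n \<Longrightarrow> g i \<in> carrier G"
    and blk_less: "i < n \<Longrightarrow> blk i < m"
    and blk_surj: "b < m \<Longrightarrow> \<exists>i<n. blk i = b"
    and m_pos: "0 < m"
begin

definition utc :: "'b mat set" where
  "utc = {M \<in> carrier_mat n n. \<forall>i<n. \<forall>j<n. blk j < blk i \<longrightarrow> M $$ (i, j) = 0}"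

text \<open>Solves \<open>g i \<otimes> h \<otimes> inv (g j) = d\<close> for the degree
  \<open>h\<close> of the entry: homogeneity of a matrix becomes a condition on each entry.\<close>

definition comp :: "'g \<Rightarrow> 'b mat set" where
  "comp d = {M \<in> utc. \<forall>i<n. \<forall>j<n. M $$ (i, j) \<in> D (inv (g i) \<otimes> d \<otimes> g j)}"

definition ids :: "('k, nat \<times> 'g) free_poly set" where
  "ids = {f. (\<forall>w\<in>Poly_Mapping.keys f. set w \<subseteq> UNIV \<times> carrier G) \<and>
     (\<forall>\<phi>. (\<forall>i. \<forall>d\<in>carrier G. \<phi> (i, d) \<in> comp d) \<longrightarrow> ev s n \<phi> f = 0\<^sub>m n n)}"

text \<open>The positions at which a matrix of degree \<open>d\<close> can have a nonzero
  entry.\<close>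

definition adm :: "'g \<Rightarrow> nat \<times> nat \<Rightarrow> bool" where
  "adm d e \<longleftrightarrow> fst e < n \<and> snd e < n \<and> blk (fst e) \<le> blk (snd e) \<and>
     inv (g (fst e)) \<otimes> d \<otimes> g (snd e) \<in> H"

lemma comp_carrier: "M \<in> comp d \<Longrightarrow> M \<in> carrier_mat n n"
  by (simp add: comp_def utc_def)

lemma munit_comp:
  assumes "d \<in> carrier G" "fst e < n" "snd e < n" "blk (fst e) \<le> blk (snd e)"
    "b \<in> D (inv (g (fst e)) \<otimes> d \<otimes> g (snd e))"
  shows "munit n e b \<in> comp d"
  using assms by (auto simp: comp_def utc_def D_zero)

lemma zero_comp: "d \<in> carrier G \<Longrightarrow> 0\<^sub>m n n \<in> comp d"
  by (auto simp: comp_def utc_def D_zero)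

text \<open>Every variable occurs exactly once in every word, so the value is a sum over the entries
  of the values of the variables. One variable after the other is replaced by a single entry that
  keeps the value nonzero.\<close>

lemma basis_reduction:
  fixes f :: "('k, nat \<times> 'g) free_poly"
  assumes f: "\<And>w. w \<in> Poly_Mapping.keys f \<Longrightarrow> distinct w \<and> set w = V"
    and V: "V \<subseteq> UNIV \<times> carrier G" "finite V"
    and \<phi>: "\<And>v. v \<in> V \<Longrightarrow> \<phi> v \<in> comp (snd v)"
    and rq: "r < n" "q < n"
    and nz: "ev s n \<phi> f $$ (r, q) \<noteq> 0"
  obtains e b where
    "\<And>v. v \<in> V \<Longrightarrow> adm (snd v) (e v) \<and> b v \<noteq> 0 \<and>
       b v \<in> D (inv (g (fst (e v))) \<otimes> snd v \<otimes> g (snd (e v)))"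
    "ev s n (\<lambda>v. munit n (e v) (b v)) f $$ (r, q) \<noteq> 0"
proof -
  have "\<exists>\<psi>. (\<forall>v\<in>V. \<psi> v \<in> comp (snd v)) \<and>
      (\<forall>v\<in>U. \<exists>p b. \<psi> v = munit n p b \<and> fst p < n \<and> snd p < n) \<and> ev s n \<psi> f $$ (r, q) \<noteq> 0"
    if "finite U" "U \<subseteq> V" for U
    using that
  proof (induction U)
    case empty
    then show ?case using \<phi> nz by blast
  next
    case (insert v U)
    then obtain \<psi> where \<psi>: "\<forall>v\<in>V. \<psi> v \<in> comp (snd v)"
      "\<forall>v\<in>U. \<exists>p b. \<psi> v = munit n p b \<and> fst p < n \<and> snd p < n" "ev s n \<psi> f $$ (r, q) \<noteq> 0"
      by auto
    have v: "v \<in> V" "v \<notin> U" using insert by auto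
    have "ev s n \<psi> f $$ (r, q) =
        (\<Sum>p\<in>{..<n} \<times> {..<n}. ev s n (\<psi>(v := munit n p (\<psi> v $$ p))) f $$ (r, q))"
    proof (rule ev_expand)
      show "\<psi> u \<in> carrier_mat n n" if "w \<in> Poly_Mapping.keys f" "u \<in> set w" for w u
        using \<psi>(1) f[OF that(1)] that(2) comp_carrier by blast
    qed (use f v rq in simp_all)
    also have "\<dots> = 0" if "\<forall>p\<in>{..<n} \<times> {..<n}. ev s n (\<psi>(v := munit n p (\<psi> v $$ p))) f $$ (r, q) = 0"
      using that by (intro sum.neutral)
    finally obtain p where p: "p \<in> {..<n} \<times> {..<n}"
      "ev s n (\<psi>(v := munit n p (\<psi> v $$ p))) f $$ (r, q) \<noteq> 0"
      using \<psi>(3) by blast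
    have pn: "fst p < n" "snd p < n" using p(1) by auto
    have d: "snd v \<in> carrier G" using v V by auto
    have c: "munit n p (\<psi> v $$ p) \<in> comp (snd v)"
    proof (cases "blk (fst p) \<le> blk (snd p)")
      case True
      have "\<psi> v $$ (fst p, snd p) \<in> D (inv (g (fst p)) \<otimes> snd v \<otimes> g (snd p))"
        using \<psi>(1) v(1) pn unfolding comp_def by blast
      with True show ?thesis using d pn by (intro munit_comp) auto
    next
      case False
      have "\<psi> v $$ (fst p, snd p) = 0"
        using \<psi>(1) v(1) pn False unfolding comp_def utc_def by (auto simp del: prod.collapse)
      then have "munit n p (\<psi> v $$ p) = 0\<^sub>m n n" by (auto intro!: eq_matI simp: munit_def)
      then show ?thesis using zero_comp[OF d] by simp
    qed
    let ?\<chi> = "\<psi>(v := munit n p (\<psi> v $$ p))"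
    have "\<forall>u\<in>V. ?\<chi> u \<in> comp (snd u)" using \<psi>(1) c by simp
    moreover have "\<forall>u\<in>insert v U. \<exists>p b. ?\<chi> u = munit n p b \<and> fst p < n \<and> snd p < n"
    proof
      fix u assume u: "u \<in> insert v U"
      show "\<exists>p b. ?\<chi> u = munit n p b \<and> fst p < n \<and> snd p < n"
      proof (cases "u = v")
        case True
        then show ?thesis using pn by (intro exI[of _ p] exI[of _ "\<psi> v $$ p"]) simp
      next
        case False
        then show ?thesis using \<psi>(2) u by simp
      qed
    qed
    ultimately show ?case using p(2) by blast
  qed
  from this[OF V(2) subset_refl] obtain \<psi> where \<psi>: "\<forall>v\<in>V. \<psi> v \<in> comp (snd v)"
    "\<forall>v\<in>V. \<exists>p b. \<psi> v = munit n p b \<and> fst p < n \<and> snd p < n" "ev s n \<psi> f $$ (r, q) \<noteq> 0"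
    by blast
  from \<psi>(2) obtain e b where eb: "\<And>v. v \<in> V \<Longrightarrow> \<psi> v = munit n (e v) (b v) \<and> fst (e v) < n \<and> snd (e v) < n"
    by metis
  have eq: "ev s n \<psi> f = ev s n (\<lambda>v. munit n (e v) (b v)) f"
    by (rule ev_cong) (use f eb in auto)
  show ?thesis
  proof (rule that[of e b])
    fix v assume v: "v \<in> V"
    have bv: "b v = \<psi> v $$ (fst (e v), snd (e v))" using eb[OF v] by (simp del: prod.collapse) simp
    have 1: "b v \<in> D (inv (g (fst (e v))) \<otimes> snd v \<otimes> g (snd (e v)))"
      using \<psi>(1) v eb[OF v] unfolding bv comp_def by blast
    \<comment> \<open>Each word contains \<open>v\<close>, so a vanishing coefficient would
      annihilate all of them.\<close>
    have 2: "b v \<noteq> 0"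
    proof
      assume b0: "b v = 0"
      have "wval n (\<lambda>v. munit n (e v) (b v)) w $$ (r, q) = 0" if "w \<in> Poly_Mapping.keys f" for w
      proof -
        have "prod_list (map b w) = 0"
          using f[OF that] v b0 by (intro prod_list_zero_mem) (metis image_eqI set_map)
        then show ?thesis using f[OF that] eb rq by (subst wval_munit) auto
      qed
      then have "ev s n (\<lambda>v. munit n (e v) (b v)) f $$ (r, q) = 0"
        using rq by (simp add: ev_index)
      with \<psi>(3) eq show False by simp
    qed
    have 3: "blk (fst (e v)) \<le> blk (snd (e v))"
    proof (rule ccontr)
      assume "\<not> blk (fst (e v)) \<le> blk (snd (e v))"
      moreover have "\<psi> v \<in> utc" using \<psi>(1) v by (simp add: comp_def)
      ultimately have "b v = 0" using eb[OF v] unfolding bv utc_def by (simp del: prod.collapse)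
      with 2 show False by simp
    qed
    have "inv (g (fst (e v))) \<otimes> snd v \<otimes> g (snd (e v)) \<in> carrier G"
      using v V eb[OF v] by auto
    with 1 2 D_outside have "inv (g (fst (e v))) \<otimes> snd v \<otimes> g (snd (e v)) \<in> H" by blast
    with 1 2 3 eb[OF v] show "adm (snd v) (e v) \<and> b v \<noteq> 0 \<and>
       b v \<in> D (inv (g (fst (e v))) \<otimes> snd v \<otimes> g (snd (e v)))" by (simp add: adm_def)
  qed (use \<psi>(3) eq in simp)
qed

end

section \<open>Transfer of rigid walks\<close>

text \<open>Only one inclusion is fixed here, the one that transfers nonzero values from the first
  algebra to the second. Each transfer can then be instantiated in either direction.\<close>

locale two = A: utg G s D H n m blk g + B: utg G s' D' H' n' m' blk' g'
  for G :: "'g monoid" (structure)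
    and s :: "'k::field_char_0 \<Rightarrow> 'b::ring_1 \<Rightarrow> 'b" and D H n m blk g
    and s' :: "'k \<Rightarrow> 'c::ring_1 \<Rightarrow> 'c" and D' H' n' m' blk' g' +
  assumes ids_sub: "B.ids \<subseteq> A.ids"
begin

lemma nonidentity_transfer:
  fixes f :: "('k, nat \<times> 'g) free_poly"
  assumes "\<And>w. w \<in> Poly_Mapping.keys f \<Longrightarrow> set w \<subseteq> UNIV \<times> carrier G"
    and "\<And>i d. d \<in> carrier G \<Longrightarrow> \<phi> (i, d) \<in> A.comp d"
    and "ev s n \<phi> f \<noteq> 0\<^sub>m n n"
  obtains \<psi> where "\<And>i d. d \<in> carrier G \<Longrightarrow> \<psi> (i, d) \<in> B.comp d" "ev s' n' \<psi> f \<noteq> 0\<^sub>m n' n'"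
proof -
  have "f \<notin> A.ids" using assms unfolding A.ids_def by blast
  then have "f \<notin> B.ids" using ids_sub by blast
  then show ?thesis using that assms(1) unfolding B.ids_def by blast
qed

text \<open>\<open>cls\<close> may be finer than the partition by degree. Fine classes make rigidity
  easy to verify, coarse ones give more injectivity, and each application has to balance the
  two.\<close>

lemma transfer_walk:
  fixes w :: "'v list" and deg :: "'v \<Rightarrow> 'g" and cls :: "'v \<Rightarrow> 'c2"
  assumes w: "distinct w" and deg: "\<And>v. v \<in> set w \<Longrightarrow> deg v \<in> carrier G"
    and cls: "\<And>u v. u \<in> set w \<Longrightarrow> v \<in> set w \<Longrightarrow> cls u = cls v \<Longrightarrow> deg u = deg v"
    and e: "\<And>v. v \<in> set w \<Longrightarrow> A.adm (deg v) (e v)"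
    and walk: "walk e r w q" "r < n" "q < n"
    and rigid: "\<And>\<sigma>. \<sigma> \<in> class_perms cls (set w) \<Longrightarrow> walk (e \<circ> \<sigma>) r w q \<Longrightarrow> \<sigma> = id"
  obtains r' q' e' where "r' < n'" "q' < n'" "walk e' r' w q'"
    "\<And>v. v \<in> set w \<Longrightarrow> B.adm (deg v) (e' v)"
    "\<And>u v. u \<in> set w \<Longrightarrow> v \<in> set w \<Longrightarrow> cls u = cls v \<Longrightarrow> e' u = e' v \<Longrightarrow> u = v"
proof -
  let ?P = "class_perms cls (set w)"
  obtain idx :: "'v \<Rightarrow> nat" where idx: "inj_on idx (set w)"
    using finite_imp_inj_to_nat_seg[OF finite_set[of w]] by blast
  \<comment> \<open>Letters become graded variables: the index keeps them distinct, the second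
    component records the degree.\<close>
  define var where "var v = (idx v, deg v)" for v
  define iv where "iv = inv_into (set w) var"
  have var: "inj_on var (set w)" using idx by (auto simp: inj_on_def var_def)
  then have iv [simp]: "v \<in> set w \<Longrightarrow> iv (var v) = v" for v by (simp add: iv_def)
  define V where "V = var ` set w"
  have V: "V \<subseteq> UNIV \<times> carrier G" "finite V" using deg by (auto simp: V_def var_def)
  define f :: "('k, nat \<times> 'g) free_poly" where
    "f = (\<Sum>\<sigma>\<in>?P. Poly_Mapping.single (map (var \<circ> \<sigma>) w) (of_int (sign \<sigma>)))"
  have perm: "\<sigma> permutes set w" if "\<sigma> \<in> ?P" for \<sigma> using that by (rule class_perms_permutes)
  have mem: "\<sigma> v \<in> set w" if "\<sigma> \<in> ?P" "v \<in> set w" for \<sigma> v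
    using perm[OF that(1)] that(2) by (simp add: permutes_in_image)
  have keys: "distinct u \<and> set u = V" if u: "u \<in> Poly_Mapping.keys f" for u
  proof -
    obtain \<sigma> where \<sigma>: "\<sigma> \<in> ?P" "u = map (var \<circ> \<sigma>) w"
      using subsetD[OF keys_sum_subset u[unfolded f_def]] by (auto split: if_splits)
    have "\<sigma> ` set w = set w" "inj_on \<sigma> (set w)" using perm[OF \<sigma>(1)]
      by (auto simp: permutes_image intro: permutes_inj_on)
    then have "inj_on (var \<circ> \<sigma>) (set w)" "(var \<circ> \<sigma>) ` set w = V"
      using var by (simp_all only: V_def image_comp[symmetric]) (intro comp_inj_on; simp)
    then show ?thesis using w by (simp add: \<sigma>(2) distinct_map)
  qed
  have keys': "set u \<subseteq> UNIV \<times> carrier G" if "u \<in> Poly_Mapping.keys f" for u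
    using keys[OF that] V(1) by simp
  have "\<forall>v\<in>set w. \<exists>b. b \<in> D (inv (g (fst (e v))) \<otimes> deg v \<otimes> g (snd (e v))) \<and> b \<noteq> 0"
    using A.D_nontriv e unfolding A.adm_def by blast
  then obtain b where b: "\<And>v. v \<in> set w \<Longrightarrow>
      b v \<in> D (inv (g (fst (e v))) \<otimes> deg v \<otimes> g (snd (e v))) \<and> b v \<noteq> 0"
    by metis
  define \<phi> where "\<phi> u = (if u \<in> V then munit n (e (iv u)) (b (iv u)) else 0\<^sub>m n n)" for u
  have \<phi>: "\<phi> (i, d) \<in> A.comp d" if d: "d \<in> carrier G" for i d
  proof (cases "(i, d) \<in> V")
    case True
    then obtain v where v: "v \<in> set w" "(i, d) = var v" by (auto simp: V_def)
    have "munit n (e v) (b v) \<in> A.comp (deg v)"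
      using b[OF v(1)] e[OF v(1)] deg[OF v(1)] by (intro A.munit_comp) (auto simp: A.adm_def)
    then show ?thesis using v True by (simp add: \<phi>_def) (simp add: var_def)
  qed (simp add: \<phi>_def A.zero_comp d)
  have snd_e: "snd (e v) < n" if "v \<in> set w" for v using e[OF that] by (simp add: A.adm_def)
  have "ev s n \<phi> f $$ (r, q) = (\<Sum>\<sigma>\<in>?P. s (of_int (sign \<sigma>)) (wval n (\<phi> \<circ> (var \<circ> \<sigma>)) w $$ (r, q)))"
    unfolding f_def using walk by (simp add: A.ev_sum_index A.ev_single_index flip: wval_map)
  \<comment> \<open>Rigidity leaves only the summand of the identity.\<close>
  also have "\<dots> = (\<Sum>\<sigma>\<in>?P. if \<sigma> = id then prod_list (map b w) else 0)"
  proof (rule sum.cong[OF refl])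
    fix \<sigma> assume \<sigma>: "\<sigma> \<in> ?P"
    have "wval n (\<phi> \<circ> (var \<circ> \<sigma>)) w $$ (r, q) =
        (if walk (e \<circ> \<sigma>) r w q then prod_list (map (b \<circ> \<sigma>) w) else 0)"
      using walk mem[OF \<sigma>] snd_e by (intro wval_munit) (auto simp: \<phi>_def V_def)
    then show "s (of_int (sign \<sigma>)) (wval n (\<phi> \<circ> (var \<circ> \<sigma>)) w $$ (r, q)) =
        (if \<sigma> = id then prod_list (map b w) else 0)"
      using rigid[OF \<sigma>] walk by (auto simp: sign_id)
  qed
  also have "\<dots> = prod_list (map b w)"
    by (simp add: finite_class_perms id_class_perms)
  also have "\<dots> \<noteq> 0"
    by (rule A.prod_list_nonzero[where d = "\<lambda>v. inv (g (fst (e v))) \<otimes> deg v \<otimes> g (snd (e v))"])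
      (use b e deg in \<open>auto simp: A.adm_def\<close>)
  finally have "ev s n \<phi> f \<noteq> 0\<^sub>m n n" using walk by auto
  then obtain \<psi> where \<psi>: "\<And>i d. d \<in> carrier G \<Longrightarrow> \<psi> (i, d) \<in> B.comp d" "ev s' n' \<psi> f \<noteq> 0\<^sub>m n' n'"
    using nonidentity_transfer keys' \<phi> by blast
  obtain r' q' where rq': "r' < n'" "q' < n'" "ev s' n' \<psi> f $$ (r', q') \<noteq> 0"
  proof -
    have "\<not> (\<forall>r'<n'. \<forall>q'<n'. ev s' n' \<psi> f $$ (r', q') = 0)"
    proof
      assume "\<forall>r'<n'. \<forall>q'<n'. ev s' n' \<psi> f $$ (r', q') = 0"
      then have "ev s' n' \<psi> f = 0\<^sub>m n' n'" by (intro eq_matI) (auto simp: ev_def)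
      with \<psi>(2) show False by simp
    qed
    with that show ?thesis by blast
  qed
  have "\<psi> v \<in> B.comp (snd v)" if "v \<in> V" for v using \<psi>(1)[of "snd v" "fst v"] that V by auto
  from B.basis_reduction[OF keys V this rq'] obtain e0 b0 where
    eb0: "\<And>v. v \<in> V \<Longrightarrow> B.adm (snd v) (e0 v) \<and> b0 v \<noteq> 0 \<and>
       b0 v \<in> D' (inv (g' (fst (e0 v))) \<otimes> snd v \<otimes> g' (snd (e0 v)))"
    "ev s' n' (\<lambda>v. munit n' (e0 v) (b0 v)) f $$ (r', q') \<noteq> 0" by blast
  define e1 where "e1 v = e0 (var v)" for v
  define b1 where "b1 v = b0 (var v)" for v
  have adm1: "B.adm (deg v) (e1 v)" "b1 v \<noteq> 0"
    "b1 v \<in> D' (inv (g' (fst (e1 v))) \<otimes> deg v \<otimes> g' (snd (e1 v)))" if "v \<in> set w" for v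
    using eb0(1)[of "var v"] that by (auto simp: V_def e1_def b1_def) (auto simp: var_def)
  define F where "F c \<sigma> = (if walk (e1 \<circ> \<sigma>) r' w q' then prod_list (map (c \<circ> \<sigma>) w) else 0)"
    for c :: "'v \<Rightarrow> 'c" and \<sigma>
  have "ev s' n' (\<lambda>v. munit n' (e0 v) (b0 v)) f $$ (r', q') =
     (\<Sum>\<sigma>\<in>?P. s' (of_int (sign \<sigma>)) (wval n' ((\<lambda>v. munit n' (e0 v) (b0 v)) \<circ> (var \<circ> \<sigma>)) w $$ (r', q')))"
    unfolding f_def using rq' by (simp add: B.ev_sum_index B.ev_single_index flip: wval_map)
  also have "\<dots> = (\<Sum>\<sigma>\<in>?P. s' (of_int (sign \<sigma>)) (F b1 \<sigma>))"
  proof (rule sum.cong[OF refl])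
    fix \<sigma> assume \<sigma>: "\<sigma> \<in> ?P"
    have "wval n' ((\<lambda>v. munit n' (e0 v) (b0 v)) \<circ> (var \<circ> \<sigma>)) w $$ (r', q') = F b1 \<sigma>"
      unfolding F_def using rq' mem[OF \<sigma>] adm1(1)
      by (intro wval_munit) (auto simp: e1_def b1_def B.adm_def)
    then show "s' (of_int (sign \<sigma>)) (wval n' ((\<lambda>v. munit n' (e0 v) (b0 v)) \<circ> (var \<circ> \<sigma>)) w $$ (r', q')) =
       s' (of_int (sign \<sigma>)) (F b1 \<sigma>)" by simp
  qed
  finally have nz: "(\<Sum>\<sigma>\<in>?P. s' (of_int (sign \<sigma>)) (F b1 \<sigma>)) \<noteq> 0" using eb0(2) by simp
  have inj: "u = v" if uv: "u \<in> set w" "v \<in> set w" "cls u = cls v" "e1 u = e1 v" for u v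
  proof (rule ccontr)
    assume "u \<noteq> v"
    have "deg u = deg v" by (rule cls) (use uv in auto)
    moreover have "inv (g' (fst (e1 v))) \<otimes> deg v \<otimes> g' (snd (e1 v)) \<in> carrier G"
      using adm1(1)[OF uv(2)] deg[OF uv(2)] by (auto simp: B.adm_def)
    ultimately obtain c where c: "b1 v = s' c (b1 u)"
      using B.D_one_dim adm1(3)[OF uv(1)] adm1(3)[OF uv(2)] adm1(2)[OF uv(1)] uv(4) by metis
    \<comment> \<open>On a common edge and in a common degree the two values differ by the scalar
      \<open>c\<close>. Once \<open>c\<close> is moved to \<open>\<xi>\<close>, the remaining values
      are symmetric in \<open>u\<close> and \<open>v\<close>, and the alternating sum
      vanishes.\<close>
    define b2 where "b2 = b1(v := b1 u)"
    define \<xi> where "\<xi> = (\<lambda>_. 1)(v := c)"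
    have b1: "b1 = (\<lambda>x. s' (\<xi> x) (b2 x))" by (auto simp: \<xi>_def b2_def c)
    \<comment> \<open>Every rearranged word contains each letter once, so the product of the scalars
      does not depend on \<open>\<sigma>\<close>.\<close>
    have eq: "F b1 \<sigma> = s' (prod \<xi> (set w)) (F b2 \<sigma>)" if \<sigma>: "\<sigma> \<in> ?P" for \<sigma>
    proof -
      have "prod_list (map (b1 \<circ> \<sigma>) w) = s' (prod_list (map (\<xi> \<circ> \<sigma>) w)) (prod_list (map (b2 \<circ> \<sigma>) w))"
        using B.prod_list_scale[of "\<xi> \<circ> \<sigma>" "b2 \<circ> \<sigma>" w] by (subst b1) (simp add: o_def)
      also have "prod_list (map (\<xi> \<circ> \<sigma>) w) = prod (\<xi> \<circ> \<sigma>) (set w)"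
        using w by (simp add: prod.distinct_set_conv_list o_def)
      also have "\<dots> = prod \<xi> (set w)" by (rule prod.permute[OF perm[OF \<sigma>], symmetric])
      finally show ?thesis unfolding F_def
        by (cases "walk (e1 \<circ> \<sigma>) r' w q'") (simp_all only: if_True if_False B.scale_zero_right)
    qed
    have sym: "F b2 (transpose u v \<circ> \<sigma>) = F b2 \<sigma>" for \<sigma>
    proof -
      have "e1 \<circ> (transpose u v \<circ> \<sigma>) = e1 \<circ> \<sigma>" "b2 \<circ> (transpose u v \<circ> \<sigma>) = b2 \<circ> \<sigma>"
        using uv(4) by (auto simp: fun_eq_iff transpose_def b2_def)
      then show ?thesis by (simp only: F_def)
    qed
    have "(\<Sum>\<sigma>\<in>?P. s' (of_int (sign \<sigma>)) (F b2 \<sigma>)) = 0"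
      by (rule B.alternating_sum_zero[of "set w" u v cls "F b2"])
        (use uv \<open>u \<noteq> v\<close> sym in \<open>simp_all only: finite_set zero_neq_numeral[symmetric] not_False_eq_True\<close>)
    moreover have "(\<Sum>\<sigma>\<in>?P. s' (of_int (sign \<sigma>)) (F b1 \<sigma>)) =
        s' (prod \<xi> (set w)) (\<Sum>\<sigma>\<in>?P. s' (of_int (sign \<sigma>)) (F b2 \<sigma>))"
      unfolding B.scale_sum_right by (intro sum.cong refl) (simp add: eq mult.commute)
    ultimately show False using nz by simp
  qed
  \<comment> \<open>A nonvanishing summand provides the walk, with edges
    \<open>e1 \<circ> \<sigma>\<close>. As \<open>\<sigma>\<close> respects classes and hence
    degrees, admissibility and injectivity pass from \<open>e1\<close> to this composite.\<close>
  obtain \<sigma> where \<sigma>: "\<sigma> \<in> ?P" "walk (e1 \<circ> \<sigma>) r' w q'"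
  proof -
    have "\<exists>\<sigma>\<in>?P. F b1 \<sigma> \<noteq> 0"
    proof (rule ccontr)
      assume "\<not> (\<exists>\<sigma>\<in>?P. F b1 \<sigma> \<noteq> 0)"
      then have "(\<Sum>\<sigma>\<in>?P. s' (of_int (sign \<sigma>)) (F b1 \<sigma>)) = 0" by (intro sum.neutral) simp
      with nz show False by simp
    qed
    with that show ?thesis unfolding F_def by metis
  qed
  show ?thesis
  proof (rule that[OF rq'(1,2) \<sigma>(2)])
    show "B.adm (deg v) ((e1 \<circ> \<sigma>) v)" if "v \<in> set w" for v
      using adm1(1)[OF mem[OF \<sigma>(1) that]] cls[OF mem[OF \<sigma>(1) that] that] class_perms_cls[OF \<sigma>(1) that]
      by simp
    show "u = v" if "u \<in> set w" "v \<in> set w" "cls u = cls v" "(e1 \<circ> \<sigma>) u = (e1 \<circ> \<sigma>) v" for u v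
    proof -
      have "\<sigma> u = \<sigma> v"
        using that class_perms_cls[OF \<sigma>(1)] mem[OF \<sigma>(1)] by (intro inj) auto
      then show ?thesis using permutes_inj[OF perm[OF \<sigma>(1)]] by (auto dest: injD)
    qed
  qed
qed

end

section \<open>Computing with cosets in abelian groups\<close>

context comm_group
begin

text \<open>Ordered rewriting with \<open>m_ac\<close> puts \<open>x\<close> to the left of \<open>inv x\<close>; these rules cancel such
  pairs at bounded distance.\<close>

lemma cancel_rules:
  shows
    "x \<in> carrier G \<Longrightarrow>
      x \<otimes> inv x = \<one>"
    "x \<in> carrier G \<Longrightarrow> a \<in> carrier G \<Longrightarrow>
      x \<otimes> (inv x \<otimes> a) = a"
    "x \<in> carrier G \<Longrightarrow> a \<in> carrier G \<Longrightarrow>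
      x \<otimes> (a \<otimes> inv x) = a"
    "x \<in> carrier G \<Longrightarrow> a \<in> carrier G \<Longrightarrow> b \<in> carrier G \<Longrightarrow>
      x \<otimes> (a \<otimes> (inv x \<otimes> b)) = a \<otimes> b"
    "x \<in> carrier G \<Longrightarrow> a \<in> carrier G \<Longrightarrow> b \<in> carrier G \<Longrightarrow>
      x \<otimes> (a \<otimes> (b \<otimes> inv x)) = a \<otimes> b"
    "x \<in> carrier G \<Longrightarrow> a \<in> carrier G \<Longrightarrow> b \<in> carrier G \<Longrightarrow> c \<in> carrier G \<Longrightarrow>
      x \<otimes> (a \<otimes> (b \<otimes> (inv x \<otimes> c))) = a \<otimes> (b \<otimes> c)"
    "x \<in> carrier G \<Longrightarrow> a \<in> carrier G \<Longrightarrow> b \<in> carrier G \<Longrightarrow> c \<in> carrier G \<Longrightarrow>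
      x \<otimes> (a \<otimes> (b \<otimes> (c \<otimes> inv x))) = a \<otimes> (b \<otimes> c)"
    "x \<in> carrier G \<Longrightarrow> a \<in> carrier G \<Longrightarrow> b \<in> carrier G \<Longrightarrow> c \<in> carrier G \<Longrightarrow> d \<in> carrier G \<Longrightarrow>
      x \<otimes> (a \<otimes> (b \<otimes> (c \<otimes> (inv x \<otimes> d)))) = a \<otimes> (b \<otimes> (c \<otimes> d))"
    "x \<in> carrier G \<Longrightarrow> a \<in> carrier G \<Longrightarrow> b \<in> carrier G \<Longrightarrow> c \<in> carrier G \<Longrightarrow> d \<in> carrier G \<Longrightarrow>
      x \<otimes> (a \<otimes> (b \<otimes> (c \<otimes> (d \<otimes> inv x)))) = a \<otimes> (b \<otimes> (c \<otimes> d))"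
proof -
  have 1: "x \<otimes> (inv x \<otimes> a) = a" if "x \<in> carrier G" "a \<in> carrier G" for x a
    using that by (simp flip: m_assoc)
  have 2: "inv x \<otimes> (x \<otimes> a) = a" if "x \<in> carrier G" "a \<in> carrier G" for x a
    using that by (simp flip: m_assoc)
  have 3: "x \<otimes> (a \<otimes> y) = a \<otimes> (x \<otimes> y)" if "x \<in> carrier G" "a \<in> carrier G" "y \<in> carrier G" for x a y
    using that m_lcomm by simp
  show "x \<in> carrier G \<Longrightarrow>
      x \<otimes> inv x = \<one>" for x
    by (simp only: 1 2 3 m_closed inv_closed r_inv r_one)
  show "x \<in> carrier G \<Longrightarrow> a \<in> carrier G \<Longrightarrow>
      x \<otimes> (inv x \<otimes> a) = a" for x a
    by (simp only: 1 2 3 m_closed inv_closed r_inv r_one)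
  show "x \<in> carrier G \<Longrightarrow> a \<in> carrier G \<Longrightarrow>
      x \<otimes> (a \<otimes> inv x) = a" for x a
    by (simp only: 1 2 3 m_closed inv_closed r_inv r_one)
  show "x \<in> carrier G \<Longrightarrow> a \<in> carrier G \<Longrightarrow> b \<in> carrier G \<Longrightarrow>
      x \<otimes> (a \<otimes> (inv x \<otimes> b)) = a \<otimes> b" for x a b
    by (simp only: 1 2 3 m_closed inv_closed r_inv r_one)
  show "x \<in> carrier G \<Longrightarrow> a \<in> carrier G \<Longrightarrow> b \<in> carrier G \<Longrightarrow>
      x \<otimes> (a \<otimes> (b \<otimes> inv x)) = a \<otimes> b" for x a b
    by (simp only: 1 2 3 m_closed inv_closed r_inv r_one)
  show "x \<in> carrier G \<Longrightarrow> a \<in> carrier G \<Longrightarrow> b \<in> carrier G \<Longrightarrow> c \<in> carrier G \<Longrightarrow>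
      x \<otimes> (a \<otimes> (b \<otimes> (inv x \<otimes> c))) = a \<otimes> (b \<otimes> c)" for x a b c
    by (simp only: 1 2 3 m_closed inv_closed r_inv r_one)
  show "x \<in> carrier G \<Longrightarrow> a \<in> carrier G \<Longrightarrow> b \<in> carrier G \<Longrightarrow> c \<in> carrier G \<Longrightarrow>
      x \<otimes> (a \<otimes> (b \<otimes> (c \<otimes> inv x))) = a \<otimes> (b \<otimes> c)" for x a b c
    by (simp only: 1 2 3 m_closed inv_closed r_inv r_one)
  show "x \<in> carrier G \<Longrightarrow> a \<in> carrier G \<Longrightarrow> b \<in> carrier G \<Longrightarrow> c \<in> carrier G \<Longrightarrow> d \<in> carrier G \<Longrightarrow>
      x \<otimes> (a \<otimes> (b \<otimes> (c \<otimes> (inv x \<otimes> d)))) = a \<otimes> (b \<otimes> (c \<otimes> d))" for x a b c d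
    by (simp only: 1 2 3 m_closed inv_closed r_inv r_one)
  show "x \<in> carrier G \<Longrightarrow> a \<in> carrier G \<Longrightarrow> b \<in> carrier G \<Longrightarrow> c \<in> carrier G \<Longrightarrow> d \<in> carrier G \<Longrightarrow>
      x \<otimes> (a \<otimes> (b \<otimes> (c \<otimes> (d \<otimes> inv x)))) = a \<otimes> (b \<otimes> (c \<otimes> d))" for x a b c d
    by (simp only: 1 2 3 m_closed inv_closed r_inv r_one)
qed

lemmas ab_simps = m_assoc m_comm m_lcomm inv_mult cancel_rules

text \<open>\<open>inv a \<otimes> x \<in> H\<close> says that \<open>a\<close> and \<open>x\<close>
  have the same coset. Along an edge of degree \<open>x \<otimes> inv y\<close> from
  \<open>a\<close> to \<open>b\<close>, agreement of \<open>a\<close> with the potential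
  \<open>x\<close>, up to the shift \<open>t\<close>, is passed on to \<open>b\<close> and
  \<open>y\<close>.\<close>

lemma coset_step:
  assumes "subgroup H G" "a \<in> carrier G" "b \<in> carrier G" "x \<in> carrier G" "y \<in> carrier G" "t \<in> carrier G"
    "inv a \<otimes> (x \<otimes> inv y) \<otimes> b \<in> H" "inv a \<otimes> x \<otimes> t \<in> H"
  shows "inv b \<otimes> y \<otimes> t \<in> H"
proof -
  have "inv (inv a \<otimes> (x \<otimes> inv y) \<otimes> b) \<otimes> (inv a \<otimes> x \<otimes> t) \<in> H"
    by (rule subgroup.m_closed[OF assms(1) subgroup.m_inv_closed[OF assms(1,7)] assms(8)])
  also have "inv (inv a \<otimes> (x \<otimes> inv y) \<otimes> b) \<otimes> (inv a \<otimes> x \<otimes> t) = inv b \<otimes> y \<otimes> t"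
    using assms(2-6) by (simp add: ab_simps)
  finally show ?thesis .
qed

text \<open>Conversely, if both ends match their potentials, the edge is admissible for the
  difference of the potentials.\<close>

lemma coset_quotient:
  assumes "subgroup H G" "a \<in> carrier G" "b \<in> carrier G" "x \<in> carrier G" "y \<in> carrier G"
    "inv a \<otimes> x \<in> H" "inv b \<otimes> y \<in> H"
  shows "inv a \<otimes> (x \<otimes> inv y) \<otimes> b \<in> H"
proof -
  have "(inv a \<otimes> x) \<otimes> inv (inv b \<otimes> y) \<in> H"
    by (rule subgroup.m_closed[OF assms(1,6) subgroup.m_inv_closed[OF assms(1,7)]])
  also have "(inv a \<otimes> x) \<otimes> inv (inv b \<otimes> y) = inv a \<otimes> (x \<otimes> inv y) \<otimes> b"
    using assms(2-5) by (simp add: ab_simps)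
  finally show ?thesis .
qed

end

text \<open>Lets the potential be followed along the word simultaneously with the indices.\<close>

lemma walk_pair:
  "walk e p w q \<Longrightarrow> walk f a w b \<Longrightarrow>
   walk (\<lambda>v. ((fst (e v), fst (f v)), (snd (e v), snd (f v)))) (p, a) w (q, b)"
  by (induction w arbitrary: p a) auto

text \<open>One of the two letters is passed before the other, and \<open>h\<close> does not
  decrease in between. Hence letters that strictly raise \<open>h\<close> start at different values
  of \<open>h\<close>.\<close>

lemma walk_order:
  fixes h :: "'i \<Rightarrow> nat"
  assumes "walk e p w q" "\<And>v. v \<in> set w \<Longrightarrow> h (fst (e v)) \<le> h (snd (e v))"
    "u \<in> set w" "v \<in> set w" "u \<noteq> v"
  shows "h (snd (e u)) \<le> h (fst (e v)) \<or> h (snd (e v)) \<le> h (fst (e u))"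
  using assms
proof (induction w arbitrary: p)
  case (Cons x w)
  have mono: "h (snd (e x)) \<le> h (fst (e v))" if "v \<in> set w" for v
    using walk_mono_mem(1)[of e "snd (e x)" w q h v] Cons.prems(1,2) that by auto
  show ?case
  proof (cases "u = x \<or> v = x")
    case True
    then show ?thesis using Cons.prems(3-5) mono by auto
  next
    case False
    then show ?thesis using Cons.IH[of "snd (e x)"] Cons.prems by auto
  qed
qed simp

text \<open>The test word for a list of items visits the blocks in order. In block \<open>b\<close> it reads, for each
  of \<open>N\<close> copies and each item \<open>a\<close>, a way \<open>LU\<close> from a base point to the edge of \<open>a\<close>, that edge
  \<open>LX\<close>, and a way \<open>LV\<close> back; \<open>LY b\<close> enters the block.\<close>

datatype 'a lab = LU nat 'a | LX nat 'a | LV nat 'a | LY nat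

definition sec :: "(nat \<Rightarrow> 'a list) \<Rightarrow> nat \<Rightarrow> nat \<Rightarrow> 'a lab list" where
  "sec L b c = concat (map (\<lambda>a. [LU c a, LX c a, LV c a]) (L b))"

definition bword :: "(nat \<Rightarrow> 'a list) \<Rightarrow> nat \<Rightarrow> nat \<Rightarrow> 'a lab list" where
  "bword L N b = LY b # concat (map (sec L b) [0..<N])"

definition word :: "(nat \<Rightarrow> 'a list) \<Rightarrow> nat \<Rightarrow> nat \<Rightarrow> 'a lab list" where
  "word L N m = concat (map (bword L N) [0..<m])"

lemma set_sec: "set (sec L b c) = LU c ` set (L b) \<union> LX c ` set (L b) \<union> LV c ` set (L b)"
  by (auto simp: sec_def)

lemma set_word:
  "v \<in> set (word L N m) \<longleftrightarrow> (\<exists>b<m. v = LY b \<or> (\<exists>c<N. v \<in> set (sec L b c)))"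
  by (simp add: word_def bword_def Bex_def)

lemma word_split: "b < m \<Longrightarrow> \<exists>ys. word L N m = word L N b @ bword L N b @ ys"
proof -
  assume b: "b < m"
  then obtain k where "m = b + Suc k" by (metis add_Suc_right less_imp_Suc_add)
  then have "[0..<m] = [0..<b] @ b # [Suc b..<m]"
    by (simp add: upt_add_eq_append[of 0 b "Suc k", simplified] upt_conv_Cons)
  then show ?thesis by (simp add: word_def)
qed

lemma sec_split:
  assumes "b < m" "c < N"
  shows "\<exists>xs ys. word L N m = xs @ sec L b c @ ys"
proof -
  have "sec L b c \<in> set (map (sec L b) [0..<N])" using assms by simp
  then obtain us vs where "map (sec L b) [0..<N] = us @ sec L b c # vs" by (meson split_list)
  then have "bword L N b = (LY b # concat us) @ sec L b c @ concat vs" by (simp add: bword_def)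
  moreover obtain ys where "word L N m = word L N b @ bword L N b @ ys" using word_split assms by blast
  ultimately show ?thesis by (metis append.assoc)
qed

lemma triple_split:
  assumes "b < m" "c < N" "a \<in> set (L b)"
  shows "\<exists>xs ys. word L N m = xs @ [LU c a, LX c a, LV c a] @ ys"
proof -
  have "[LU c a, LX c a, LV c a] \<in> set (map (\<lambda>a. [LU c a, LX c a, LV c a]) (L b))" using assms by auto
  then obtain us vs where "map (\<lambda>a. [LU c a, LX c a, LV c a]) (L b) = us @ [LU c a, LX c a, LV c a] # vs"
    by (meson split_list)
  then have "sec L b c = concat us @ [LU c a, LX c a, LV c a] @ concat vs" by (simp add: sec_def)
  moreover obtain xs ys where "word L N m = xs @ sec L b c @ ys" using sec_split assms by blast
  ultimately show ?thesis by (metis append.assoc)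
qed

lemma distinct_word:
  assumes "\<And>b. b < m \<Longrightarrow> distinct (L b)"
    "\<And>b b'. b < m \<Longrightarrow> b' < m \<Longrightarrow> b \<noteq> b' \<Longrightarrow> set (L b) \<inter> set (L b') = {}"
  shows "distinct (word L N m)"
  unfolding word_def
proof (rule distinct_concat_map)
  fix b assume b: "b \<in> set [0..<m]"
  have "distinct (sec L b c)" for c
    unfolding sec_def by (rule distinct_concat_map) (use assms(1) b in auto)
  then have "distinct (concat (map (sec L b) [0..<N]))"
    by (intro distinct_concat_map) (auto simp: set_sec)
  then show "distinct (bword L N b)" by (auto simp: bword_def set_sec)
next
  fix b b' assume "b \<in> set [0..<m]" "b' \<in> set [0..<m]" "b \<noteq> b'"
  then have "set (L b) \<inter> set (L b') = {}" "b \<noteq> b'" using assms(2) by auto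
  then show "set (bword L N b) \<inter> set (bword L N b') = {}"
    by (auto simp: bword_def set_sec)
qed simp

text \<open>By truncated subtraction \<open>LY 0\<close> is a loop at \<open>P 0\<close>, so block
  \<open>0\<close> needs no special treatment, and the empty word for \<open>m = 0\<close> starts
  and ends at \<open>P 0\<close>.\<close>

lemma walk_word:
  assumes "\<And>a b c. b < m \<Longrightarrow> a \<in> set (L b) \<Longrightarrow>
      h (LU c a) = (P b, x a) \<and> h (LX c a) = (x a, y a) \<and> h (LV c a) = (y a, P b)"
    and "\<And>b. b < m \<Longrightarrow> h (LY b) = (P (b - 1), P b)"
  shows "walk h (P 0) (word L N m) (P (m - 1))"
  using assms
proof (induction m)
  case (Suc m)
  have "walk h (P m) (sec L m c) (P m)" for c
    unfolding sec_def by (rule walk_concat_closed) (use Suc.prems(1)[of m] in auto)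
  then have "walk h (P m) (concat (map (sec L m) [0..<N])) (P m)"
    by (intro walk_concat_closed)
  then have "walk h (P (m - 1)) (bword L N m) (P m)"
    using Suc.prems(2)[of m] by (simp add: bword_def)
  moreover have "walk h (P 0) (word L N m) (P (m - 1))"
    by (rule Suc.IH; rule Suc.prems; simp)
  ultimately show ?case by (auto simp: word_def walk_append)
qed (simp add: word_def)

section \<open>Transfer of items\<close>

context two
begin

text \<open>An item \<open>(i, j, t)\<close> stands for a matrix unit at \<open>(i, j)\<close> with
  a coefficient that gives it degree \<open>t\<close>. \<open>\<gamma> i\<close> is any
  representative of the coset of \<open>g i\<close>, and \<open>inv t \<otimes> \<gamma> i\<close>
  then represents that of \<open>g j\<close>; the freedom in \<open>\<gamma>\<close> matters as long
  as \<open>H\<close> and \<open>H'\<close> are not compared. Injectivity concerns items with the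
  same \<open>t\<close>, since only their letters are alternated.\<close>

definition items_map where
  "items_map I \<gamma> F \<theta> \<longleftrightarrow> \<theta> \<in> carrier G \<and>
     (\<forall>i j t. (i, j, t) \<in> I \<longrightarrow> fst (F (i, j, t)) < n' \<and> snd (F (i, j, t)) < n' \<and>
       blk' (fst (F (i, j, t))) = blk' (snd (F (i, j, t))) \<and>
       inv (g' (fst (F (i, j, t)))) \<otimes> \<gamma> i \<otimes> \<theta> \<in> H' \<and>
       inv (g' (snd (F (i, j, t)))) \<otimes> (inv t \<otimes> \<gamma> i) \<otimes> \<theta> \<in> H') \<and>
     (\<forall>i j k l t. (i, j, t) \<in> I \<longrightarrow> (k, l, t) \<in> I \<longrightarrow> F (i, j, t) = F (k, l, t) \<longrightarrow> (i, j) = (k, l)) \<and>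
     (\<forall>a\<in>I. \<forall>a'\<in>I. blk (fst a) \<le> blk (fst a') \<longrightarrow> blk' (fst (F a)) \<le> blk' (fst (F a')))"

lemma items_mapD:
  assumes "items_map I \<gamma> F \<theta>"
  shows "\<theta> \<in> carrier G"
    "\<And>i j t. (i, j, t) \<in> I \<Longrightarrow> fst (F (i, j, t)) < n' \<and> snd (F (i, j, t)) < n' \<and>
       blk' (fst (F (i, j, t))) = blk' (snd (F (i, j, t))) \<and>
       inv (g' (fst (F (i, j, t)))) \<otimes> \<gamma> i \<otimes> \<theta> \<in> H' \<and>
       inv (g' (snd (F (i, j, t)))) \<otimes> (inv t \<otimes> \<gamma> i) \<otimes> \<theta> \<in> H'"
    "\<And>i j k l t. (i, j, t) \<in> I \<Longrightarrow> (k, l, t) \<in> I \<Longrightarrow> F (i, j, t) = F (k, l, t) \<Longrightarrow> (i, j) = (k, l)"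
    "\<And>a a'. a \<in> I \<Longrightarrow> a' \<in> I \<Longrightarrow> blk (fst a) \<le> blk (fst a') \<Longrightarrow> blk' (fst (F a)) \<le> blk' (fst (F a'))"
  using assms unfolding items_map_def by blast+

text \<open>The word repeats each block as often as the second algebra has blocks. A walk in the second
  algebra changes its block fewer times than that, so one copy of each block stays inside a
  diagonal block.\<close>

lemma items_transfer:
  fixes I :: "(nat \<times> nat \<times> 'g) set" and \<gamma> :: "nat \<Rightarrow> 'g"
  assumes "finite I"
    and items: "\<And>i j t. (i, j, t) \<in> I \<Longrightarrow>
      i < n \<and> j < n \<and> blk i = blk j \<and> t \<in> carrier G \<and> inv (g i) \<otimes> t \<otimes> g j \<in> H"
    and \<gamma>: "\<And>i. i < n \<Longrightarrow> \<gamma> i \<in> carrier G \<and> inv (g i) \<otimes> \<gamma> i \<in> H"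
  shows "\<exists>F \<theta>. items_map I \<gamma> F \<theta>"
proof -
  have "\<exists>P. \<forall>b<m. P b < n \<and> blk (P b) = b" using A.blk_surj by metis
  then obtain P where P: "\<And>b. b < m \<Longrightarrow> P b < n" "\<And>b. b < m \<Longrightarrow> blk (P b) = b" by blast
  have "\<exists>L. \<forall>b. set (L b) = {a \<in> I. blk (fst a) = b} \<and> distinct (L b)"
    using assms(1) by (intro choice allI finite_distinct_list) simp
  then obtain L where L: "\<And>b. set (L b) = {a \<in> I. blk (fst a) = b}" "\<And>b. distinct (L b)" by blast
  define w where "w = word L m' m"
  define e where "e v = (case v of LU c a \<Rightarrow> (P (blk (fst a)), fst a) | LX c a \<Rightarrow> (fst a, fst (snd a))
     | LV c a \<Rightarrow> (fst (snd a), P (blk (fst a))) | LY b \<Rightarrow> (P (b - 1), P b))" for v :: "(nat \<times> nat \<times> 'g) lab"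
  define Q where "Q b = \<gamma> (P b)" for b
  \<comment> \<open>The potential runs through the chosen representatives at the vertices of the
    walk. Taking its differences as degrees makes the cosets along a transferred walk computable
    from the start.\<close>
  define pot where "pot v = (case v of LU c a \<Rightarrow> (Q (blk (fst a)), \<gamma> (fst a))
     | LX c a \<Rightarrow> (\<gamma> (fst a), inv (snd (snd a)) \<otimes> \<gamma> (fst a))
     | LV c a \<Rightarrow> (inv (snd (snd a)) \<otimes> \<gamma> (fst a), Q (blk (fst a))) | LY b \<Rightarrow> (Q (b - 1), Q b))"
    for v :: "(nat \<times> nat \<times> 'g) lab"
  define deg where "deg v = fst (pot v) \<otimes> inv (snd (pot v))" for v
  \<comment> \<open>The zeros are placeholders that forget the indices: a class collects the items
    of one copy with the same \<open>t\<close>, and every other letter is alone.\<close>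
  define cls where "cls v = (case v of LX c a \<Rightarrow> LX c (0, 0, snd (snd a)) | _ \<Rightarrow> v)"
    for v :: "(nat \<times> nat \<times> 'g) lab"
  have \<gamma>_carrier: "\<gamma> i \<in> carrier G" if "i < n" for i using \<gamma> that by blast
  have we: "walk e (P 0) w (P (m - 1))" unfolding w_def
    by (rule walk_word[where x = fst and y = "\<lambda>a. fst (snd a)"]) (auto simp: e_def L)
  have wpot: "walk pot (Q 0) w (Q (m - 1))" unfolding w_def
    by (rule walk_word[where x = "\<lambda>a. \<gamma> (fst a)" and y = "\<lambda>a. inv (snd (snd a)) \<otimes> \<gamma> (fst a)"])
      (auto simp: pot_def L)
  have dist: "distinct w" unfolding w_def by (rule distinct_word) (auto simp: L)
  have mem: "(\<exists>b<m. v = LY b) \<or>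
      (\<exists>c<m'. \<exists>a\<in>I. blk (fst a) < m \<and> v \<in> {LU c a, LX c a, LV c a})" if "v \<in> set w" for v
    using that unfolding w_def set_word set_sec L by blast
  have memI: "LU c a \<in> set w" "LX c a \<in> set w" "LV c a \<in> set w" if "a \<in> I" "c < m'" for a c
  proof -
    have "blk (fst a) < m" using that items[of "fst a" "fst (snd a)" "snd (snd a)"] A.blk_less by auto
    then show "LU c a \<in> set w" "LX c a \<in> set w" "LV c a \<in> set w"
      using that unfolding w_def set_word set_sec L by blast+
  qed
  have pot_e: "fst (e v) < n \<and> snd (e v) < n \<and> blk (fst (e v)) \<le> blk (snd (e v)) \<and>
      fst (pot v) \<in> carrier G \<and> snd (pot v) \<in> carrier G \<and>
      inv (g (fst (e v))) \<otimes> fst (pot v) \<in> H \<and> inv (g (snd (e v))) \<otimes> snd (pot v) \<in> H"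
    if v: "v \<in> set w" for v
  proof -
    have Y: "Q b \<in> carrier G \<and> inv (g (P b)) \<otimes> Q b \<in> H" if "b < m" for b
      using \<gamma>[OF P(1)[OF that]] by (simp add: Q_def)
    have X: "i < n \<and> j < n \<and> blk i = blk j \<and> \<gamma> i \<in> carrier G \<and> inv t \<otimes> \<gamma> i \<in> carrier G \<and>
      inv (g i) \<otimes> \<gamma> i \<in> H \<and> inv (g j) \<otimes> (inv t \<otimes> \<gamma> i) \<in> H" if "(i, j, t) \<in> I" for i j t
    proof -
      have "inv (inv (g i) \<otimes> t \<otimes> g j) \<otimes> (inv (g i) \<otimes> \<gamma> i) \<in> H"
        by (rule subgroup.m_closed[OF A.H_subgroup subgroup.m_inv_closed[OF A.H_subgroup]])
          (use items[OF that] \<gamma>[of i] in simp_all)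
      also have "inv (inv (g i) \<otimes> t \<otimes> g j) \<otimes> (inv (g i) \<otimes> \<gamma> i) = inv (g j) \<otimes> (inv t \<otimes> \<gamma> i)"
        using items[OF that] \<gamma>[of i] by (simp add: A.ab_simps)
      finally show ?thesis using items[OF that] \<gamma>[of i] by auto
    qed
    from mem[OF v] show ?thesis
    proof (elim disjE exE conjE bexE)
      fix b assume b: "b < m" "v = LY b"
      then have "b - 1 < m" by simp
      then show ?thesis using b Y[of b] Y[of "b - 1"] P by (auto simp: e_def pot_def)
    next
      fix c a assume "c < m'" "a \<in> I" "blk (fst a) < m" "v \<in> {LU c a, LX c a, LV c a}"
      moreover obtain i j t where "a = (i, j, t)" by (cases a)
      ultimately show ?thesis using X[of i j t] Y[of "blk i"] P by (auto simp: e_def pot_def)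
    qed
  qed
  have deg: "deg v \<in> carrier G" if "v \<in> set w" for v using pot_e[OF that] by (simp add: deg_def)
  have adm: "A.adm (deg v) (e v)" if "v \<in> set w" for v
    using pot_e[OF that] A.coset_quotient[OF A.H_subgroup] by (simp add: A.adm_def deg_def)
  have degX: "deg (LX c a) = snd (snd a)" if "a \<in> I" for c a
  proof -
    obtain i j t where "a = (i, j, t)" by (cases a)
    then show ?thesis using items[of i j t] that \<gamma>[of i] by (simp add: deg_def pot_def A.ab_simps)
  qed
  have clsX: "u = v \<or> (\<exists>c a a'. u = LX c a \<and> v = LX c a' \<and> snd (snd a) = snd (snd a'))"
    if "cls u = cls v" for u v
    using that by (cases u; cases v) (auto simp: cls_def)
  have cls: "deg u = deg v" if "u \<in> set w" "v \<in> set w" "cls u = cls v" for u v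
  proof -
    have "a \<in> I" if "LX c a \<in> set w" for c a using mem[OF that] by auto
    then show ?thesis using clsX[OF that(3)] that(1,2) degX by metis
  qed
  have rigid: "\<sigma> = id" if \<sigma>: "\<sigma> \<in> class_perms cls (set w)" and walk: "walk (e \<circ> \<sigma>) (P 0) w (P (m - 1))" for \<sigma>
  proof
    have fix_cls: "\<sigma> v = v" if "v \<in> set w" "\<And>c a. v \<noteq> LX c a" for v
      using clsX[OF class_perms_cls[OF \<sigma> that(1)]] that(2) by auto
    fix v
    consider "v \<notin> set w" | "v \<in> set w" "\<And>c a. v \<noteq> LX c a" | c a where "v \<in> set w" "v = LX c a" by blast
    then show "\<sigma> v = id v"
    proof cases
      case 1
      then show ?thesis using class_perms_permutes[OF \<sigma>] by (simp add: permutes_not_in)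
    next
      case 2
      then show ?thesis using fix_cls by simp
    next
      case 3
      \<comment> \<open>The neighbours \<open>LU c a\<close> and \<open>LV c a\<close> are fixed,
        and their edges pin both ends of the edge of \<open>\<sigma> v\<close>; the class determines
        the copy and \<open>t\<close>.\<close>
      from mem[OF 3(1)] 3(2) have a: "c < m'" "a \<in> I" "blk (fst a) < m" by auto
      then obtain xs ys where "w = xs @ [LU c a, LX c a, LV c a] @ ys"
        unfolding w_def using triple_split[of "blk (fst a)" m c m' a L] L by auto
      with walk have "snd (e (\<sigma> (LU c a))) = fst (e (\<sigma> v))" "snd (e (\<sigma> v)) = fst (e (\<sigma> (LV c a)))"
        by (auto simp: walk_append 3(2))
      moreover have "\<sigma> (LU c a) = LU c a" "\<sigma> (LV c a) = LV c a"
        using fix_cls memI[OF a(2,1)] by auto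
      moreover obtain a' where "\<sigma> v = LX c a'" "snd (snd a) = snd (snd a')"
        using clsX[OF class_perms_cls[OF \<sigma> 3(1)]] 3(2) by (metis lab.inject(2))
      ultimately show ?thesis by (auto simp: e_def 3(2) prod_eq_iff)
    qed
  qed
  have Pn: "P 0 < n" "P (m - 1) < n" using P(1) A.m_pos by auto
  obtain e' r' q' where e': "r' < n'" "q' < n'" "walk e' r' w q'"
    "\<And>v. v \<in> set w \<Longrightarrow> B.adm (deg v) (e' v)"
    "\<And>u v. u \<in> set w \<Longrightarrow> v \<in> set w \<Longrightarrow> cls u = cls v \<Longrightarrow> e' u = e' v \<Longrightarrow> u = v"
  proof (rule transfer_walk[OF dist deg cls adm we Pn rigid])
    fix r' q' e'
    assume "r' < n'" "q' < n'" "walk e' r' w q'"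
      "\<And>v. v \<in> set w \<Longrightarrow> B.adm (deg v) (e' v)"
      "\<And>u v. u \<in> set w \<Longrightarrow> v \<in> set w \<Longrightarrow> cls u = cls v \<Longrightarrow> e' u = e' v \<Longrightarrow> u = v"
    then show thesis by (rule that)
  qed
  have mono: "blk' (fst (e' v)) \<le> blk' (snd (e' v))" if "v \<in> set w" for v
    using e'(4)[OF that] by (simp add: B.adm_def)
  define cp where "cp c = {v \<in> set w. \<exists>a. v = LU c a \<or> v = LX c a \<or> v = LV c a}" for c
  \<comment> \<open>Pigeonhole: if each copy had a letter that raises the block, these
    \<open>m'\<close> letters would start in different blocks, none of which is the last
    one.\<close>
  have "\<exists>c<m'. \<forall>v\<in>cp c. blk' (fst (e' v)) = blk' (snd (e' v))"
  proof (rule ccontr)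
    assume "\<not> ?thesis"
    then have "\<forall>c\<in>{..<m'}. \<exists>v. v \<in> cp c \<and> blk' (fst (e' v)) \<noteq> blk' (snd (e' v))" by blast
    then obtain f where f: "\<And>c. c < m' \<Longrightarrow> f c \<in> cp c" "\<And>c. c < m' \<Longrightarrow> blk' (fst (e' (f c))) \<noteq> blk' (snd (e' (f c)))"
      by (metis lessThan_iff)
    have fw: "f c \<in> set w" if "c < m'" for c using f(1)[OF that] by (simp add: cp_def)
    have lt: "blk' (fst (e' (f c))) < blk' (snd (e' (f c)))" if "c < m'" for c
      using f(2)[OF that] mono[OF fw[OF that]] by simp
    have inj: "inj_on (\<lambda>c. blk' (fst (e' (f c)))) {..<m'}"
    proof (rule inj_onI, rule ccontr)
      fix c d assume cd: "c \<in> {..<m'}" "d \<in> {..<m'}" "blk' (fst (e' (f c))) = blk' (fst (e' (f d)))" "c \<noteq> d"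
      have "f c \<noteq> f d" using f(1)[of c] f(1)[of d] cd by (auto simp: cp_def)
      then have "blk' (snd (e' (f c))) \<le> blk' (fst (e' (f d))) \<or> blk' (snd (e' (f d))) \<le> blk' (fst (e' (f c)))"
        using walk_order[OF e'(3) mono, of "f c" "f d"] fw cd by auto
      then show False using lt[of c] lt[of d] cd by auto
    qed
    have "blk' (fst (e' (f c))) \<in> {..<m' - 1}" if "c < m'" for c
    proof -
      have "snd (e' (f c)) < n'" using e'(4)[OF fw[OF that]] by (simp add: B.adm_def)
      then show ?thesis using lt[OF that] B.blk_less by fastforce
    qed
    then have "card {..<m'} \<le> card {..<m' - 1}"
      by (intro card_inj_on_le[OF inj]) auto
    then show False using B.m_pos by simp
  qed
  then obtain c where c: "c < m'" "\<And>v. v \<in> cp c \<Longrightarrow> blk' (fst (e' v)) = blk' (snd (e' v))" by blast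
  define F where "F a = e' (LX c a)" for a
  \<comment> \<open>Chosen so that the coset relation holds at the start of the transferred walk
    with the value \<open>\<one>\<close>; \<open>coset_step\<close> carries it along.\<close>
  define \<theta> where "\<theta> = inv (Q 0) \<otimes> g' r'"
  have Q0: "Q 0 \<in> carrier G" using \<gamma>_carrier P(1) A.m_pos by (simp add: Q_def)
  have \<theta>: "\<theta> \<in> carrier G" using Q0 e'(1) by (simp add: \<theta>_def)
  have coset: "inv (g' (fst (e' v))) \<otimes> fst (pot v) \<otimes> \<theta> \<in> H' \<and> inv (g' (snd (e' v))) \<otimes> snd (pot v) \<otimes> \<theta> \<in> H'"
    if v: "v \<in> set w" for v
  proof -
    let ?e = "\<lambda>v. ((fst (e' v), fst (pot v)), (snd (e' v), snd (pot v)))"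
    let ?P = "\<lambda>z. inv (g' (fst z)) \<otimes> snd z \<otimes> \<theta> \<in> H'"
    have "inv (g' r') \<otimes> Q 0 \<otimes> \<theta> = \<one>" using e'(1) Q0 by (simp add: \<theta>_def A.ab_simps)
    then have 0: "?P (r', Q 0)" using subgroup.one_closed[OF B.H_subgroup] by simp
    have step: "?P (snd (?e v))" if v: "v \<in> set w" and "?P (fst (?e v))" for v
    proof -
      have "inv (g' (fst (e' v))) \<otimes> (fst (pot v) \<otimes> inv (snd (pot v))) \<otimes> g' (snd (e' v)) \<in> H'"
        "fst (e' v) < n'" "snd (e' v) < n'"
        using e'(4)[OF v] by (auto simp: B.adm_def deg_def)
      then show ?thesis
        using A.coset_step[OF B.H_subgroup, of "g' (fst (e' v))" "g' (snd (e' v))" "fst (pot v)" "snd (pot v)" \<theta>]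
          pot_e[OF v] \<theta> that(2) by simp
    qed
    show ?thesis
      using walk_mem_induct[OF walk_pair[OF e'(3) wpot], of ?P, OF 0 step] v by simp
  qed
  \<comment> \<open>No letter of copy \<open>c\<close> changes the block, so a contiguous section of
    this copy stays in a single block.\<close>
  have sec: "blk' (fst (e' u)) = blk' (fst (e' v))"
    if "b < m" "u \<in> set (sec L b c)" "v \<in> set (sec L b c)" for b u v
  proof -
    obtain xs ys where "w = xs @ sec L b c @ ys" using sec_split[OF \<open>b < m\<close> c(1), of L] unfolding w_def by auto
    then obtain p1 q1 where 1: "walk e' p1 (sec L b c) q1" and sub: "set (sec L b c) \<subseteq> set w"
      using e'(3) by (auto simp: walk_append)
    have "set (sec L b c) \<subseteq> cp c" using sub by (auto simp: cp_def set_sec)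
    with c(2) have "\<And>v. v \<in> set (sec L b c) \<Longrightarrow> blk' (fst (e' v)) = blk' p1 \<Longrightarrow> blk' (snd (e' v)) = blk' p1" by fastforce
    from walk_mem_induct[OF 1, of "\<lambda>i. blk' i = blk' p1", OF refl this] that show ?thesis by simp
  qed
  have "items_map I \<gamma> F \<theta>"
    unfolding items_map_def
  proof (intro conjI[OF \<theta>] conjI[of "\<forall>i j t. _ i j t"] conjI[of "\<forall>i j k l t. _ i j k l t"] allI impI ballI)
    fix i j t assume a: "(i, j, t) \<in> I"
    note w = memI(2)[OF a c(1)]
    show "fst (F (i, j, t)) < n' \<and> snd (F (i, j, t)) < n' \<and>
       blk' (fst (F (i, j, t))) = blk' (snd (F (i, j, t))) \<and>
       inv (g' (fst (F (i, j, t)))) \<otimes> \<gamma> i \<otimes> \<theta> \<in> H' \<and>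
       inv (g' (snd (F (i, j, t)))) \<otimes> (inv t \<otimes> \<gamma> i) \<otimes> \<theta> \<in> H'"
      using coset[OF w] e'(4)[OF w] c(2)[of "LX c (i, j, t)"] w
      by (simp add: F_def pot_def B.adm_def cp_def)
  next
    fix i j k l t assume "(i, j, t) \<in> I" "(k, l, t) \<in> I" "F (i, j, t) = F (k, l, t)"
    then show "(i, j) = (k, l)"
      using e'(5)[OF memI(2)[OF _ c(1)] memI(2)[OF _ c(1)], of "(i, j, t)" "(k, l, t)"]
      by (simp add: F_def cls_def)
  next
    fix a a' assume a: "a \<in> I" "a' \<in> I" "blk (fst a) \<le> blk (fst a')"
    let ?b = "blk (fst a)" and ?b' = "blk (fst a')"
    have bm: "?b < m" "?b' < m"
      using a items[of "fst a" "fst (snd a)" "snd (snd a)"] items[of "fst a'" "fst (snd a')" "snd (snd a')"] A.blk_less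
      by auto
    show "blk' (fst (F a)) \<le> blk' (fst (F a'))"
    proof (cases "?b = ?b'")
      case True
      then show ?thesis using sec[of ?b "LX c a" "LX c a'"] a bm by (simp add: F_def set_sec L)
    next
      case False
      then have lt: "?b < ?b'" using a(3) by simp
      obtain ys where ys: "w = word L m' ?b' @ bword L m' ?b' @ ys"
        using word_split[OF bm(2), of L m'] unfolding w_def by auto
      then obtain r1 r2 where r: "walk e' r' (word L m' ?b') r1" "walk e' r1 (bword L m' ?b') r2"
        using e'(3) by (auto simp: walk_append)
      have 1: "LX c a \<in> set (word L m' ?b')" using lt a c(1) by (auto simp: set_word set_sec L)
      have 2: "LX c a' \<in> set (bword L m' ?b')" using a c(1) by (auto simp: bword_def set_sec L)
      have "blk' (fst (e' (LX c a))) \<le> blk' (snd (e' (LX c a)))" using mono memI(2)[OF a(1) c(1)] by blast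
      also have "\<dots> \<le> blk' r1" by (rule walk_mono_mem(2)[OF r(1) _ 1]) (use mono ys in auto)
      also have "\<dots> \<le> blk' (fst (e' (LX c a')))" by (rule walk_mono_mem(1)[OF r(2) _ 2]) (use mono ys in auto)
      finally show ?thesis by (simp add: F_def)
    qed
  qed
  then show ?thesis by blast
qed

end

context comm_group
begin

lemma coset_diff:
  assumes "subgroup H G" "a \<in> carrier G" "x \<in> carrier G" "y \<in> carrier G"
    "inv a \<otimes> x \<in> H" "inv a \<otimes> y \<in> H"
  shows "inv x \<otimes> y \<in> H"
proof -
  have "inv (inv a \<otimes> x) \<otimes> (inv a \<otimes> y) \<in> H"
    by (rule subgroup.m_closed[OF assms(1) subgroup.m_inv_closed[OF assms(1,5)] assms(6)])
  also have "inv (inv a \<otimes> x) \<otimes> (inv a \<otimes> y) = inv x \<otimes> y"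
    using assms(2-4) by (simp add: ab_simps)
  finally show ?thesis .
qed

lemma coset_sym:
  assumes "subgroup H G" "x \<in> carrier G" "y \<in> carrier G" "inv x \<otimes> y \<in> H"
  shows "inv y \<otimes> x \<in> H"
  using coset_diff[OF assms(1,2,3,2,4)] assms subgroup.one_closed[OF assms(1)] by simp

lemma coset_trans:
  assumes "subgroup H G" "x \<in> carrier G" "y \<in> carrier G" "z \<in> carrier G"
    "inv x \<otimes> y \<in> H" "inv y \<otimes> z \<in> H"
  shows "inv x \<otimes> z \<in> H"
  using coset_diff[OF assms(1,3,2,4) coset_sym[OF assms(1,2,3,5)] assms(6)] .

lemma coset_refl: "subgroup H G \<Longrightarrow> x \<in> carrier G \<Longrightarrow> inv x \<otimes> x \<in> H"
  by (simp add: subgroup.one_closed)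

lemma coset_mult:
  assumes "subgroup H G" "x \<in> carrier G" "y \<in> carrier G" "z \<in> carrier G" "w \<in> carrier G"
    "inv x \<otimes> y \<in> H" "inv z \<otimes> w \<in> H"
  shows "inv (x \<otimes> z) \<otimes> (y \<otimes> w) \<in> H"
proof -
  have "(inv x \<otimes> y) \<otimes> (inv z \<otimes> w) \<in> H"
    by (rule subgroup.m_closed[OF assms(1,6,7)])
  also have "(inv x \<otimes> y) \<otimes> (inv z \<otimes> w) = inv (x \<otimes> z) \<otimes> (y \<otimes> w)"
    using assms(2-5) by (simp add: ab_simps)
  finally show ?thesis .
qed

lemma coset_cancel:
  assumes "x \<in> carrier G" "y \<in> carrier G" "z \<in> carrier G"
  shows "inv (x \<otimes> z) \<otimes> (y \<otimes> z) = inv x \<otimes> y"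
  using assms by (simp add: ab_simps)

lemma coset_inv:
  assumes "subgroup H G" "x \<in> carrier G" "y \<in> carrier G" "inv x \<otimes> y \<in> H"
  shows "inv (inv x) \<otimes> inv y \<in> H"
  using coset_sym[OF assms] assms(2,3) by (simp add: m_comm)

end

lemma bij_of_equal_fibres:
  assumes "finite A" "finite B"
    and card: "\<And>c. card {a \<in> A. f a = c} = card {b \<in> B. h b = c}"
  shows "\<exists>\<pi>. bij_betw \<pi> A B \<and> (\<forall>a\<in>A. h (\<pi> a) = f a)"
proof -
  have "\<exists>p. bij_betw p {a \<in> A. f a = c} {b \<in> B. h b = c}" for c
    using assms by (intro finite_same_card_bij) auto
  then obtain p where p: "\<And>c. bij_betw (p c) {a \<in> A. f a = c} {b \<in> B. h b = c}" by metis
  define \<pi> where "\<pi> a = p (f a) a" for a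
  have 1: "\<pi> a \<in> B \<and> h (\<pi> a) = f a" if "a \<in> A" for a
    using bij_betwE[OF p[of "f a"]] that by (simp add: \<pi>_def)
  have "inj_on \<pi> A"
  proof (rule inj_onI)
    fix a a' assume a: "a \<in> A" "a' \<in> A" "\<pi> a = \<pi> a'"
    then have "f a = f a'" using 1 by metis
    with a show "a = a'"
      using inj_onD[OF bij_betw_imp_inj_on[OF p[of "f a"]], of a a'] by (simp add: \<pi>_def)
  qed
  moreover have "B \<subseteq> \<pi> ` A"
  proof
    fix b assume "b \<in> B"
    then have "b \<in> p (h b) ` {a \<in> A. f a = h b}"
      unfolding bij_betw_imp_surj_on[OF p[of "h b"]] by simp
    then obtain a where a: "a \<in> A" "f a = h b" "b = p (h b) a" by blast
    then have "\<pi> a = b" by (simp add: \<pi>_def)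
    with a(1) show "b \<in> \<pi> ` A" by blast
  qed
  ultimately have "bij_betw \<pi> A B" using 1 by (auto simp: bij_betw_def)
  with 1 show ?thesis by blast
qed

text \<open>A surjection of a finite set onto itself is injective, so the list of values is sorted
  and distinct with the elements of \<open>[0..<m]\<close>.\<close>

lemma mono_surj_lessThan_id:
  fixes f :: "nat \<Rightarrow> nat"
  assumes "\<And>a b. a \<le> b \<Longrightarrow> b < m \<Longrightarrow> f a \<le> f b" "f ` {..<m} = {..<m}" "b < m"
  shows "f b = b"
proof -
  have set: "set (map f [0..<m]) = set [0..<m]" using assms(2) by (simp add: atLeast0LessThan)
  moreover have "distinct (map f [0..<m])"
    by (rule card_distinct) (simp add: set del: set_map)
  moreover have "sorted (map f [0..<m])"
    unfolding sorted_iff_nth_mono using assms(1) by (simp add: order.strict_trans1)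
  ultimately have "map f [0..<m] = [0..<m]" by (intro sorted_distinct_set_unique) auto
  then have "map f [0..<m] ! b = [0..<m] ! b" by simp
  with assms(3) show ?thesis by simp
qed

context utg
begin

text \<open>Its cardinality is the multiplicity of the coset of \<open>u\<close> in block
  \<open>b\<close>, the invariant that has to be recovered.\<close>

definition cell :: "nat \<Rightarrow> 'g \<Rightarrow> nat set" where
  "cell b u = {i. i < n \<and> blk i = b \<and> inv (g i) \<otimes> u \<in> H}"

definition block_pairs :: "(nat \<times> nat) set" where
  "block_pairs = {(i, j). i < n \<and> j < n \<and> blk i = blk j}"

lemma finite_cell [simp]: "finite (cell b u)"
  by (simp add: cell_def)

lemma finite_block_pairs [simp]: "finite block_pairs"
  by (rule finite_subset[of _ "{..<n} \<times> {..<n}"]) (auto simp: block_pairs_def)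

lemma cell_self: "i < n \<Longrightarrow> i \<in> cell (blk i) (g i)"
  by (simp add: cell_def subgroup.one_closed[OF H_subgroup])

lemma cell_cong:
  assumes "u \<in> carrier G" "v \<in> carrier G" "inv u \<otimes> v \<in> H"
  shows "cell b u = cell b v"
proof -
  have "inv (g i) \<otimes> u \<in> H \<longleftrightarrow> inv (g i) \<otimes> v \<in> H" if "i < n" for i
    using coset_trans[OF H_subgroup g_carrier[OF that] assms(1,2) _ assms(3)]
      coset_trans[OF H_subgroup g_carrier[OF that] assms(2,1) _ coset_sym[OF H_subgroup assms]]
    by blast
  then show ?thesis by (auto simp: cell_def)
qed

lemma exists_largest_cell:
  "\<exists>p<n. \<forall>b. \<forall>u\<in>carrier G. card (cell b u) \<le> card (cell (blk p) (g p))"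
proof -
  obtain i where i: "i < n" using blk_surj m_pos by blast
  have "card (cell (blk j) (g j)) \<le> n" for j
    using card_mono[of "{..<n}" "cell (blk j) (g j)"] by (auto simp: cell_def)
  then obtain p where p: "p < n" "\<And>j. j < n \<Longrightarrow> card (cell (blk j) (g j)) \<le> card (cell (blk p) (g p))"
    using ex_has_greatest_nat[of "\<lambda>j. j < n" i "\<lambda>j. card (cell (blk j) (g j))" "Suc n", OF i]
    by (auto simp: less_Suc_eq_le)
  have "card (cell b u) \<le> card (cell (blk p) (g p))" if u: "u \<in> carrier G" for b u
  proof (cases "cell b u = {}")
    case False
    then obtain j where j: "j < n" "blk j = b" "inv (g j) \<otimes> u \<in> H" by (auto simp: cell_def)
    then have "cell b u = cell (blk j) (g j)" using cell_cong[of "g j" u b] u by simp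
    with p(2)[OF j(1)] show ?thesis by simp
  qed simp
  with p(1) show ?thesis by blast
qed

end

section \<open>Recovering the support\<close>

context two
begin

text \<open>The items of degree \<open>\<one>\<close> on the square of the cell land injectively in
  the square of one cell, which compares the sizes. The extra item \<open>(p, p, t)\<close>,
  admissible since \<open>t\<close> lies in \<open>H\<close>, ends in the coset of
  \<open>inv t \<otimes> u\<close>; this differs from the coset of \<open>u\<close> unless
  \<open>t\<close> lies in \<open>H'\<close>.\<close>

lemma cell_transfer:
  assumes p: "p < n" and t: "t \<in> H"
  shows "\<exists>k u. u \<in> carrier G \<and> card (A.cell (blk p) (g p)) \<le> card (B.cell k u) \<and>
    B.cell k (inv t \<otimes> u) \<noteq> {}"
proof -
  let ?C = "A.cell (blk p) (g p)"
  \<comment> \<open>Constant on the cell, so that all images lie in one \<open>H'\<close>-coset,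
    whatever the relation between \<open>H\<close> and \<open>H'\<close>.\<close>
  define \<gamma> where "\<gamma> i = (if i \<in> ?C then g p else g i)" for i
  define I where "I = (\<lambda>(i, j). (i, j, \<one>)) ` (?C \<times> ?C) \<union> {(p, p, t)}"
  have pC: "p \<in> ?C" using p by (rule A.cell_self)
  have C: "i < n" "blk i = blk p" "inv (g i) \<otimes> g p \<in> H" if "i \<in> ?C" for i
    using that by (auto simp: A.cell_def)
  have fin: "finite I" by (auto simp: I_def)
  have items: "i < n \<and> j < n \<and> blk i = blk j \<and> t' \<in> carrier G \<and> inv (g i) \<otimes> t' \<otimes> g j \<in> H"
    if "(i, j, t') \<in> I" for i j t'
  proof -
    consider "i \<in> ?C" "j \<in> ?C" "t' = \<one>" | "i = p" "j = p" "t' = t"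
      using \<open>(i, j, t') \<in> I\<close> unfolding I_def by auto
    then show ?thesis
    proof cases
      case 1
      then show ?thesis using C[of i] C[of j] p
          A.coset_trans[OF A.H_subgroup _ _ _ C(3)[of i] A.coset_sym[OF A.H_subgroup _ _ C(3)[of j]]]
        by simp
    next
      case 2
      then show ?thesis using p t A.H_carrier[OF t] by (simp add: A.ab_simps)
    qed
  qed
  have \<gamma>: "\<gamma> i \<in> carrier G \<and> inv (g i) \<otimes> \<gamma> i \<in> H" if "i < n" for i
    using that C(3) p A.coset_refl[OF A.H_subgroup] by (auto simp: \<gamma>_def)
  obtain F \<theta> where F_map: "items_map I \<gamma> F \<theta>"
    using items_transfer[OF fin items \<gamma>] by blast
  note \<theta> = items_mapD(1)[OF F_map] and F = items_mapD(2)[OF F_map]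
    and inj = items_mapD(3)[OF F_map] and mono = items_mapD(4)[OF F_map]
  define k where "k = blk' (fst (F (p, p, \<one>)))"
  define u where "u = g p \<otimes> \<theta>"
  have u: "u \<in> carrier G" using p \<theta> by (simp add: u_def)
  have I1: "(i, j, \<one>) \<in> I" if "i \<in> ?C" "j \<in> ?C" for i j using that by (auto simp: I_def)
  have It: "(p, p, t) \<in> I" by (simp add: I_def)
  have k: "blk' (fst (F a)) = k" if "a \<in> I" for a
  proof -
    have "blk (fst a) = blk p" using that C by (auto simp: I_def)
    then show ?thesis using mono[OF that I1[OF pC pC]] mono[OF I1[OF pC pC] that] by (simp add: k_def)
  qed
  have mem: "F (i, j, \<one>) \<in> B.cell k u \<times> B.cell k u" if "i \<in> ?C" "j \<in> ?C" for i j
    using F[OF I1[OF that]] k[OF I1[OF that]] that p \<theta>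
    by (auto simp: B.cell_def mem_Times_iff \<gamma>_def u_def A.m_assoc)
  have "card (?C \<times> ?C) \<le> card (B.cell k u \<times> B.cell k u)"
  proof (rule card_inj_on_le[where f = "\<lambda>(i, j). F (i, j, \<one>)"])
    show "inj_on (\<lambda>(i, j). F (i, j, \<one>)) (?C \<times> ?C)"
    proof (rule inj_onI)
      fix x y assume "x \<in> ?C \<times> ?C" "y \<in> ?C \<times> ?C"
        "(case x of (i, j) \<Rightarrow> F (i, j, \<one>)) = (case y of (i, j) \<Rightarrow> F (i, j, \<one>))"
      then show "x = y"
        using inj[OF I1 I1, of "fst x" "snd x" "fst y" "snd y"] by (cases x; cases y) simp
    qed
    show "(\<lambda>(i, j). F (i, j, \<one>)) ` (?C \<times> ?C) \<subseteq> B.cell k u \<times> B.cell k u"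
    proof (rule image_subsetI)
      fix x assume "x \<in> ?C \<times> ?C"
      then show "(case x of (i, j) \<Rightarrow> F (i, j, \<one>)) \<in> B.cell k u \<times> B.cell k u"
        using mem[of "fst x" "snd x"] by (cases x) simp
    qed
  qed simp
  then have "(card ?C)\<^sup>2 \<le> (card (B.cell k u))\<^sup>2" by (simp add: card_cartesian_product power2_eq_square)
  then have "card ?C \<le> card (B.cell k u)" by simp
  moreover have "snd (F (p, p, t)) \<in> B.cell k (inv t \<otimes> u)"
    using F[OF It] k[OF It] p \<theta> pC A.H_carrier[OF t] by (auto simp: B.cell_def \<gamma>_def u_def A.m_assoc)
  ultimately show ?thesis using u by blast
qed

end

locale two_eq = two +
  assumes ids_sup: "A.ids \<subseteq> B.ids"
begin

lemma rev_two: "two G s' D' H' n' m' blk' g' s D H n m blk g"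
  by unfold_locales (rule ids_sup)

text \<open>If \<open>t \<in> H - H'\<close>, then a largest cell of size \<open>M\<close> is carried to two cells \<open>C\<close>, \<open>C'\<close> of one
  block, the first of size \<open>M\<close>. Carrying the \<open>M\<^sup>2 + card C'\<^sup>2\<close> items of \<open>C \<times> C \<union> C' \<times> C'\<close> back
  places too many matrix units into a single product of two cells.\<close>

lemma support_subset: "H \<subseteq> H'"
proof
  interpret rev: two G s' D' H' n' m' blk' g' s D H n m blk g by (rule rev_two)
  fix t assume t: "t \<in> H"
  show "t \<in> H'"
  proof (rule ccontr)
    assume tH': "t \<notin> H'"
    have tc: "t \<in> carrier G" using t by simp
    obtain p where p: "p < n" "\<And>b u. u \<in> carrier G \<Longrightarrow> card (A.cell b u) \<le> card (A.cell (blk p) (g p))"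
      using A.exists_largest_cell by blast
    obtain p' where p': "p' < n'" "\<And>b u. u \<in> carrier G \<Longrightarrow> card (B.cell b u) \<le> card (B.cell (blk' p') (g' p'))"
      using B.exists_largest_cell by blast
    obtain k u where u: "u \<in> carrier G" "card (A.cell (blk p) (g p)) \<le> card (B.cell k u)"
      "B.cell k (inv t \<otimes> u) \<noteq> {}" using cell_transfer[OF p(1) t] by blast
    obtain k2 u2 where u2: "u2 \<in> carrier G" "card (B.cell (blk' p') (g' p')) \<le> card (A.cell k2 u2)"
      using rev.cell_transfer[OF p'(1) subgroup.one_closed[OF B.H_subgroup]] by blast
    define M where "M = card (A.cell (blk p) (g p))"
    have "card (A.cell k2 u2) \<le> M" unfolding M_def by (rule p(2)[OF u2(1)])
    moreover have "card (B.cell k u) \<le> card (B.cell (blk' p') (g' p'))" by (rule p'(2)[OF u(1)])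
    \<comment> \<open>Transfer in both directions closes a circle of inequalities, so the image of
      the largest cell is again a cell of size \<open>M\<close>.\<close>
    ultimately have M: "card (B.cell k u) = M" using u(2) u2(2) unfolding M_def by linarith
    let ?C = "B.cell k u" and ?C' = "B.cell k (inv t \<otimes> u)"
    have "M > 0" using A.cell_self[OF p(1)] by (auto simp: M_def card_gt_0_iff)
    then obtain q where q: "q \<in> ?C" using M by fastforce
    have disj: "?C \<inter> ?C' = {}"
    proof (rule ccontr)
      assume "?C \<inter> ?C' \<noteq> {}"
      then obtain i where i: "i < n'" "inv (g' i) \<otimes> u \<in> H'" "inv (g' i) \<otimes> (inv t \<otimes> u) \<in> H'"
        by (auto simp: B.cell_def)
      then have "inv (inv t \<otimes> u) \<otimes> u \<in> H'" using A.coset_diff[OF B.H_subgroup, of "g' i"] u(1) tc by simp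
      also have "inv (inv t \<otimes> u) \<otimes> u = t" using u(1) tc by (simp add: A.ab_simps)
      finally show False using tH' by simp
    qed
    define \<gamma> where "\<gamma> i = (if i \<in> ?C then u else if i \<in> ?C' then inv t \<otimes> u else g' i)" for i
    define S where "S = ?C \<times> ?C \<union> ?C' \<times> ?C'"
    define I where "I = (\<lambda>(i, j). (i, j, \<one>)) ` S"
    have fin: "finite I" by (auto simp: I_def S_def)
    have items: "i < n' \<and> j < n' \<and> blk' i = blk' j \<and> t' \<in> carrier G \<and> inv (g' i) \<otimes> t' \<otimes> g' j \<in> H'"
      if "(i, j, t') \<in> I" for i j t'
    proof -
      obtain v where v: "v \<in> carrier G" "i \<in> B.cell k v" "j \<in> B.cell k v" "t' = \<one>"
      proof (cases "i \<in> ?C \<and> j \<in> ?C \<and> t' = \<one>")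
        case True
        then show ?thesis using that u(1) by blast
      next
        case False
        then have "i \<in> ?C' \<and> j \<in> ?C' \<and> t' = \<one>" using \<open>(i, j, t') \<in> I\<close> by (auto simp: I_def S_def)
        then show ?thesis using that[of "inv t \<otimes> u"] u(1) tc by auto
      qed
      then show ?thesis
        using A.coset_trans[OF B.H_subgroup, of "g' i" v "g' j"] A.coset_sym[OF B.H_subgroup, of "g' j" v]
        by (auto simp: B.cell_def)
    qed
    have \<gamma>: "\<gamma> i \<in> carrier G \<and> inv (g' i) \<otimes> \<gamma> i \<in> H'" if "i < n'" for i
      using that u(1) tc A.coset_refl[OF B.H_subgroup] by (auto simp: \<gamma>_def B.cell_def)
    obtain F \<theta> where F_map: "rev.items_map I \<gamma> F \<theta>"
    using rev.items_transfer[OF fin items \<gamma>] by blast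
  note \<theta> = rev.items_mapD(1)[OF F_map] and F = rev.items_mapD(2)[OF F_map]
    and inj = rev.items_mapD(3)[OF F_map] and mono = rev.items_mapD(4)[OF F_map]
    define k0 where "k0 = blk (fst (F (q, q, \<one>)))"
    have I1: "(i, j, \<one>) \<in> I" if "(i, j) \<in> S" for i j using that by (auto simp: I_def)
    have qS: "(q, q) \<in> S" using q by (simp add: S_def)
    have mem: "F (i, j, \<one>) \<in> A.cell k0 (u \<otimes> \<theta>) \<times> A.cell k0 (u \<otimes> \<theta>)" if ij: "(i, j) \<in> S" for i j
    proof -
      have "blk' i = blk' q" using ij q by (auto simp: S_def B.cell_def)
      then have k: "blk (fst (F (i, j, \<one>))) = k0"
        using mono[OF I1[OF ij] I1[OF qS]] mono[OF I1[OF qS] I1[OF ij]] by (simp add: k0_def)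
      \<comment> \<open>Since \<open>t\<close> lies in \<open>H\<close>, both values of
        \<open>\<gamma>\<close> describe the same coset in the first algebra, and both squares are
        sent into one square.\<close>
      have "\<gamma> i = u \<or> \<gamma> i = inv t \<otimes> u" using ij by (auto simp: S_def \<gamma>_def)
      then have v: "inv a \<otimes> (u \<otimes> \<theta>) \<in> H" if a: "a \<in> carrier G" "inv a \<otimes> \<gamma> i \<otimes> \<theta> \<in> H" for a
      proof
        assume "\<gamma> i = inv t \<otimes> u"
        then have "t \<otimes> (inv a \<otimes> (inv t \<otimes> u) \<otimes> \<theta>) \<in> H"
          using \<open>\<gamma> i = inv t \<otimes> u\<close> a(2) by (intro subgroup.m_closed[OF A.H_subgroup t]) simp
        also have "t \<otimes> (inv a \<otimes> (inv t \<otimes> u) \<otimes> \<theta>) = inv a \<otimes> (u \<otimes> \<theta>)"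
          using tc u(1) a(1) \<theta> by (simp add: A.ab_simps)
        finally show ?thesis .
      qed (use a u(1) \<theta> in \<open>simp add: A.m_assoc\<close>)
      have "\<gamma> i \<in> carrier G" using ij \<gamma> by (auto simp: S_def B.cell_def)
      then show ?thesis using F[OF I1[OF ij]] k v by (auto simp: A.cell_def mem_Times_iff)
    qed
    have "card S \<le> card (A.cell k0 (u \<otimes> \<theta>) \<times> A.cell k0 (u \<otimes> \<theta>))"
    proof (rule card_inj_on_le[where f = "\<lambda>(i, j). F (i, j, \<one>)"])
      show "inj_on (\<lambda>(i, j). F (i, j, \<one>)) S"
      proof (rule inj_onI)
        fix x y assume "x \<in> S" "y \<in> S"
          "(case x of (i, j) \<Rightarrow> F (i, j, \<one>)) = (case y of (i, j) \<Rightarrow> F (i, j, \<one>))"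
        then show "x = y"
          using inj[OF I1 I1, of "fst x" "snd x" "fst y" "snd y"] by (cases x; cases y) simp
      qed
      show "(\<lambda>(i, j). F (i, j, \<one>)) ` S \<subseteq> A.cell k0 (u \<otimes> \<theta>) \<times> A.cell k0 (u \<otimes> \<theta>)"
      proof (rule image_subsetI)
        fix x assume "x \<in> S"
        then show "(case x of (i, j) \<Rightarrow> F (i, j, \<one>)) \<in> A.cell k0 (u \<otimes> \<theta>) \<times> A.cell k0 (u \<otimes> \<theta>)"
          using mem[of "fst x" "snd x"] by (cases x) simp
      qed
    qed simp
    also have "\<dots> \<le> M * M" unfolding card_cartesian_product M_def
      using p(2) u(1) \<theta> by (intro mult_mono) auto
    also have "\<dots> < M * M + card ?C' * card ?C'"
      using u(3) by (simp add: card_gt_0_iff)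
    also have "\<dots> = card S" unfolding S_def
      using disj by (subst card_Un_disjoint) (auto simp: card_cartesian_product M)
    finally show False by simp
  qed
qed

end

section \<open>Recovering the blocks\<close>

context two
begin

text \<open>Pairs with equal images have congruent degrees. The degree \<open>t i j\<close> of an
  item is a representative depending only on the coset, so such pairs belong to one class, and
  injectivity within classes becomes injectivity on all pairs.\<close>

lemma block_pairs_transfer:
  assumes HH: "H' = H"
  shows "\<exists>F. \<exists>\<theta>\<in>carrier G. inj_on F A.block_pairs \<and> F ` A.block_pairs \<subseteq> B.block_pairs \<and>
    (\<forall>i j. (i, j) \<in> A.block_pairs \<longrightarrow>
       inv (g' (fst (F (i, j)))) \<otimes> (g i \<otimes> \<theta>) \<in> H \<and> inv (g' (snd (F (i, j)))) \<otimes> (g j \<otimes> \<theta>) \<in> H) \<and>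
    (\<forall>i j k l. (i, j) \<in> A.block_pairs \<longrightarrow> (k, l) \<in> A.block_pairs \<longrightarrow> blk i \<le> blk k \<longrightarrow>
       blk' (fst (F (i, j))) \<le> blk' (fst (F (k, l))))"
proof -
  let ?E = A.block_pairs
  \<comment> \<open>The predicate depends only on the coset of \<open>x\<close>, hence so does the
    chosen element.\<close>
  define rep where "rep x = (SOME y. y \<in> carrier G \<and> inv x \<otimes> y \<in> H)" for x
  have rep: "rep x \<in> carrier G \<and> inv x \<otimes> rep x \<in> H" if "x \<in> carrier G" for x
    unfolding rep_def by (rule someI[of _ x]) (use that A.coset_refl[OF A.H_subgroup] in auto)
  have rep_eq: "rep x = rep y" if "x \<in> carrier G" "y \<in> carrier G" "inv x \<otimes> y \<in> H" for x y
  proof -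
    have "(z \<in> carrier G \<and> inv x \<otimes> z \<in> H) = (z \<in> carrier G \<and> inv y \<otimes> z \<in> H)" for z
      using A.coset_diff[OF A.H_subgroup that(1,2) _ that(3)] A.coset_trans[OF A.H_subgroup that(1,2) _ that(3)] by blast
    then show ?thesis by (simp add: rep_def)
  qed
  define t where "t i j = rep (g i \<otimes> inv (g j))" for i j
  define I where "I = (\<lambda>(i, j). (i, j, t i j)) ` ?E"
  have ijE: "i < n" "j < n" "blk i = blk j" if "(i, j) \<in> ?E" for i j
    using that by (auto simp: A.block_pairs_def)
  have t: "t i j \<in> carrier G" "inv (g i) \<otimes> t i j \<otimes> g j \<in> H" if "(i, j) \<in> ?E" for i j
  proof -
    note ij = ijE[OF that]
    show "t i j \<in> carrier G" using rep[of "g i \<otimes> inv (g j)"] ij by (simp add: t_def)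
    have "inv (g i \<otimes> inv (g j)) \<otimes> t i j \<in> H" using rep[of "g i \<otimes> inv (g j)"] ij by (simp add: t_def)
    also have "inv (g i \<otimes> inv (g j)) \<otimes> t i j = inv (g i) \<otimes> t i j \<otimes> g j"
      using ij \<open>t i j \<in> carrier G\<close> by (simp add: A.ab_simps)
    finally show "inv (g i) \<otimes> t i j \<otimes> g j \<in> H" .
  qed
  have fin: "finite I" by (auto simp: I_def)
  have items: "i < n \<and> j < n \<and> blk i = blk j \<and> t' \<in> carrier G \<and> inv (g i) \<otimes> t' \<otimes> g j \<in> H"
    if "(i, j, t') \<in> I" for i j t'
    using that t ijE by (auto simp: I_def)
  have \<gamma>: "g i \<in> carrier G \<and> inv (g i) \<otimes> g i \<in> H" if "i < n" for i
    using that A.coset_refl[OF A.H_subgroup] by auto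
  obtain F0 \<theta> where F_map: "items_map I g F0 \<theta>"
    using items_transfer[OF fin items \<gamma>] by blast
  note \<theta> = items_mapD(1)[OF F_map] and F0 = items_mapD(2)[OF F_map]
    and inj = items_mapD(3)[OF F_map] and mono = items_mapD(4)[OF F_map]
  define F where "F = (\<lambda>(i, j). F0 (i, j, t i j))"
  have I: "(i, j, t i j) \<in> I" if "(i, j) \<in> ?E" for i j using that by (auto simp: I_def)
  have F: "fst (F (i, j)) < n'" "snd (F (i, j)) < n'" "blk' (fst (F (i, j))) = blk' (snd (F (i, j)))"
    "inv (g' (fst (F (i, j)))) \<otimes> (g i \<otimes> \<theta>) \<in> H" "inv (g' (snd (F (i, j)))) \<otimes> (g j \<otimes> \<theta>) \<in> H"
    if "(i, j) \<in> ?E" for i j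
  proof -
    note ij = ijE[OF that] and tt = t[OF that] and f = F0[OF I[OF that]]
    show l: "fst (F (i, j)) < n'" "snd (F (i, j)) < n'" "blk' (fst (F (i, j))) = blk' (snd (F (i, j)))"
      using f by (auto simp: F_def)
    show "inv (g' (fst (F (i, j)))) \<otimes> (g i \<otimes> \<theta>) \<in> H"
      using f ij \<theta> by (auto simp: F_def HH A.m_assoc)
    have "inv (g' (snd (F (i, j)))) \<otimes> (inv (t i j) \<otimes> g i \<otimes> \<theta>) \<in> H"
      using f ij \<theta> tt(1) by (auto simp: F_def HH A.m_assoc)
    moreover have "inv (inv (t i j) \<otimes> g i \<otimes> \<theta>) \<otimes> (g j \<otimes> \<theta>) = inv (g i) \<otimes> t i j \<otimes> g j"
      using ij \<theta> tt(1) by (simp add: A.ab_simps)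
    ultimately show "inv (g' (snd (F (i, j)))) \<otimes> (g j \<otimes> \<theta>) \<in> H"
      using A.coset_trans[OF A.H_subgroup, of "g' (snd (F (i, j)))" "inv (t i j) \<otimes> g i \<otimes> \<theta>" "g j \<otimes> \<theta>"]
        tt ij \<theta> l by simp
  qed
  show ?thesis
  proof (intro exI[of _ F] bexI[OF _ \<theta>] conjI[of "inj_on _ _"] conjI[of "_ ` _ \<subseteq> _"] conjI[of "\<forall>i. _ i"] allI impI)
    show "inj_on F ?E"
    proof (rule inj_onI, clarify)
      fix i j k l assume ij: "(i, j) \<in> ?E" and kl: "(k, l) \<in> ?E" and eq: "F (i, j) = F (k, l)"
      note c = ijE[OF ij] ijE[OF kl]
      have "inv (g i \<otimes> \<theta>) \<otimes> (g k \<otimes> \<theta>) \<in> H"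
        by (rule A.coset_diff[OF A.H_subgroup _ _ _ F(4)[OF ij] F(4)[OF kl, folded eq]]) (use F(1)[OF ij] c \<theta> in auto)
      then have ik: "inv (g i) \<otimes> g k \<in> H" using c \<theta> by (simp add: A.coset_cancel)
      have "inv (g j \<otimes> \<theta>) \<otimes> (g l \<otimes> \<theta>) \<in> H"
        by (rule A.coset_diff[OF A.H_subgroup _ _ _ F(5)[OF ij] F(5)[OF kl, folded eq]]) (use F(2)[OF ij] c \<theta> in auto)
      then have jl: "inv (g j) \<otimes> g l \<in> H" using c \<theta> by (simp add: A.coset_cancel)
      have "inv (g i \<otimes> inv (g j)) \<otimes> (g k \<otimes> inv (g l)) \<in> H"
        by (rule A.coset_mult[OF A.H_subgroup _ _ _ _ ik A.coset_inv[OF A.H_subgroup _ _ jl]]) (use c in auto)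
      then have "t i j = t k l" unfolding t_def by (intro rep_eq) (use c in auto)
      then have "(i, j) = (k, l)" using inj[OF I[OF ij]] I[OF kl] eq by (simp add: F_def)
      then show "i = k \<and> j = l" by simp
    qed
    show "F ` ?E \<subseteq> B.block_pairs" using F(1-3) by (fastforce simp: B.block_pairs_def)
    show "inv (g' (fst (F (i, j)))) \<otimes> (g i \<otimes> \<theta>) \<in> H \<and> inv (g' (snd (F (i, j)))) \<otimes> (g j \<otimes> \<theta>) \<in> H"
      if "(i, j) \<in> ?E" for i j using F(4,5)[OF that] by blast
    show "blk' (fst (F (i, j))) \<le> blk' (fst (F (k, l)))"
      if "(i, j) \<in> ?E" "(k, l) \<in> ?E" "blk i \<le> blk k" for i j k l
      using mono[OF I[OF that(1)] I[OF that(2)]] that(3) by (simp add: F_def)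
  qed
qed

text \<open>Equal numbers of pairs turn the injection into a bijection. Weak preservation of the
  block order, used in both directions, sends all pairs of one block to the same block, which
  \<open>\<kappa>\<close> records.\<close>

lemma block_pairs_surj:
  assumes HH: "H' = H" and le: "card B.block_pairs \<le> card A.block_pairs"
  shows "\<exists>F \<kappa>. \<exists>\<theta>\<in>carrier G. bij_betw F A.block_pairs B.block_pairs \<and>
    (\<forall>i j. (i, j) \<in> A.block_pairs \<longrightarrow>
       inv (g' (fst (F (i, j)))) \<otimes> (g i \<otimes> \<theta>) \<in> H \<and> inv (g' (snd (F (i, j)))) \<otimes> (g j \<otimes> \<theta>) \<in> H) \<and>
    (\<forall>i j. (i, j) \<in> A.block_pairs \<longrightarrow> blk' (fst (F (i, j))) = \<kappa> (blk i)) \<and>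
    (\<forall>a b. a \<le> b \<longrightarrow> b < m \<longrightarrow> \<kappa> a \<le> \<kappa> b) \<and> \<kappa> ` {..<m} = {..<m'}"
proof -
  let ?E = A.block_pairs and ?E' = B.block_pairs
  obtain F \<theta> where \<theta>: "\<theta> \<in> carrier G" and F: "inj_on F ?E" "F ` ?E \<subseteq> ?E'"
    "\<And>i j. (i, j) \<in> ?E \<Longrightarrow>
       inv (g' (fst (F (i, j)))) \<otimes> (g i \<otimes> \<theta>) \<in> H \<and> inv (g' (snd (F (i, j)))) \<otimes> (g j \<otimes> \<theta>) \<in> H"
    "\<And>i j k l. (i, j) \<in> ?E \<Longrightarrow> (k, l) \<in> ?E \<Longrightarrow> blk i \<le> blk k \<Longrightarrow>
       blk' (fst (F (i, j))) \<le> blk' (fst (F (k, l)))"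
    using block_pairs_transfer[OF HH] by blast
  have "F ` ?E = ?E'"
    using F le by (intro card_seteq) (auto simp: card_image)
  then have bij: "bij_betw F ?E ?E'" using F(1) by (simp add: bij_betw_def)
  have "\<exists>P. \<forall>b<m. P b < n \<and> blk (P b) = b" using A.blk_surj by metis
  then obtain P where P: "\<And>b. b < m \<Longrightarrow> P b < n" "\<And>b. b < m \<Longrightarrow> blk (P b) = b" by blast
  have PE: "(P b, P b) \<in> ?E" if "b < m" for b using P[OF that] by (simp add: A.block_pairs_def)
  define \<kappa> where "\<kappa> b = blk' (fst (F (P b, P b)))" for b
  have \<kappa>: "blk' (fst (F (i, j))) = \<kappa> (blk i)" if ij: "(i, j) \<in> ?E" for i j
  proof -
    have "blk i < m" using ij A.blk_less by (auto simp: A.block_pairs_def)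
    then show ?thesis using F(4)[OF ij PE] F(4)[OF PE ij] P unfolding \<kappa>_def by (metis le_antisym order_refl)
  qed
  have mono: "\<kappa> a \<le> \<kappa> b" if "a \<le> b" "b < m" for a b
    using F(4)[OF PE PE, of a b] that P by (simp add: \<kappa>_def)
  have surj: "\<kappa> ` {..<m} = {..<m'}"
    proof
      show "\<kappa> ` {..<m} \<subseteq> {..<m'}"
      proof
        fix x assume "x \<in> \<kappa> ` {..<m}"
        then obtain b where "b < m" "x = \<kappa> b" by auto
        then show "x \<in> {..<m'}" using F(2) PE[of b] B.blk_less by (force simp: \<kappa>_def B.block_pairs_def)
      qed
      show "{..<m'} \<subseteq> \<kappa> ` {..<m}"
      proof
        fix b' assume "b' \<in> {..<m'}"
        then obtain i' where i': "i' < n'" "blk' i' = b'" using B.blk_surj by auto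
        then have "(i', i') \<in> F ` ?E" unfolding \<open>F ` ?E = ?E'\<close> by (simp add: B.block_pairs_def)
        then obtain i j where ij: "(i, j) \<in> ?E" "F (i, j) = (i', i')" by auto
        then have "b' = \<kappa> (blk i)" using \<kappa>[OF ij(1)] i' by simp
        moreover have "blk i < m" using ij(1) A.blk_less by (auto simp: A.block_pairs_def)
        ultimately show "b' \<in> \<kappa> ` {..<m}" by blast
      qed
    qed
  show ?thesis
    by (intro exI[of _ F] exI[of _ \<kappa>] bexI[OF _ \<theta>]) (use bij F(3) \<kappa> mono surj in blast)
qed

end

text \<open>The bijection of pairs restricts to one between the squares of corresponding cells.
  Corresponding cells therefore have equally many elements and can be matched with each
  other.\<close>

lemma (in two_eq) index_bijection:
  assumes HH: "H' = H"
  shows "\<exists>\<pi>. bij_betw \<pi> {..<n} {..<n'} \<and> (\<exists>\<theta>\<in>carrier G.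
    \<forall>i<n. blk' (\<pi> i) = blk i \<and> inv (g' (\<pi> i)) \<otimes> (g i \<otimes> \<theta>) \<in> H)"
proof -
  interpret rev: two G s' D' H' n' m' blk' g' s D H n m blk g by (rule rev_two)
  let ?E = A.block_pairs and ?E' = B.block_pairs
  have le: "card ?E \<le> card ?E'"
  proof -
    obtain F where "inj_on F ?E" "F ` ?E \<subseteq> ?E'" using block_pairs_transfer[OF HH] by blast
    then show ?thesis by (rule card_inj_on_le) simp
  qed
  have ge: "card ?E' \<le> card ?E"
  proof -
    obtain F where "inj_on F ?E'" "F ` ?E' \<subseteq> ?E" using rev.block_pairs_transfer[OF HH[symmetric]] by blast
    then show ?thesis by (rule card_inj_on_le) simp
  qed
  have "\<exists>\<kappa>. \<kappa> ` {..<m'} = {..<m}"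
    using rev.block_pairs_surj[OF HH[symmetric] le] by blast
  then have mm': "m \<le> m'" using surj_card_le[of "{..<m'}" "{..<m}"] by auto
  obtain F \<theta> \<kappa> where \<theta>: "\<theta> \<in> carrier G" and bij: "bij_betw F ?E ?E'"
    and F0: "\<forall>i j. (i, j) \<in> ?E \<longrightarrow>
       inv (g' (fst (F (i, j)))) \<otimes> (g i \<otimes> \<theta>) \<in> H \<and> inv (g' (snd (F (i, j)))) \<otimes> (g j \<otimes> \<theta>) \<in> H"
    "\<forall>i j. (i, j) \<in> ?E \<longrightarrow> blk' (fst (F (i, j))) = \<kappa> (blk i)"
    and \<kappa>0: "\<forall>a b. a \<le> b \<longrightarrow> b < m \<longrightarrow> \<kappa> a \<le> \<kappa> b" and surj: "\<kappa> ` {..<m} = {..<m'}"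
    using block_pairs_surj[OF HH ge] by (elim exE bexE conjE) (rule that; assumption)
  note F = F0[rule_format] and \<kappa> = \<kappa>0[rule_format] surj
  \<comment> \<open>There are surjections between the sets of blocks in both directions; a monotone
    one between equally many blocks is the identity.\<close>
  have "m = m'" using mm' surj_card_le[of "{..<m}" "{..<m'}" \<kappa>] \<kappa>(2) by simp
  then have \<kappa>_id: "\<kappa> b = b" if "b < m" for b
    using mono_surj_lessThan_id[of m \<kappa> b] \<kappa> that by simp
  have blkF: "blk' (fst (F (i, j))) = blk i" "blk' (snd (F (i, j))) = blk i"
    "fst (F (i, j)) < n'" "snd (F (i, j)) < n'" if ij: "(i, j) \<in> ?E" for i j
  proof -
    have "F (i, j) \<in> ?E'" using bij ij by (auto simp: bij_betw_def)
    moreover have "blk i < m" using ij A.blk_less by (auto simp: A.block_pairs_def)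
    ultimately show "blk' (fst (F (i, j))) = blk i" "blk' (snd (F (i, j))) = blk i"
      "fst (F (i, j)) < n'" "snd (F (i, j)) < n'"
      using F(2)[OF ij] \<kappa>_id by (auto simp: B.block_pairs_def)
  qed
  have cells: "card (A.cell b u) = card (B.cell b (u \<otimes> \<theta>))" if u: "u \<in> carrier G" for b u
  proof -
    let ?C = "A.cell b u" and ?C' = "B.cell b (u \<otimes> \<theta>)"
    have CE: "(i, j) \<in> ?E" if "i \<in> ?C" "j \<in> ?C" for i j
      using that by (auto simp: A.cell_def A.block_pairs_def)
    have sh: "inv (g i \<otimes> \<theta>) \<otimes> (u \<otimes> \<theta>) = inv (g i) \<otimes> u" if "i < n" for i
      using that u \<theta> by (simp add: A.coset_cancel)
    have C': "i' \<in> B.cell b v \<longleftrightarrow> i' < n' \<and> blk' i' = b \<and> inv (g' i') \<otimes> v \<in> H" for i' v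
      by (subst B.cell_def) (simp add: HH)
    have into: "i' \<in> ?C'" if "i' < n'" "blk' i' = b" "inv (g' i') \<otimes> (g i \<otimes> \<theta>) \<in> H" "i \<in> ?C" for i i'
      using that u \<theta> sh[of i] A.coset_trans[OF A.H_subgroup, of "g' i'" "g i \<otimes> \<theta>" "u \<otimes> \<theta>"]
      by (auto simp: A.cell_def C')
    have onto: "i \<in> ?C" if "i' \<in> ?C'" "i < n" "blk i = b" "inv (g' i') \<otimes> (g i \<otimes> \<theta>) \<in> H" for i i'
      using that u \<theta> sh[of i] A.coset_diff[OF A.H_subgroup, of "g' i'" "g i \<otimes> \<theta>" "u \<otimes> \<theta>"]
      by (auto simp: A.cell_def C')
    have "F ` (?C \<times> ?C) = ?C' \<times> ?C'"
    proof
      show "F ` (?C \<times> ?C) \<subseteq> ?C' \<times> ?C'"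
      proof (rule image_subsetI)
        fix p assume "p \<in> ?C \<times> ?C"
        then obtain i j where p: "p = (i, j)" and ij: "i \<in> ?C" "j \<in> ?C" by blast
        then have "blk i = b" by (simp add: A.cell_def)
        then show "F p \<in> ?C' \<times> ?C'"
          unfolding p
          using into[OF _ _ _ ij(1)] into[OF _ _ _ ij(2)] F(1)[OF CE[OF ij]] blkF[OF CE[OF ij]]
          by (simp add: mem_Times_iff)
      qed
      show "?C' \<times> ?C' \<subseteq> F ` (?C \<times> ?C)"
      proof clarify
        fix i' j' assume ij': "i' \<in> ?C'" "j' \<in> ?C'"
        then have "(i', j') \<in> ?E'" by (auto simp: B.cell_def B.block_pairs_def)
        then have "(i', j') \<in> F ` ?E" using bij by (simp add: bij_betw_def)
        then obtain i j where ij: "(i, j) \<in> ?E" "F (i, j) = (i', j')" by auto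
        have "blk i = b" "blk j = b" "i < n" "j < n"
          using blkF(1)[OF ij(1)] ij ij' by (auto simp: B.cell_def A.block_pairs_def)
        then have "i \<in> ?C" "j \<in> ?C"
          using onto[OF ij'(1)] onto[OF ij'(2)] F(1)[OF ij(1)] ij(2) by auto
        with ij(2) show "(i', j') \<in> F ` (?C \<times> ?C)" by (metis SigmaI image_eqI)
      qed
    qed
    moreover have "inj_on F (?C \<times> ?C)"
      using bij CE by (auto simp: bij_betw_def intro: inj_on_subset)
    ultimately have "card (?C' \<times> ?C') = card (?C \<times> ?C)" by (metis card_image)
    then have "(card ?C')\<^sup>2 = (card ?C)\<^sup>2" by (simp add: card_cartesian_product power2_eq_square)
    then show ?thesis by simp
  qed
  \<comment> \<open>A key is a block together with a coset. In \<open>key'\<close> the coset is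
    shifted by \<open>\<theta>\<close>, so that equality of keys is the relation required of
    \<open>\<pi>\<close>.\<close>
  define key where "key i = (blk i, {x \<in> carrier G. inv (g i) \<otimes> x \<in> H})" for i
  define key' where "key' i = (blk' i, {x \<in> carrier G. inv (g' i) \<otimes> (x \<otimes> \<theta>) \<in> H})" for i
  have key_key: "key i = key j \<longleftrightarrow> blk i = blk j \<and> inv (g i) \<otimes> g j \<in> H" if "i < n" "j < n" for i j
  proof
    assume "key i = key j"
    then have "blk i = blk j" "g j \<in> {x \<in> carrier G. inv (g i) \<otimes> x \<in> H}"
      using that subgroup.one_closed[OF A.H_subgroup] by (auto simp: key_def)
    then show "blk i = blk j \<and> inv (g i) \<otimes> g j \<in> H" by simp
  next
    assume a: "blk i = blk j \<and> inv (g i) \<otimes> g j \<in> H"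
    then show "key i = key j"
      using that A.coset_diff[OF A.H_subgroup, of "g i" "g j"] A.coset_trans[OF A.H_subgroup, of "g i" "g j"]
      by (auto simp: key_def)
  qed
  have key_key': "key' i' = key j \<longleftrightarrow> blk' i' = blk j \<and> inv (g' i') \<otimes> (g j \<otimes> \<theta>) \<in> H"
    if "i' < n'" "j < n" for i' j
  proof
    assume eq: "key' i' = key j"
    have "g j \<in> snd (key j)" using that by (simp add: key_def subgroup.one_closed[OF A.H_subgroup])
    then have "g j \<in> snd (key' i')" using eq by simp
    then show "blk' i' = blk j \<and> inv (g' i') \<otimes> (g j \<otimes> \<theta>) \<in> H" using eq by (simp add: key_def key'_def)
  next
    assume a: "blk' i' = blk j \<and> inv (g' i') \<otimes> (g j \<otimes> \<theta>) \<in> H"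
    have "inv (g' i') \<otimes> (x \<otimes> \<theta>) \<in> H \<longleftrightarrow> inv (g j) \<otimes> x \<in> H" if x: "x \<in> carrier G" for x
      using a x \<theta> \<open>i' < n'\<close> \<open>j < n\<close> A.coset_cancel[of "g j" x \<theta>]
        A.coset_diff[OF A.H_subgroup, of "g' i'" "g j \<otimes> \<theta>" "x \<otimes> \<theta>"]
        A.coset_trans[OF A.H_subgroup, of "g' i'" "g j \<otimes> \<theta>" "x \<otimes> \<theta>"] by auto
    then show "key' i' = key j" using a by (auto simp: key_def key'_def)
  qed
  have fib: "card {i \<in> {..<n}. key i = c} = card {i \<in> {..<n'}. key' i = c}" for c
  proof (cases "\<exists>j<n. key j = c")
    case True
    then obtain j where j: "j < n" "key j = c" by blast
    have "{i \<in> {..<n}. key i = c} = A.cell (blk j) (g j)"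
      using key_key[OF _ j(1)] j(2) by (auto simp: A.cell_def)
    moreover have "{i \<in> {..<n'}. key' i = c} = B.cell (blk j) (g j \<otimes> \<theta>)"
      using key_key'[OF _ j(1)] j(2) by (subst B.cell_def) (auto simp: HH)
    ultimately show ?thesis using cells[of "g j" "blk j"] j(1) by simp
  next
    case False
    have "key' i' \<noteq> c" if "i' < n'" for i'
    proof
      assume c: "key' i' = c"
      have "(i', i') \<in> ?E'" using that by (simp add: B.block_pairs_def)
      then have "(i', i') \<in> F ` ?E" using bij by (simp add: bij_betw_def)
      then obtain i j where ij: "(i, j) \<in> ?E" "F (i, j) = (i', i')" by auto
      have "i < n" using ij by (simp add: A.block_pairs_def)
      then have "key' i' = key i" using key_key'[OF that] F(1)[OF ij(1)] blkF[OF ij(1)] ij(2) by simp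
      with c False \<open>i < n\<close> show False by auto
    qed
    then have "{i \<in> {..<n}. key i = c} = {}" "{i \<in> {..<n'}. key' i = c} = {}" using False by auto
    then show ?thesis by (simp only:)
  qed
  obtain \<pi> where \<pi>: "bij_betw \<pi> {..<n} {..<n'}" "\<And>i. i \<in> {..<n} \<Longrightarrow> key' (\<pi> i) = key i"
    using bij_of_equal_fibres[OF finite_lessThan finite_lessThan fib] by blast
  have "blk' (\<pi> i) = blk i \<and> inv (g' (\<pi> i)) \<otimes> (g i \<otimes> \<theta>) \<in> H" if "i < n" for i
    using key_key'[of "\<pi> i" i] \<pi>(2)[of i] bij_betwE[OF \<pi>(1)] that by auto
  with \<pi>(1) \<theta> show ?thesis by blast
qed

section \<open>Isomorphisms of graded algebras\<close>

context gda
begin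

lemma D_uminus: "d \<in> carrier G \<Longrightarrow> x \<in> D d \<Longrightarrow> - x \<in> D d"
  using D_scale[of d x "-1"] by simp

lemma D_diff: "d \<in> carrier G \<Longrightarrow> x \<in> D d \<Longrightarrow> y \<in> D d \<Longrightarrow> x - y \<in> D d"
  using D_add[of d x "- y"] D_uminus by simp

lemma D_independent_image:
  assumes "finite T" "inj_on \<delta> T" "\<And>t. t \<in> T \<Longrightarrow> \<delta> t \<in> carrier G" "\<And>t. t \<in> T \<Longrightarrow> z t \<in> D (\<delta> t)"
    and "(\<Sum>t\<in>T. z t) = 0" "t \<in> T"
  shows "z t = 0"
proof -
  let ?i = "inv_into T \<delta>"
  have "z (?i (\<delta> t)) = 0"
  proof (rule D_independent[of "\<delta> ` T" "\<lambda>h. z (?i h)"])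
    show "(\<Sum>h\<in>\<delta> ` T. z (?i h)) = 0"
      using assms by (simp add: sum.reindex)
  qed (use assms in auto)
  then show ?thesis using assms by simp
qed

end

context utg
begin

lemma utc_carrier: "M \<in> utc \<Longrightarrow> M \<in> carrier_mat n n"
  by (simp add: utc_def)

lemma comp_utc: "M \<in> comp d \<Longrightarrow> M \<in> utc"
  by (simp add: comp_def)

lemma utc_add: "M \<in> utc \<Longrightarrow> N \<in> utc \<Longrightarrow> M + N \<in> utc"
  by (auto simp: utc_def)

lemma utc_scale: "M \<in> utc \<Longrightarrow> map_mat (s c) M \<in> utc"
  by (auto simp: utc_def)

lemma utc_one: "1\<^sub>m n \<in> utc"
  by (auto simp: utc_def)

lemma utc_zero: "0\<^sub>m n n \<in> utc"
  by (auto simp: utc_def)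

lemma utc_mult:
  assumes "M \<in> utc" "N \<in> utc"
  shows "M * N \<in> utc"
proof -
  have c: "M \<in> carrier_mat n n" "N \<in> carrier_mat n n" using assms utc_carrier by auto
  have "(M * N) $$ (i, j) = 0" if ij: "i < n" "j < n" "blk j < blk i" for i j
  proof -
    have "M $$ (i, k) * N $$ (k, j) = 0" if "k < n" for k
    proof (cases "blk k < blk i")
      case True
      then show ?thesis using assms(1) ij that by (simp add: utc_def)
    next
      case False
      then have "blk j < blk k" using ij by simp
      then show ?thesis using assms(2) ij that by (simp add: utc_def)
    qed
    then show ?thesis unfolding mult_mat_index[OF c ij(1,2)] by (intro sum.neutral) simp
  qed
  then show ?thesis using c by (simp add: utc_def del: index_mult_mat)
qed

lemma utc_wval: "(\<And>v. v \<in> set w \<Longrightarrow> \<phi> v \<in> utc) \<Longrightarrow> wval n \<phi> w \<in> utc"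
  by (induction w) (auto simp: utc_one intro: utc_mult)

end

locale pair = A: utg G s D H n m blk g + B: utg G s' D' H' n' m' blk' g'
  for G :: "'g monoid" (structure)
    and s :: "'k::field_char_0 \<Rightarrow> 'b::ring_1 \<Rightarrow> 'b" and D H n m blk g
    and s' :: "'k \<Rightarrow> 'c::ring_1 \<Rightarrow> 'c" and D' H' n' m' blk' g'
begin

text \<open>For components only inclusion is demanded, as in the notion of isomorphism of graded
  algebras; \<open>iso_comp_surj\<close> recovers equality.\<close>

definition graded_iso :: "('b mat \<Rightarrow> 'c mat) \<Rightarrow> bool" where
  "graded_iso \<Psi> \<longleftrightarrow> bij_betw \<Psi> A.utc B.utc \<and>
     (\<forall>M\<in>A.utc. \<forall>N\<in>A.utc. \<Psi> (M + N) = \<Psi> M + \<Psi> N \<and> \<Psi> (M * N) = \<Psi> M * \<Psi> N) \<and>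
     \<Psi> (1\<^sub>m n) = 1\<^sub>m n' \<and> (\<forall>c. \<forall>M\<in>A.utc. \<Psi> (map_mat (s c) M) = map_mat (s' c) (\<Psi> M)) \<and>
     (\<forall>d\<in>carrier G. \<Psi> ` A.comp d \<subseteq> B.comp d)"

context
  fixes \<Psi>
  assumes iso: "graded_iso \<Psi>"
begin

lemma iso_bij: "bij_betw \<Psi> A.utc B.utc"
  and iso_add: "M \<in> A.utc \<Longrightarrow> N \<in> A.utc \<Longrightarrow> \<Psi> (M + N) = \<Psi> M + \<Psi> N"
  and iso_mult: "M \<in> A.utc \<Longrightarrow> N \<in> A.utc \<Longrightarrow> \<Psi> (M * N) = \<Psi> M * \<Psi> N"
  and iso_one: "\<Psi> (1\<^sub>m n) = 1\<^sub>m n'"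
  and iso_scale: "M \<in> A.utc \<Longrightarrow> \<Psi> (map_mat (s c) M) = map_mat (s' c) (\<Psi> M)"
  and iso_comp: "d \<in> carrier G \<Longrightarrow> M \<in> A.comp d \<Longrightarrow> \<Psi> M \<in> B.comp d"
  using iso unfolding graded_iso_def by blast+

lemma iso_in: "M \<in> A.utc \<Longrightarrow> \<Psi> M \<in> B.utc"
  using iso_bij by (auto simp: bij_betw_def)

lemma iso_zero: "\<Psi> (0\<^sub>m n n) = 0\<^sub>m n' n'"
proof -
  have "map_mat (s 0) (1\<^sub>m n) = (0\<^sub>m n n :: 'b mat)" "map_mat (s' 0) (1\<^sub>m n') = (0\<^sub>m n' n' :: 'c mat)"
    by (auto intro!: eq_matI)
  then show ?thesis using iso_scale[OF A.utc_one, of 0] iso_one by simp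
qed

lemma iso_wval:
  "(\<And>v. v \<in> set w \<Longrightarrow> \<phi> v \<in> A.utc) \<Longrightarrow> \<Psi> (wval n \<phi> w) = wval n' (\<Psi> \<circ> \<phi>) w"
  by (induction w) (auto simp: iso_one iso_mult A.utc_wval)

lemma iso_sum:
  assumes "finite S" "\<And>w. w \<in> S \<Longrightarrow> F w \<in> A.utc"
  shows "mat n n (\<lambda>p. \<Sum>w\<in>S. F w $$ p) \<in> A.utc \<and>
    \<Psi> (mat n n (\<lambda>p. \<Sum>w\<in>S. F w $$ p)) = mat n' n' (\<lambda>p. \<Sum>w\<in>S. \<Psi> (F w) $$ p)"
  using assms
proof (induction S)
  case empty
  have "mat n n (\<lambda>p. 0) = (0\<^sub>m n n :: 'b mat)" "mat n' n' (\<lambda>p. 0) = (0\<^sub>m n' n' :: 'c mat)" by auto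
  then show ?case using iso_zero A.utc_zero by simp
next
  case (insert w S)
  let ?M = "\<lambda>S. mat n n (\<lambda>p. \<Sum>w\<in>S. F w $$ p)" and ?N = "\<lambda>S. mat n' n' (\<lambda>p. \<Sum>w\<in>S. \<Psi> (F w) $$ p)"
  have w: "F w \<in> A.utc" "\<Psi> (F w) \<in> carrier_mat n' n'" "F w \<in> carrier_mat n n"
    using insert.prems iso_in A.utc_carrier B.utc_carrier by auto
  have "?M (insert w S) = F w + ?M S" "?N (insert w S) = \<Psi> (F w) + ?N S"
    using insert.hyps w by (auto intro!: eq_matI)
  then show ?case using insert w by (simp add: iso_add A.utc_add)
qed

lemma iso_ev:
  assumes "\<And>w v. w \<in> Poly_Mapping.keys f \<Longrightarrow> v \<in> set w \<Longrightarrow> \<phi> v \<in> A.utc"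
  shows "ev s n \<phi> f \<in> A.utc" "\<Psi> (ev s n \<phi> f) = ev s' n' (\<Psi> \<circ> \<phi>) f"
proof -
  let ?F = "\<lambda>w. map_mat (s (Poly_Mapping.lookup f w)) (wval n \<phi> w)"
  have W: "wval n \<phi> w \<in> A.utc" if "w \<in> Poly_Mapping.keys f" for w
    using assms that by (intro A.utc_wval) blast
  have e1: "ev s n \<phi> f = mat n n (\<lambda>p. \<Sum>w\<in>Poly_Mapping.keys f. ?F w $$ p)"
    unfolding ev_def by (rule eq_matI) (auto intro!: sum.cong dest!: W A.utc_carrier)
  have "\<Psi> (?F w) = map_mat (s' (Poly_Mapping.lookup f w)) (wval n' (\<Psi> \<circ> \<phi>) w)"
    if "w \<in> Poly_Mapping.keys f" for w
    using W[OF that] assms that by (simp add: iso_scale iso_wval)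
  moreover have "wval n' (\<Psi> \<circ> \<phi>) w \<in> carrier_mat n' n'" if "w \<in> Poly_Mapping.keys f" for w
    using assms that iso_in B.utc_carrier by (intro wval_carrier) auto
  ultimately have "\<Psi> (?F w) $$ (i, j) = s' (Poly_Mapping.lookup f w) (wval n' (\<Psi> \<circ> \<phi>) w $$ (i, j))"
    if "w \<in> Poly_Mapping.keys f" "i < n'" "j < n'" for w i j
    using that by (metis carrier_matD index_map_mat(1))
  then have e2: "ev s' n' (\<Psi> \<circ> \<phi>) f = mat n' n' (\<lambda>p. \<Sum>w\<in>Poly_Mapping.keys f. \<Psi> (?F w) $$ p)"
    unfolding ev_def by (intro eq_matI) (auto intro!: sum.cong)
  have "?F w \<in> A.utc" if "w \<in> Poly_Mapping.keys f" for w using W[OF that] by (rule A.utc_scale)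
  from iso_sum[of "Poly_Mapping.keys f" ?F, OF finite_keys this]
  show "ev s n \<phi> f \<in> A.utc" "\<Psi> (ev s n \<phi> f) = ev s' n' (\<Psi> \<circ> \<phi>) f"
    unfolding e1 e2 by auto
qed

text \<open>An entry of degree \<open>h\<close> at \<open>(i, j)\<close> contributes to the degree
  \<open>g i \<otimes> h \<otimes> inv (g j)\<close>. The given \<open>d\<close> is put into
  \<open>T\<close> so that the component of degree \<open>d\<close>, possibly zero, can be
  named.\<close>

lemma homogeneous_decomposition:
  assumes M: "M \<in> A.utc" and d: "d \<in> carrier G"
  shows "\<exists>T N. finite T \<and> T \<subseteq> carrier G \<and> d \<in> T \<and> (\<forall>t\<in>T. N t \<in> A.comp t) \<and>
    M = mat n n (\<lambda>p. \<Sum>t\<in>T. N t $$ p)"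
proof -
  \<comment> \<open>A zero entry receives the empty decomposition, which keeps the components
    block-triangular.\<close>
  have "\<exists>S c. finite S \<and> S \<subseteq> carrier G \<and> (\<forall>h\<in>S. c h \<in> D h) \<and> M $$ p = (\<Sum>h\<in>S. c h) \<and>
      (M $$ p = 0 \<longrightarrow> S = {})" for p
  proof (cases "M $$ p = 0")
    case True
    then show ?thesis by (intro exI[of _ "{}"]) simp
  next
    case False
    then show ?thesis using A.D_generate[of "M $$ p"] by blast
  qed
  then obtain S c where S: "\<And>p. finite (S p)" "\<And>p. S p \<subseteq> carrier G" "\<And>p h. h \<in> S p \<Longrightarrow> c p h \<in> D h"
    "\<And>p. M $$ p = (\<Sum>h\<in>S p. c p h)" "\<And>p. M $$ p = 0 \<Longrightarrow> S p = {}"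
    by metis
  define T where "T = insert d (\<Union>(i, j)\<in>{..<n} \<times> {..<n}. (\<lambda>h. g i \<otimes> h \<otimes> inv (g j)) ` S (i, j))"
  define \<delta> where "\<delta> = (\<lambda>(i, j) t. inv (g i) \<otimes> t \<otimes> g j)"
  define N where "N t = mat n n (\<lambda>p. if \<delta> p t \<in> S p then c p (\<delta> p t) else 0)" for t
  have fin: "finite T" using S(1) by (auto simp: T_def)
  have T: "T \<subseteq> carrier G"
  proof -
    have "g i \<otimes> h \<otimes> inv (g j) \<in> carrier G" if "i < n" "j < n" "h \<in> S (i, j)" for i j h
      using that S(2)[of "(i, j)"] by auto
    then show ?thesis using d by (auto simp: T_def)
  qed
  have N: "N t \<in> A.comp t" if t: "t \<in> T" for t
  proof -
    have tc: "t \<in> carrier G" using t T by blast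
    have "S (i, j) = {}" if "i < n" "j < n" "blk j < blk i" for i j
      using S(5)[of "(i, j)"] M that by (simp add: A.utc_def)
    then have "N t \<in> A.utc" by (auto simp: N_def A.utc_def)
    moreover have "N t $$ (i, j) \<in> D (inv (g i) \<otimes> t \<otimes> g j)" if "i < n" "j < n" for i j
      using S(3)[of "\<delta> (i, j) t" "(i, j)"] that tc A.D_zero by (simp add: N_def \<delta>_def)
    ultimately show ?thesis by (simp add: A.comp_def)
  qed
  have "M = mat n n (\<lambda>p. \<Sum>t\<in>T. N t $$ p)"
  proof (rule eq_matI)
    fix i j assume "i < dim_row (mat n n (\<lambda>p. \<Sum>t\<in>T. N t $$ p))" "j < dim_col (mat n n (\<lambda>p. \<Sum>t\<in>T. N t $$ p))"
    then have ij: "i < n" "j < n" by auto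
    let ?p = "(i, j)"
    have inj: "inj_on (\<delta> ?p) T"
      using ij T by (intro inj_onI) (auto simp: \<delta>_def subset_iff)
    have sub: "S ?p \<subseteq> \<delta> ?p ` T"
    proof
      fix h assume h: "h \<in> S ?p"
      then have "h \<in> carrier G" using S(2) by blast
      then have "h = \<delta> ?p (g i \<otimes> h \<otimes> inv (g j))" using ij by (simp add: \<delta>_def A.ab_simps)
      moreover have "g i \<otimes> h \<otimes> inv (g j) \<in> T" using h ij by (auto simp: T_def)
      ultimately show "h \<in> \<delta> ?p ` T" by blast
    qed
    have "(\<Sum>t\<in>T. N t $$ ?p) = (\<Sum>t\<in>T. if \<delta> ?p t \<in> S ?p then c ?p (\<delta> ?p t) else 0)"
      using ij by (simp add: N_def)
    also have "\<dots> = (\<Sum>h\<in>\<delta> ?p ` T. if h \<in> S ?p then c ?p h else 0)"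
      by (simp add: sum.reindex[OF inj])
    also have "\<dots> = (\<Sum>h\<in>S ?p. c ?p h)"
      using sub fin by (intro sum.mono_neutral_cong_right) auto
    finally show "M $$ (i, j) = mat n n (\<lambda>p. \<Sum>t\<in>T. N t $$ p) $$ (i, j)"
      using ij S(4)[of ?p] by simp
  qed (use M in \<open>auto dest: A.utc_carrier\<close>)
  with fin T N show ?thesis by (intro exI[of _ T] exI[of _ N]) (auto simp: T_def)
qed

text \<open>The images of the components of a preimage have different degrees and add up to an
  element of degree \<open>d\<close>. Independence in each entry shows that the component of degree
  \<open>d\<close> alone is mapped to this element.\<close>

lemma iso_comp_surj:
  assumes d: "d \<in> carrier G" and M': "M' \<in> B.comp d"
  shows "\<exists>M\<in>A.comp d. \<Psi> M = M'"
proof -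
  have "M' \<in> \<Psi> ` A.utc" using iso_bij M' B.comp_utc by (auto simp: bij_betw_def)
  then obtain M where M: "M \<in> A.utc" "\<Psi> M = M'" by blast
  obtain T N where T: "finite T" "T \<subseteq> carrier G" "d \<in> T" "\<And>t. t \<in> T \<Longrightarrow> N t \<in> A.comp t"
    "M = mat n n (\<lambda>p. \<Sum>t\<in>T. N t $$ p)"
    using homogeneous_decomposition[OF M(1) d] by blast
  have sum: "M' = mat n' n' (\<lambda>p. \<Sum>t\<in>T. \<Psi> (N t) $$ p)"
    using iso_sum[OF T(1), of N] T(4) A.comp_utc M(2) T(5) by auto
  have "\<Psi> (N d) = M'"
  proof (rule eq_matI)
    fix i j assume "i < dim_row M'" "j < dim_col M'"
    then have ij: "i < n'" "j < n'" using B.comp_carrier[OF M'] by auto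
    let ?\<delta> = "\<lambda>t. inv (g' i) \<otimes> t \<otimes> g' j"
    let ?z = "\<lambda>t. if t = d then \<Psi> (N t) $$ (i, j) - M' $$ (i, j) else \<Psi> (N t) $$ (i, j)"
    have "?z d = 0"
    proof (rule B.D_independent_image[OF T(1), of ?\<delta> ?z])
      show "inj_on ?\<delta> T" using ij T(2) by (intro inj_onI) (auto simp: subset_iff)
      show "?\<delta> t \<in> carrier G" if "t \<in> T" for t using that T(2) ij by auto
      show "?z t \<in> D' (?\<delta> t)" if "t \<in> T" for t
      proof -
        have "\<Psi> (N t) \<in> B.comp t" using that T by (intro iso_comp) auto
        then have 1: "\<Psi> (N t) $$ (i, j) \<in> D' (?\<delta> t)" using ij by (simp add: B.comp_def)
        have 2: "M' $$ (i, j) \<in> D' (?\<delta> d)" using M' ij by (simp add: B.comp_def)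
        have "?\<delta> d \<in> carrier G" using d ij by simp
        with 1 2 show ?thesis using B.D_diff[of "?\<delta> d"] by (cases "t = d") simp_all
      qed
      have "(\<Sum>t\<in>T. ?z t) = (\<Sum>t\<in>T. \<Psi> (N t) $$ (i, j) - (if t = d then M' $$ (i, j) else 0))"
        by (intro sum.cong) auto
      also have "\<dots> = 0" using sum ij T(1,3) by (simp add: sum_subtractf)
      finally show "(\<Sum>t\<in>T. ?z t) = 0" .
    qed (use T in simp)
    then show "\<Psi> (N d) $$ (i, j) = M' $$ (i, j)" by simp
  qed (use iso_comp[OF d T(4)[OF T(3)]] M' in \<open>auto dest!: B.comp_carrier\<close>)
  with T show ?thesis by blast
qed

text \<open>Evaluations correspond under \<open>\<Psi>\<close>. One inclusion pushes homogeneous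
  values forward, the other pulls them back and needs homogeneous preimages.\<close>

lemma iso_ids: "A.ids = B.ids"
proof
  show "B.ids \<subseteq> A.ids"
  proof
    fix f :: "('k, nat \<times> 'g) free_poly" assume f: "f \<in> B.ids"
    have keys: "\<forall>w\<in>Poly_Mapping.keys f. set w \<subseteq> UNIV \<times> carrier G" using f by (simp add: B.ids_def)
    have "ev s n \<phi> f = 0\<^sub>m n n" if \<phi>: "\<And>i d. d \<in> carrier G \<Longrightarrow> \<phi> (i, d) \<in> A.comp d" for \<phi>
    proof -
      have utc: "\<phi> v \<in> A.utc" if "w \<in> Poly_Mapping.keys f" "v \<in> set w" for w v
      proof -
        have "v \<in> UNIV \<times> carrier G" using keys that by blast
        then show ?thesis using \<phi>[of "snd v" "fst v"] A.comp_utc by (auto simp: mem_Times_iff)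
      qed
      have "\<forall>i. \<forall>d\<in>carrier G. (\<Psi> \<circ> \<phi>) (i, d) \<in> B.comp d" using \<phi> iso_comp by auto
      then have "ev s' n' (\<Psi> \<circ> \<phi>) f = 0\<^sub>m n' n'" using f by (simp add: B.ids_def)
      then have "\<Psi> (ev s n \<phi> f) = \<Psi> (0\<^sub>m n n)" using iso_ev(2)[of f \<phi>, OF utc] iso_zero by simp
      then show ?thesis
        using iso_bij iso_ev(1)[of f \<phi>, OF utc] A.utc_zero by (auto simp: bij_betw_def dest: inj_onD)
    qed
    with keys show "f \<in> A.ids" by (auto simp: A.ids_def)
  qed
  show "A.ids \<subseteq> B.ids"
  proof
    fix f :: "('k, nat \<times> 'g) free_poly" assume f: "f \<in> A.ids"
    have keys: "\<forall>w\<in>Poly_Mapping.keys f. set w \<subseteq> UNIV \<times> carrier G" using f by (simp add: A.ids_def)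
    have "ev s' n' \<phi>' f = 0\<^sub>m n' n'" if \<phi>': "\<And>i d. d \<in> carrier G \<Longrightarrow> \<phi>' (i, d) \<in> B.comp d" for \<phi>'
    proof -
      have "\<forall>v. \<exists>M. snd v \<in> carrier G \<longrightarrow> M \<in> A.comp (snd v) \<and> \<Psi> M = \<phi>' v"
        using iso_comp_surj \<phi>' by (metis prod.collapse)
      then obtain \<phi> where \<phi>: "\<And>v. snd v \<in> carrier G \<Longrightarrow> \<phi> v \<in> A.comp (snd v) \<and> \<Psi> (\<phi> v) = \<phi>' v"
        by metis
      have vc: "snd v \<in> carrier G" if "w \<in> Poly_Mapping.keys f" "v \<in> set w" for w v
      proof -
        have "v \<in> UNIV \<times> carrier G" using keys that by blast
        then show ?thesis by (simp add: mem_Times_iff)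
      qed
      have utc: "\<phi> v \<in> A.utc" if "w \<in> Poly_Mapping.keys f" "v \<in> set w" for w v
        using \<phi>[OF vc[OF that]] A.comp_utc by blast
      have "ev s n \<phi> f = 0\<^sub>m n n" using f \<phi> by (auto simp: A.ids_def)
      moreover have "ev s' n' \<phi>' f = ev s' n' (\<Psi> \<circ> \<phi>) f"
        by (rule ev_cong) (use \<phi> vc in auto)
      ultimately show ?thesis using iso_ev(2)[of f \<phi>, OF utc] iso_zero by simp
    qed
    with keys show "f \<in> B.ids" by (auto simp: B.ids_def)
  qed
qed

end

text \<open>Conjugation by the diagonal matrix of the \<open>Z i\<close> corrects the degrees of the matrix units.\<close>

lemma iso_exists:
  assumes f: "bij f" "\<And>x y. f (x + y) = f x + f y" "\<And>x y. f (x * y) = f x * f y" "f 1 = 1"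
    "\<And>c x. f (s c x) = s' c (f x)" "\<And>d x. d \<in> carrier G \<Longrightarrow> x \<in> D d \<Longrightarrow> f x \<in> D' d"
    and \<pi>: "bij_betw \<pi> {..<n} {..<n'}" "\<theta> \<in> carrier G"
    "\<And>i. i < n \<Longrightarrow> blk' (\<pi> i) = blk i \<and> inv (g' (\<pi> i)) \<otimes> (g i \<otimes> \<theta>) \<in> H'"
  shows "\<exists>\<Psi>. graded_iso \<Psi>"
proof -
  \<comment> \<open>\<open>h i\<close> lies in \<open>H'\<close>, so there is an invertible
    \<open>Z i\<close> of this degree; it compensates the difference between
    \<open>g' (\<pi> i)\<close> and \<open>g i \<otimes> \<theta>\<close>.\<close>
  define h where "h i = inv (g' (\<pi> i)) \<otimes> (g i \<otimes> \<theta>)" for i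
  have \<pi>n: "\<pi> i < n'" if "i < n" for i using bij_betwE[OF \<pi>(1)] that by auto
  have hc: "h i \<in> carrier G" if "i < n" for i using \<pi>n[OF that] that \<pi>(2) by (simp add: h_def)
  have "\<forall>i. \<exists>z w. i < n \<longrightarrow> z \<in> D' (h i) \<and> w \<in> D' (inv (h i)) \<and> z * w = 1 \<and> w * z = 1"
  proof
    fix i
    show "\<exists>z w. i < n \<longrightarrow> z \<in> D' (h i) \<and> w \<in> D' (inv (h i)) \<and> z * w = 1 \<and> w * z = 1"
    proof (cases "i < n")
      case True
      then obtain z where "z \<in> D' (h i)" "z \<noteq> 0" using \<pi>(3) B.D_nontriv unfolding h_def by blast
      then show ?thesis using B.D_inverse[OF hc[OF True]] by blast
    qed simp
  qed
  then obtain Z W where ZW: "\<And>i. i < n \<Longrightarrow> Z i \<in> D' (h i)" "\<And>i. i < n \<Longrightarrow> W i \<in> D' (inv (h i))"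
    "\<And>i. i < n \<Longrightarrow> Z i * W i = 1" "\<And>i. i < n \<Longrightarrow> W i * Z i = 1"
    by metis
  define \<sigma> where "\<sigma> = inv_into {..<n} \<pi>"
  have \<sigma>: "\<sigma> a < n" "\<pi> (\<sigma> a) = a" if "a < n'" for a
    using that bij_betw_imp_surj_on[OF \<pi>(1)] inv_into_into[of a \<pi> "{..<n}"] f_inv_into_f[of a \<pi> "{..<n}"]
    by (auto simp: \<sigma>_def)
  have \<sigma>\<pi>: "\<sigma> (\<pi> i) = i" if "i < n" for i
    using that bij_betw_imp_inj_on[OF \<pi>(1)] by (simp add: \<sigma>_def)
  have \<sigma>_bij: "bij_betw \<sigma> {..<n'} {..<n}" unfolding \<sigma>_def by (rule bij_betw_inv_into[OF \<pi>(1)])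
  define fi where "fi = inv_into UNIV f"
  have fi: "f (fi y) = y" "fi (f x) = x" for x y
    using f(1) by (simp_all add: fi_def bij_def surj_f_inv_f)
  have f0: "f 0 = 0" using f(2)[of 0 0] by simp
  have fi0: "fi 0 = 0" using fi(2)[of 0] f0 by simp
  have f_sum: "f (\<Sum>k\<in>S. F k) = (\<Sum>k\<in>S. f (F k))" for F and S :: "nat set"
    by (induction S rule: infinite_finite_induct) (auto simp: f0 f(2))
  define \<Psi> where "\<Psi> M = mat n' n' (\<lambda>(a, b). Z (\<sigma> a) * f (M $$ (\<sigma> a, \<sigma> b)) * W (\<sigma> b))" for M
  define \<Phi> where "\<Phi> M = mat n n (\<lambda>(i, j). fi (W i * M $$ (\<pi> i, \<pi> j) * Z j))" for M
  have \<Psi>_utc: "\<Psi> M \<in> B.utc" if "M \<in> A.utc" for M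
  proof -
    have "\<Psi> M $$ (a, b) = 0" if "a < n'" "b < n'" "blk' b < blk' a" for a b
    proof -
      have "blk (\<sigma> b) < blk (\<sigma> a)" using \<pi>(3)[of "\<sigma> a"] \<pi>(3)[of "\<sigma> b"] \<sigma> that by auto
      then show ?thesis using \<open>M \<in> A.utc\<close> \<sigma>(1) that by (simp add: \<Psi>_def A.utc_def f0)
    qed
    then show ?thesis by (simp add: B.utc_def \<Psi>_def)
  qed
  have \<Phi>_utc: "\<Phi> M \<in> A.utc" if "M \<in> B.utc" for M
  proof -
    have "\<Phi> M $$ (i, j) = 0" if "i < n" "j < n" "blk j < blk i" for i j
    proof -
      have "blk' (\<pi> j) < blk' (\<pi> i)" using \<pi>(3)[of i] \<pi>(3)[of j] that by auto
      then show ?thesis using \<open>M \<in> B.utc\<close> \<pi>n that by (simp add: \<Phi>_def B.utc_def fi0)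
    qed
    then show ?thesis by (simp add: A.utc_def \<Phi>_def)
  qed
  have canc: "W i * (Z i * x * W j) * Z j = x" "Z i * (W i * x * Z j) * W j = x" if "i < n" "j < n" for i j x
  proof -
    have "W i * (Z i * x * W j) * Z j = (W i * Z i) * x * (W j * Z j)"
      "Z i * (W i * x * Z j) * W j = (Z i * W i) * x * (Z j * W j)" by (simp_all only: mult.assoc)
    then show "W i * (Z i * x * W j) * Z j = x" "Z i * (W i * x * Z j) * W j = x"
      using ZW(3,4) that by simp_all
  qed
  have "bij_betw \<Psi> A.utc B.utc"
  proof (rule bij_betw_byWitness[where f' = \<Phi>])
    show "\<forall>M\<in>A.utc. \<Phi> (\<Psi> M) = M"
    proof
      fix M assume "M \<in> A.utc"
      then have "M \<in> carrier_mat n n" by (rule A.utc_carrier)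
      then show "\<Phi> (\<Psi> M) = M"
        by (intro eq_matI) (auto simp: \<Phi>_def \<Psi>_def \<pi>n \<sigma>\<pi> canc fi)
    qed
    show "\<forall>M\<in>B.utc. \<Psi> (\<Phi> M) = M"
    proof
      fix M assume "M \<in> B.utc"
      then have "M \<in> carrier_mat n' n'" by (rule B.utc_carrier)
      then show "\<Psi> (\<Phi> M) = M"
        by (intro eq_matI) (auto simp: \<Phi>_def \<Psi>_def \<sigma> canc fi)
    qed
  qed (use \<Psi>_utc \<Phi>_utc in auto)
  moreover have "\<Psi> (M + N) = \<Psi> M + \<Psi> N" if "M \<in> A.utc" "N \<in> A.utc" for M N
    using that[THEN A.utc_carrier] by (intro eq_matI) (auto simp: \<Psi>_def \<sigma> f(2) algebra_simps)
  moreover have "\<Psi> (M * N) = \<Psi> M * \<Psi> N" if "M \<in> A.utc" "N \<in> A.utc" for M N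
  proof (rule eq_matI)
    fix a b assume "a < dim_row (\<Psi> M * \<Psi> N)" "b < dim_col (\<Psi> M * \<Psi> N)"
    then have ab: "a < n'" "b < n'" by (auto simp: \<Psi>_def)
    have c: "M \<in> carrier_mat n n" "N \<in> carrier_mat n n" using that A.utc_carrier by auto
    have cP: "\<Psi> M \<in> carrier_mat n' n'" "\<Psi> N \<in> carrier_mat n' n'" by (simp_all add: \<Psi>_def)
    have "(\<Psi> M * \<Psi> N) $$ (a, b) = (\<Sum>k<n'. \<Psi> M $$ (a, k) * \<Psi> N $$ (k, b))"
      by (rule mult_mat_index[OF cP ab])
    also have "\<dots> = (\<Sum>k<n'. Z (\<sigma> a) * (f (M $$ (\<sigma> a, \<sigma> k)) * f (N $$ (\<sigma> k, \<sigma> b))) * W (\<sigma> b))"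
    proof (rule sum.cong[OF refl])
      fix k assume "k \<in> {..<n'}"
      then have k: "k < n'" by simp
      have "\<Psi> M $$ (a, k) * \<Psi> N $$ (k, b) =
          Z (\<sigma> a) * f (M $$ (\<sigma> a, \<sigma> k)) * (W (\<sigma> k) * Z (\<sigma> k)) * f (N $$ (\<sigma> k, \<sigma> b)) * W (\<sigma> b)"
        using ab k by (simp add: \<Psi>_def mult.assoc)
      then show "\<Psi> M $$ (a, k) * \<Psi> N $$ (k, b) =
          Z (\<sigma> a) * (f (M $$ (\<sigma> a, \<sigma> k)) * f (N $$ (\<sigma> k, \<sigma> b))) * W (\<sigma> b)"
        using ZW(4)[OF \<sigma>(1)[OF k]] by (simp add: mult.assoc)
    qed
    also have "\<dots> = (\<Sum>k<n. Z (\<sigma> a) * (f (M $$ (\<sigma> a, k)) * f (N $$ (k, \<sigma> b))) * W (\<sigma> b))"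
      by (rule sum.reindex_bij_betw[OF \<sigma>_bij, of "\<lambda>k. Z (\<sigma> a) * (f (M $$ (\<sigma> a, k)) * f (N $$ (k, \<sigma> b))) * W (\<sigma> b)"])
    also have "\<dots> = Z (\<sigma> a) * f (\<Sum>k<n. M $$ (\<sigma> a, k) * N $$ (k, \<sigma> b)) * W (\<sigma> b)"
      by (simp add: f_sum f(3) sum_distrib_left sum_distrib_right)
    also have "\<dots> = Z (\<sigma> a) * f ((M * N) $$ (\<sigma> a, \<sigma> b)) * W (\<sigma> b)"
      using mult_mat_index[OF c \<sigma>(1)[OF ab(1)] \<sigma>(1)[OF ab(2)]] by simp
    also have "\<dots> = \<Psi> (M * N) $$ (a, b)" using ab by (simp add: \<Psi>_def del: index_mult_mat)
    finally show "\<Psi> (M * N) $$ (a, b) = (\<Psi> M * \<Psi> N) $$ (a, b)" by simp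
  qed (simp_all add: \<Psi>_def)
  moreover have "\<Psi> (1\<^sub>m n) = 1\<^sub>m n'"
  proof (rule eq_matI)
    fix a b assume "a < dim_row (1\<^sub>m n' :: 'c mat)" "b < dim_col (1\<^sub>m n' :: 'c mat)"
    then have ab: "a < n'" "b < n'" by auto
    have "\<sigma> a = \<sigma> b \<longleftrightarrow> a = b" using \<sigma>(2)[OF ab(1)] \<sigma>(2)[OF ab(2)] by metis
    then show "\<Psi> (1\<^sub>m n) $$ (a, b) = 1\<^sub>m n' $$ (a, b)"
      using ab \<sigma>(1) ZW(3) by (simp add: \<Psi>_def f0 f(4))
  qed (simp_all add: \<Psi>_def)
  moreover have "\<Psi> (map_mat (s c) M) = map_mat (s' c) (\<Psi> M)" if "M \<in> A.utc" for c M
    using that[THEN A.utc_carrier]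
    by (intro eq_matI) (auto simp: \<Psi>_def \<sigma> f(5) simp flip: B.scale_mult_left B.scale_mult_right)
  moreover have "\<Psi> M \<in> B.comp d" if d: "d \<in> carrier G" and M: "M \<in> A.comp d" for d M
  proof -
    have "\<Psi> M $$ (a, b) \<in> D' (inv (g' a) \<otimes> d \<otimes> g' b)" if ab: "a < n'" "b < n'" for a b
    proof -
      let ?i = "\<sigma> a" and ?j = "\<sigma> b"
      have ij: "?i < n" "?j < n" "\<pi> ?i = a" "\<pi> ?j = b" using \<sigma> ab by auto
      have "M $$ (?i, ?j) \<in> D (inv (g ?i) \<otimes> d \<otimes> g ?j)" using M ij by (simp add: A.comp_def)
      then have "f (M $$ (?i, ?j)) \<in> D' (inv (g ?i) \<otimes> d \<otimes> g ?j)" using ij d by (intro f(6)) auto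
      then have "Z ?i * f (M $$ (?i, ?j)) * W ?j \<in> D' (h ?i \<otimes> (inv (g ?i) \<otimes> d \<otimes> g ?j) \<otimes> inv (h ?j))"
        using ij d hc by (intro B.D_mult ZW(1,2)) auto
      \<comment> \<open>The corrections on both sides replace \<open>g\<close> by \<open>g'\<close>,
        and the common shift \<open>\<theta>\<close> cancels.\<close>
      also have "h ?i \<otimes> (inv (g ?i) \<otimes> d \<otimes> g ?j) \<otimes> inv (h ?j) = inv (g' a) \<otimes> d \<otimes> g' b"
      proof -
        have "h ?i \<otimes> inv (g ?i) = inv (g' a) \<otimes> \<theta>" "inv (h ?j) \<otimes> g ?j = g' b \<otimes> inv \<theta>"
          using ij ab \<pi>(2) by (simp_all add: h_def A.ab_simps)
        moreover have "h ?i \<otimes> (inv (g ?i) \<otimes> d \<otimes> g ?j) \<otimes> inv (h ?j) =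
            (h ?i \<otimes> inv (g ?i)) \<otimes> d \<otimes> (inv (h ?j) \<otimes> g ?j)"
          using ij hc d by (simp add: A.m_ac)
        ultimately show ?thesis using ab d \<pi>(2) by (simp add: A.ab_simps)
      qed
      finally show ?thesis using ab by (simp add: \<Psi>_def)
    qed
    then show ?thesis using \<Psi>_utc[OF A.comp_utc[OF M]] by (simp add: B.comp_def)
  qed
  ultimately have "graded_iso \<Psi>" unfolding graded_iso_def by blast
  then show ?thesis by blast
qed

end

section \<open>Recovering the commutation factors\<close>

text \<open>For each edge \<open>l\<close> of a cell the word reads two closed walks from a base point through \<open>l\<close>,
  the first along \<open>BP l\<close> and the second along \<open>BQ l\<close>. The \<open>BP\<close>-letters have one common degree, and so
  have the \<open>BQ\<close>-letters; all other letters are alone in their class, which makes \<open>BP undefined\<close> and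
  \<open>BQ undefined\<close> in \<open>ccls\<close> mere tags.\<close>

datatype 'a clab = BU 'a | BP 'a | BV 'a | BW 'a | BQ 'a | BT 'a

definition cword :: "'a list \<Rightarrow> 'a clab list" where
  "cword Ls = concat (map (\<lambda>l. [BU l, BP l, BV l, BW l, BQ l, BT l]) Ls)"

definition clabels :: "'a set \<Rightarrow> 'a clab set" where
  "clabels S = BU ` S \<union> BP ` S \<union> BV ` S \<union> BW ` S \<union> BQ ` S \<union> BT ` S"

text \<open>Being the identity off \<open>S\<close>, it is an involution that permutes
  \<open>clabels S\<close>.\<close>

definition cswap :: "'a set \<Rightarrow> 'a clab \<Rightarrow> 'a clab" where
  "cswap S v = (case v of BP l \<Rightarrow> if l \<in> S then BQ l else v
     | BQ l \<Rightarrow> if l \<in> S then BP l else v | _ \<Rightarrow> v)"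

definition ccls :: "'a clab \<Rightarrow> 'a clab" where
  "ccls v = (case v of BP l \<Rightarrow> BP undefined | BQ l \<Rightarrow> BQ undefined | _ \<Rightarrow> v)"

lemma set_cword: "set (cword Ls) = clabels (set Ls)"
  by (auto simp: cword_def clabels_def)

lemma finite_clabels: "finite S \<Longrightarrow> finite (clabels S)"
  by (simp add: clabels_def)

lemma distinct_cword: "distinct Ls \<Longrightarrow> distinct (cword Ls)"
  unfolding cword_def by (rule distinct_concat_map) auto

lemma cswap_cswap [simp]: "cswap S (cswap S v) = v"
  by (cases v) (auto simp: cswap_def)

lemma cswap_permutes: "cswap S permutes clabels S"
proof (rule bij_imp_permutes)
  have "cswap S v \<in> clabels S" if "v \<in> clabels S" for v
    using that by (auto simp: clabels_def cswap_def)
  then show "bij_betw (cswap S) (clabels S) (clabels S)"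
    by (intro bij_betw_byWitness[where f' = "cswap S"]) auto
  show "cswap S v = v" if "v \<notin> clabels S" for v
    using that by (cases v) (auto simp: clabels_def cswap_def)
qed

lemma ccls_eqD:
  "ccls u = ccls v \<Longrightarrow> u = v \<or> (\<exists>l l'. u = BP l \<and> v = BP l') \<or> (\<exists>l l'. u = BQ l \<and> v = BQ l')"
  by (cases u; cases v) (auto simp: ccls_def)

lemma class_perms_mem: "\<sigma> \<in> class_perms cls W \<Longrightarrow> v \<in> W \<Longrightarrow> \<sigma> v \<in> W"
  by (simp add: class_perms_def permutes_in_image)

lemma class_perms_BP:
  assumes "\<sigma> \<in> class_perms ccls (clabels S)" "l \<in> S"
  shows "\<exists>l'\<in>S. \<sigma> (BP l) = BP l'" "\<exists>l'\<in>S. \<sigma> (BQ l) = BQ l'"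
proof -
  have m: "BP l \<in> clabels S" "BQ l \<in> clabels S" using assms(2) by (auto simp: clabels_def)
  show "\<exists>l'\<in>S. \<sigma> (BP l) = BP l'"
    using ccls_eqD[OF class_perms_cls[OF assms(1) m(1)]] class_perms_mem[OF assms(1) m(1)] assms(2)
    by (auto simp: clabels_def)
  show "\<exists>l'\<in>S. \<sigma> (BQ l) = BQ l'"
    using ccls_eqD[OF class_perms_cls[OF assms(1) m(2)]] class_perms_mem[OF assms(1) m(2)] assms(2)
    by (auto simp: clabels_def)
qed

lemma class_perms_fix:
  assumes "\<sigma> \<in> class_perms ccls (clabels S)" "\<And>l. v \<noteq> BP l" "\<And>l. v \<noteq> BQ l"
  shows "\<sigma> v = v"
proof (cases "v \<in> clabels S")
  case True
  then show ?thesis using ccls_eqD[OF class_perms_cls[OF assms(1) True]] assms by auto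
next
  case False
  then show ?thesis using class_perms_permutes[OF assms(1)] by (simp add: permutes_not_in)
qed

text \<open>The transposition acts from the left, so a fixed \<open>\<tau>\<close> on the right does
  not interfere. This covers the word itself and the one with exchanged letters.\<close>

lemma (in unital_algebra) alternating_walks_zero:
  assumes "(2 :: 'k) \<noteq> 0" "finite W" "x \<in> W" "y \<in> W" "x \<noteq> y" "cls x = cls y" "e x = e y"
  shows "(\<Sum>\<sigma>\<in>class_perms cls W. scale (of_int (sign \<sigma>))
    (if walk (e \<circ> (\<sigma> \<circ> \<tau>)) a w b then c else 0)) = 0"
proof (rule alternating_sum_zero[OF assms(1-6)])
  fix \<sigma>
  have "e \<circ> (transpose x y \<circ> \<sigma> \<circ> \<tau>) = e \<circ> (\<sigma> \<circ> \<tau>)"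
    using assms(7) by (auto simp: fun_eq_iff transpose_def)
  then show "(if walk (e \<circ> (transpose x y \<circ> \<sigma> \<circ> \<tau>)) a w b then c else 0) =
      (if walk (e \<circ> (\<sigma> \<circ> \<tau>)) a w b then c else 0)" by (simp only:)
qed

text \<open>If the \<open>BP\<close>- and the \<open>BQ\<close>-edges both fill the same square \<open>T\<close>, the permutation \<open>\<kappa>\<close> that
  exchanges a \<open>BP\<close>-label with the \<open>BQ\<close>-label on the same edge is conjugate to \<open>cswap S\<close>; hence
  \<open>\<sigma> \<mapsto> \<kappa> \<sigma> (cswap S)\<close> preserves both signs and walks. Otherwise two labels of one class share an
  edge and both sides vanish.\<close>

lemma (in unital_algebra) swap_walks_sum:
  fixes e :: "'v clab \<Rightarrow> 'i \<times> 'i"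
  assumes two: "(2 :: 'k) \<noteq> 0" and S: "finite S" and w: "set w = clabels S"
    and T: "finite T" "card T \<le> card S" "\<And>l. l \<in> S \<Longrightarrow> e (BP l) \<in> T" "\<And>l. l \<in> S \<Longrightarrow> e (BQ l) \<in> T"
  shows "(\<Sum>\<sigma>\<in>class_perms ccls (clabels S). scale (of_int (sign \<sigma>)) (if walk (e \<circ> \<sigma>) a w b then c else 0)) =
    (\<Sum>\<sigma>\<in>class_perms ccls (clabels S). scale (of_int (sign \<sigma>)) (if walk (e \<circ> (\<sigma> \<circ> cswap S)) a w b then c else 0))"
    (is "?L = ?R")
proof (cases "inj_on (\<lambda>l. e (BP l)) S \<and> inj_on (\<lambda>l. e (BQ l)) S")
  case False
  have "\<exists>x y. x \<in> clabels S \<and> y \<in> clabels S \<and> x \<noteq> y \<and> ccls x = ccls y \<and> e x = e y"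
  proof (cases "inj_on (\<lambda>l. e (BP l)) S")
    case True
    then obtain l l' where "l \<in> S" "l' \<in> S" "l \<noteq> l'" "e (BQ l) = e (BQ l')"
      using False by (auto simp: inj_on_def)
    then show ?thesis by (intro exI[of _ "BQ l"] exI[of _ "BQ l'"]) (simp add: clabels_def ccls_def)
  next
    case False
    then obtain l l' where "l \<in> S" "l' \<in> S" "l \<noteq> l'" "e (BP l) = e (BP l')"
      by (auto simp: inj_on_def)
    then show ?thesis by (intro exI[of _ "BP l"] exI[of _ "BP l'"]) (simp add: clabels_def ccls_def)
  qed
  then obtain x y where xy: "x \<in> clabels S" "y \<in> clabels S" "x \<noteq> y" "ccls x = ccls y" "e x = e y"
    by blast
  have "?L = 0" "?R = 0"
    using alternating_walks_zero[where \<tau> = id and cls = ccls, OF two finite_clabels[OF S] xy]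
      alternating_walks_zero[where \<tau> = "cswap S" and cls = ccls, OF two finite_clabels[OF S] xy]
    by simp_all
  then show ?thesis by simp
next
  case True
  let ?P = "class_perms ccls (clabels S)" and ?\<iota> = "cswap S"
  have full: "h ` S = T" if "inj_on h S" "\<And>l. l \<in> S \<Longrightarrow> h l \<in> T" for h :: "'v \<Rightarrow> 'i \<times> 'i"
    using that T(1,2) by (intro card_seteq) (auto simp: card_image)
  have bP: "bij_betw (\<lambda>l. e (BP l)) S T" and bQ: "bij_betw (\<lambda>l. e (BQ l)) S T"
    using True full T(3,4) by (auto simp: bij_betw_def)
  \<comment> \<open>\<open>BQ (q l)\<close> is the letter that lies on the same edge as
    \<open>BP l\<close>.\<close>
  define q where "q l = inv_into S (\<lambda>l. e (BQ l)) (e (BP l))" for l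
  have q: "bij_betw q S S"
    using bij_betw_trans[OF bP bij_betw_inv_into[OF bQ]] by (simp add: q_def[abs_def] o_def)
  have eq: "e (BQ (q l)) = e (BP l)" if "l \<in> S" for l
    using that T(3) bij_betw_inv_into_right[OF bQ] by (simp add: q_def)
  have q_surj: "\<exists>l'\<in>S. l = q l'" if "l \<in> S" for l
    using that bij_betw_imp_surj_on[OF q] by blast
  have qS: "q l \<in> S" if "l \<in> S" for l using q that by (auto simp: bij_betw_def)
  \<comment> \<open>Conjugation by \<open>\<delta>\<close> turns the exchange of \<open>BP l\<close>
    and \<open>BQ l\<close> into that of \<open>BP l\<close> and \<open>BQ (q l)\<close>, which
    leaves all edges unchanged.\<close>
  define \<delta> where "\<delta> v = (case v of BQ l \<Rightarrow> if l \<in> S then BQ (q l) else v | _ \<Rightarrow> v)" for v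
  have \<delta>: "\<delta> permutes clabels S"
  proof (rule bij_imp_permutes)
    define q' where "q' = inv_into S q"
    have q': "q' (q l) = l" "q (q' l) = l" "q' l \<in> S" if "l \<in> S" for l
      using that bij_betw_inv_into_left[OF q] bij_betw_inv_into_right[OF q] bij_betwE[OF bij_betw_inv_into[OF q]]
      by (simp_all add: q'_def)
    let ?\<delta>' = "\<lambda>v. case v of BQ l \<Rightarrow> if l \<in> S then BQ (q' l) else v | _ \<Rightarrow> v"
    show "bij_betw \<delta> (clabels S) (clabels S)"
    proof (rule bij_betw_byWitness[where f' = ?\<delta>'])
      show "\<forall>v\<in>clabels S. ?\<delta>' (\<delta> v) = v"
        by (simp add: clabels_def ball_Un \<delta>_def q' qS)
      show "\<forall>v\<in>clabels S. \<delta> (?\<delta>' v) = v"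
        by (simp add: clabels_def ball_Un \<delta>_def q')
      show "\<delta> ` clabels S \<subseteq> clabels S"
        by (simp add: clabels_def image_subset_iff ball_Un \<delta>_def qS)
      show "?\<delta>' ` clabels S \<subseteq> clabels S"
        by (simp add: clabels_def image_subset_iff ball_Un q')
    qed
    show "\<delta> v = v" if "v \<notin> clabels S" for v
      using that by (cases v) (auto simp: \<delta>_def clabels_def)
  qed
  define \<kappa> where "\<kappa> = \<delta> \<circ> ?\<iota> \<circ> inv_into UNIV \<delta>"
  note \<iota>p = cswap_permutes[of S]
  have \<kappa>p: "\<kappa> permutes clabels S"
    unfolding \<kappa>_def by (intro permutes_compose permutes_inv \<delta> \<iota>p)
  have perm: "permutation \<delta>" "permutation ?\<iota>" "permutation \<kappa>" "permutation (inv_into UNIV \<delta>)"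
    using \<delta> \<iota>p \<kappa>p permutes_inv[OF \<delta>] finite_clabels[OF S] by (auto intro: permutation_permutes[THEN iffD2])
  have inv\<delta>: "inv_into UNIV \<delta> (\<delta> v) = v" for v using permutes_inverses(2)[OF \<delta>] .
  have \<kappa>\<kappa>: "\<kappa> (\<kappa> v) = v" for v
    using permutes_inverses(1)[OF \<delta>] by (simp add: \<kappa>_def inv\<delta>)
  have sgn: "sign \<kappa> * sign ?\<iota> = 1"
  proof -
    have "sign \<kappa> = sign \<delta> * sign ?\<iota> * sign (inv_into UNIV \<delta>)"
      unfolding \<kappa>_def using perm by (simp add: sign_compose permutation_compose)
    also have "sign (inv_into UNIV \<delta>) = sign \<delta>" using perm(1) by (rule sign_inverse)
    finally have "sign \<kappa> * sign ?\<iota> = (sign \<delta> * sign \<delta>) * (sign ?\<iota> * sign ?\<iota>)"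
      by (simp only: mult_ac)
    then show ?thesis by simp
  qed
  have \<kappa>BP: "\<kappa> (BP l) = BQ (q l)" "\<kappa> (BQ (q l)) = BP l" if "l \<in> S" for l
  proof -
    have "BP l = \<delta> (BP l)" "BQ (q l) = \<delta> (BQ l)" using that by (simp_all add: \<delta>_def)
    then show "\<kappa> (BP l) = BQ (q l)" "\<kappa> (BQ (q l)) = BP l"
      using that inv\<delta>[of "BP l"] inv\<delta>[of "BQ l"] by (simp_all add: \<kappa>_def) (simp_all add: cswap_def \<delta>_def)
  qed
  have \<kappa>BQ: "\<exists>l'\<in>S. \<kappa> (BQ l) = BP l'" if "l \<in> S" for l
  proof -
    obtain l' where "l' \<in> S" "l = q l'" using q_surj[OF \<open>l \<in> S\<close>] by blast
    then show ?thesis using \<kappa>BP by blast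
  qed
  have \<kappa>fix: "\<kappa> v = v" if "\<And>l. v \<noteq> BP l" "\<And>l. v \<noteq> BQ l" for v
  proof -
    have "\<delta> v = v" using that by (cases v) (auto simp: \<delta>_def)
    then have "inv_into UNIV \<delta> v = v" using inv\<delta>[of v] by simp
    moreover have "?\<iota> v = v" using that by (cases v) (auto simp: cswap_def)
    ultimately show ?thesis using \<open>\<delta> v = v\<close> by (simp add: \<kappa>_def)
  qed
  have e\<kappa>: "e (\<kappa> v) = e v" for v
  proof (cases "v \<in> clabels S")
    case False
    then show ?thesis using \<kappa>p by (simp add: permutes_not_in)
  next
    case True
    consider l where "l \<in> S" "v = BP l" | l where "l \<in> S" "v = BQ l" | "\<And>l. v \<noteq> BP l" "\<And>l. v \<noteq> BQ l"
      using True by (auto simp: clabels_def)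
    then show ?thesis
    proof cases
      case 1
      then show ?thesis using \<kappa>BP eq by simp
    next
      case 2
      then obtain l' where "l' \<in> S" "l = q l'" using q_surj by blast
      then show ?thesis using 2 \<kappa>BP eq by simp
    next
      case 3
      then show ?thesis using \<kappa>fix by simp
    qed
  qed
  \<comment> \<open>\<open>\<sigma>\<close> keeps \<open>BP\<close>-letters and
    \<open>BQ\<close>-letters apart, while \<open>\<kappa>\<close> and \<open>cswap S\<close> each
    exchange the two kinds; the composite respects classes again.\<close>
  have conj: "\<kappa> \<circ> \<sigma> \<circ> ?\<iota> \<in> ?P" if \<sigma>: "\<sigma> \<in> ?P" for \<sigma>
  proof -
    have "ccls ((\<kappa> \<circ> \<sigma> \<circ> ?\<iota>) v) = ccls v" if "v \<in> clabels S" for v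
    proof -
      consider l where "l \<in> S" "v = BP l" | l where "l \<in> S" "v = BQ l" | "\<And>l. v \<noteq> BP l" "\<And>l. v \<noteq> BQ l"
        using \<open>v \<in> clabels S\<close> by (auto simp: clabels_def)
      then show ?thesis
      proof cases
        case 1
        then obtain l' where "l' \<in> S" "\<sigma> (BQ l) = BQ l'" using class_perms_BP[OF \<sigma>] by blast
        moreover obtain l'' where "\<kappa> (BQ l') = BP l''" using \<kappa>BQ calculation(1) by blast
        ultimately show ?thesis using 1 by (simp add: cswap_def ccls_def)
      next
        case 2
        then obtain l' where "l' \<in> S" "\<sigma> (BP l) = BP l'" using class_perms_BP[OF \<sigma>] by blast
        then show ?thesis using 2 \<kappa>BP(1) by (simp add: cswap_def ccls_def)
      next
        case 3
        then have "?\<iota> v = v" by (cases v) (auto simp: cswap_def)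
        then show ?thesis using class_perms_fix[OF \<sigma> 3] \<kappa>fix[OF 3] by simp
      qed
    qed
    moreover have "\<kappa> \<circ> \<sigma> \<circ> ?\<iota> permutes clabels S"
      by (intro permutes_compose \<kappa>p \<iota>p class_perms_permutes[OF \<sigma>])
    ultimately show ?thesis by (simp add: class_perms_def)
  qed
  have bij: "bij_betw (\<lambda>\<sigma>. \<kappa> \<circ> \<sigma> \<circ> ?\<iota>) ?P ?P"
  proof (rule bij_betw_byWitness[where f' = "\<lambda>\<sigma>. \<kappa> \<circ> \<sigma> \<circ> ?\<iota>"])
    have "\<kappa> \<circ> (\<kappa> \<circ> \<sigma> \<circ> ?\<iota>) \<circ> ?\<iota> = \<sigma>" for \<sigma> by (simp add: fun_eq_iff \<kappa>\<kappa>)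
    then show "\<forall>\<sigma>\<in>?P. \<kappa> \<circ> (\<kappa> \<circ> \<sigma> \<circ> ?\<iota>) \<circ> ?\<iota> = \<sigma>" "\<forall>\<sigma>\<in>?P. \<kappa> \<circ> (\<kappa> \<circ> \<sigma> \<circ> ?\<iota>) \<circ> ?\<iota> = \<sigma>" by blast+
  qed (use conj in blast)+
  have "?L = (\<Sum>\<sigma>\<in>?P. scale (of_int (sign (\<kappa> \<circ> \<sigma> \<circ> ?\<iota>))) (if walk (e \<circ> (\<kappa> \<circ> \<sigma> \<circ> ?\<iota>)) a w b then c else 0))"
    by (rule sum.reindex_bij_betw[OF bij, symmetric])
  also have "\<dots> = ?R"
  proof (rule sum.cong[OF refl])
    fix \<sigma> assume \<sigma>: "\<sigma> \<in> ?P"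
    have "permutation \<sigma>"
      using class_perms_permutes[OF \<sigma>] finite_clabels[OF S] by (auto intro: permutation_permutes[THEN iffD2])
    then have "sign (\<kappa> \<circ> \<sigma> \<circ> ?\<iota>) = sign \<kappa> * sign \<sigma> * sign ?\<iota>"
      using perm by (simp add: sign_compose permutation_compose)
    also have "\<dots> = (sign \<kappa> * sign ?\<iota>) * sign \<sigma>" by (simp only: mult_ac)
    finally have "sign (\<kappa> \<circ> \<sigma> \<circ> ?\<iota>) = sign \<sigma>" using sgn by simp
    moreover have "e \<circ> (\<kappa> \<circ> \<sigma> \<circ> ?\<iota>) = e \<circ> (\<sigma> \<circ> ?\<iota>)" by (simp add: fun_eq_iff e\<kappa>)
    ultimately show "scale (of_int (sign (\<kappa> \<circ> \<sigma> \<circ> ?\<iota>))) (if walk (e \<circ> (\<kappa> \<circ> \<sigma> \<circ> ?\<iota>)) a w b then c else 0) =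
      scale (of_int (sign \<sigma>)) (if walk (e \<circ> (\<sigma> \<circ> ?\<iota>)) a w b then c else 0)" by simp
  qed
  finally show ?thesis .
qed

lemma cword_Nil [simp]: "cword [] = []"
  and cword_Cons [simp]: "cword (l # Ls) = [BU l, BP l, BV l, BW l, BQ l, BT l] @ cword Ls"
  and cword_append: "cword (Ls @ Ls') = cword Ls @ cword Ls'"
  by (simp_all add: cword_def)

text \<open>With \<open>y'\<close> inverse to \<open>y\<close>, a label other than \<open>l0\<close>
  contributes \<open>x * y' * y\<close> before and \<open>y * y' * x\<close> after the exchange,
  both equal to \<open>x\<close>. Only at \<open>l0\<close> does \<open>x * y\<close> become
  \<open>y * x\<close>, so the commutation factor appears to the first power and not to the power of
  the number of labels.\<close>

definition cval :: "'b \<Rightarrow> 'b \<Rightarrow> 'b \<Rightarrow> 'a \<Rightarrow> 'a clab \<Rightarrow> 'b::one" where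
  "cval x y y' l0 v = (case v of BP l \<Rightarrow> x | BQ l \<Rightarrow> y | BV l \<Rightarrow> if l = l0 then 1 else y' | _ \<Rightarrow> 1)"

lemma cval_simps [simp]:
  "cval x y y' l0 (BU l) = 1" "cval x y y' l0 (BP l) = x" "cval x y y' l0 (BV l) = (if l = l0 then 1 else y')"
  "cval x y y' l0 (BW l) = 1" "cval x y y' l0 (BQ l) = y" "cval x y y' l0 (BT l) = 1"
  by (simp_all add: cval_def)

lemma cswap_simps [simp]:
  "cswap S (BU l) = BU l" "l \<in> S \<Longrightarrow> cswap S (BP l) = BQ l" "cswap S (BV l) = BV l"
  "cswap S (BW l) = BW l" "l \<in> S \<Longrightarrow> cswap S (BQ l) = BP l" "cswap S (BT l) = BT l"
  by (simp_all add: cswap_def)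

lemma (in unital_algebra) cval_swap:
  fixes x y y' :: 'b
  assumes "y * y' = 1" "y' * y = 1" "x * y = scale \<mu> (y * x)" "distinct Ls" "set Ls \<subseteq> S"
  shows "prod_list (map (cval x y y' l0) (cword Ls)) =
    scale (if l0 \<in> set Ls then \<mu> else 1) (prod_list (map (cval x y y' l0 \<circ> cswap S) (cword Ls)))"
  using assms(4,5) unfolding comp_def
proof (induction Ls)
  case (Cons l Ls)
  let ?R = "prod_list (map (\<lambda>v. cval x y y' l0 (cswap S v)) (cword Ls))"
  have IH: "prod_list (map (cval x y y' l0) (cword Ls)) = scale (if l0 \<in> set Ls then \<mu> else 1) ?R"
    by (rule Cons.IH) (use Cons.prems in auto)
  show ?case
  proof (cases "l = l0")
    case True
    have "x * (y * ?R) = scale \<mu> (y * (x * ?R))"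
      using assms(3) by (metis mult.assoc scale_mult_left)
    with True IH Cons.prems show ?thesis by simp
  next
    case False
    have "x * (y' * (y * z)) = y * (y' * (x * z))" for z
      using assms(1,2) by (metis mult.assoc mult_1)
    with False IH Cons.prems show ?thesis
      by (simp flip: scale_mult_right)
  qed
qed simp

context gda
begin

definition cdeg :: "'g \<Rightarrow> 'g \<Rightarrow> 'a \<Rightarrow> 'a clab \<Rightarrow> 'g" where
  "cdeg t r l0 v = (case v of BP l \<Rightarrow> t | BQ l \<Rightarrow> r | BV l \<Rightarrow> if l = l0 then \<one> else inv r | _ \<Rightarrow> \<one>)"

lemma cval_D:
  assumes "x \<in> D t" "y \<in> D r" "y' \<in> D (inv r)" "x \<noteq> 0" "y \<noteq> 0" "y * y' = 1"
  shows "cval x y y' l0 v \<in> D (cdeg t r l0 v)" "cval x y y' l0 v \<noteq> 0"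
proof -
  have "y' \<noteq> 0" using assms(6) by auto
  then show "cval x y y' l0 v \<in> D (cdeg t r l0 v)" "cval x y y' l0 v \<noteq> 0"
    using assms one_D by (cases v; simp add: cval_def cdeg_def)+
qed

lemma cdeg_H: "t \<in> H \<Longrightarrow> r \<in> H \<Longrightarrow> cdeg t r l0 v \<in> H"
  using H_subgroup by (cases v) (auto simp: cdeg_def intro: subgroup.one_closed subgroup.m_inv_closed)

lemma prod_list_homogeneous:
  assumes "\<And>v. v \<in> set w \<Longrightarrow> d v \<in> carrier G \<and> b v \<in> D (d v)"
  shows "\<exists>h\<in>carrier G. prod_list (map b w) \<in> D h"
  using assms
proof (induction w)
  case Nil
  show ?case using one_D by auto
next
  case (Cons a w)
  then obtain h where "h \<in> carrier G" "prod_list (map b w) \<in> D h" by auto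
  then have "d a \<otimes> h \<in> carrier G" "prod_list (map b (a # w)) \<in> D (d a \<otimes> h)"
    using Cons.prems[of a] D_mult[of "d a" h] by auto
  then show ?case by blast
qed

lemma power_nonzero: "h \<in> carrier G \<Longrightarrow> c \<in> D h \<Longrightarrow> c \<noteq> 0 \<Longrightarrow> c ^ N \<noteq> 0"
  by (induction N) (auto simp: D_mult_nonzero)

end

lemma (in unital_algebra) ev_fpow_Suc_index:
  assumes "\<And>w v. w \<in> Poly_Mapping.keys f \<Longrightarrow> v \<in> set w \<Longrightarrow> \<phi> v \<in> carrier_mat n n" "i < n" "j < n"
  shows "ev scale n \<phi> (fpow f (Suc N)) $$ (i, j) =
    (\<Sum>k<n. ev scale n \<phi> f $$ (i, k) * ev scale n \<phi> (fpow f N) $$ (k, j))"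
proof -
  have "\<phi> v \<in> carrier_mat n n" if "w \<in> Poly_Mapping.keys f \<union> Poly_Mapping.keys (fpow f N)" "v \<in> set w" for w v
    using that assms(1) keys_fpow[of w f N "{v. \<phi> v \<in> carrier_mat n n}"] by blast
  then have "ev scale n \<phi> (fpow f (Suc N)) = ev scale n \<phi> f * ev scale n \<phi> (fpow f N)"
    unfolding fpow.simps by (rule ev_fmul)
  then show ?thesis using mult_mat_index[OF ev_carrier ev_carrier assms(2,3)] by simp
qed

text \<open>Row \<open>p\<close> of the value vanishes off the diagonal, so only the path that
  remains at \<open>p\<close> contributes.\<close>

lemma (in unital_algebra) ev_fpow_diagonal:
  assumes "\<And>w v. w \<in> Poly_Mapping.keys f \<Longrightarrow> v \<in> set w \<Longrightarrow> \<phi> v \<in> carrier_mat n n" "p < n"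
    and "\<And>k. k < n \<Longrightarrow> k \<noteq> p \<Longrightarrow> ev scale n \<phi> f $$ (p, k) = 0"
  shows "ev scale n \<phi> (fpow f N) $$ (p, p) = ev scale n \<phi> f $$ (p, p) ^ N"
proof (induction N)
  case 0
  then show ?case using assms(2) by (simp add: ev_single_index)
next
  case (Suc N)
  have "ev scale n \<phi> (fpow f (Suc N)) $$ (p, p) =
      (\<Sum>k<n. ev scale n \<phi> f $$ (p, k) * ev scale n \<phi> (fpow f N) $$ (k, p))"
    by (rule ev_fpow_Suc_index) (use assms in auto)
  also have "\<dots> = (\<Sum>k<n. if k = p then ev scale n \<phi> f $$ (p, p) * ev scale n \<phi> (fpow f N) $$ (p, p) else 0)"
    using assms(3) by (intro sum.cong) auto
  finally show ?case using assms(2) Suc by simp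
qed

text \<open>Each factor raises the block by at least one, and there are only \<open>m\<close>
  blocks.\<close>

lemma (in utg) ev_fpow_zero:
  assumes "\<And>w v. w \<in> Poly_Mapping.keys f \<Longrightarrow> v \<in> set w \<Longrightarrow> \<phi> v \<in> carrier_mat n n"
    and "\<And>i j. i < n \<Longrightarrow> j < n \<Longrightarrow> blk j \<le> blk i \<Longrightarrow> ev s n \<phi> f $$ (i, j) = 0"
  shows "ev s n \<phi> (fpow f m) = 0\<^sub>m n n"
proof -
  have *: "ev s n \<phi> (fpow f N) $$ (i, j) = 0" if "i < n" "j < n" "blk j < blk i + N" for i j N
    using that
  proof (induction N arbitrary: i)
    case 0
    then show ?case by (auto simp: ev_single_index)
  next
    case (Suc N)
    have "ev s n \<phi> f $$ (i, k) * ev s n \<phi> (fpow f N) $$ (k, j) = 0" if "k < n" for k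
    proof (cases "blk k \<le> blk i")
      case True
      then show ?thesis using assms(2) Suc.prems that by simp
    next
      case False
      then have "ev s n \<phi> (fpow f N) $$ (k, j) = 0" using Suc.prems that by (intro Suc.IH) auto
      then show ?thesis by simp
    qed
    then show ?case using ev_fpow_Suc_index[of f \<phi> n i j N, OF assms(1) Suc.prems(1,2)] by simp
  qed
  show ?thesis
  proof (rule eq_matI)
    fix i j assume "i < dim_row (0\<^sub>m n n :: 'b mat)" "j < dim_col (0\<^sub>m n n :: 'b mat)"
    then show "ev s n \<phi> (fpow f m) $$ (i, j) = 0\<^sub>m n n $$ (i, j)"
      using *[of i j m] blk_less[of j] by simp
  qed (simp_all add: ev_def)
qed

context two
begin

text \<open>The two words of the test polynomial differ by exchanging the \<open>BP\<close>- and the \<open>BQ\<close>-letters.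
  The degrees of the \<open>BV\<close>-letters are chosen such that, inside one cell, the exchange costs the
  commutation factor of \<open>t\<close> and \<open>r\<close> exactly once.\<close>

lemma commutation_transfer:
  assumes HH: "H' = H"
    and normA: "\<And>i j. i < n \<Longrightarrow> j < n \<Longrightarrow> blk i = blk j \<Longrightarrow> inv (g i) \<otimes> g j \<in> H \<Longrightarrow> g i = g j"
    and normB: "\<And>i j. i < n' \<Longrightarrow> j < n' \<Longrightarrow> blk' i = blk' j \<Longrightarrow> inv (g' i) \<otimes> g' j \<in> H \<Longrightarrow> g' i = g' j"
    and p: "p < n"
    and max: "\<And>b u. u \<in> carrier G \<Longrightarrow> card (B.cell b u) \<le> card (A.cell (blk p) (g p))"
    and t: "t \<in> H" and r: "r \<in> H"
    and comm: "\<And>x y. x \<in> D' t \<Longrightarrow> y \<in> D' r \<Longrightarrow> x * y = s' \<beta> (y * x)"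
    and x: "x \<in> D t" and y: "y \<in> D r"
  shows "x * y = s \<beta> (y * x)"
proof (rule ccontr)
  assume neq: "x * y \<noteq> s \<beta> (y * x)"
  have tc: "t \<in> carrier G" "r \<in> carrier G" using t r A.H_carrier by auto
  have xy0: "x \<noteq> 0" "y \<noteq> 0" using neq by auto
  obtain y' where y': "y' \<in> D (inv r)" "y * y' = 1" "y' * y = 1" using A.D_inverse[OF tc(2) y xy0(2)] by blast
  have "x * y \<in> D (t \<otimes> r)" "y * x \<in> D (t \<otimes> r)" "y * x \<noteq> 0"
    using A.D_mult[OF tc x y] A.D_mult[OF tc(2,1) y x] A.D_mult_nonzero[OF tc(2) y xy0(2,1)] tc
    by (auto simp: A.m_comm)
  then obtain \<mu> where \<mu>: "x * y = s \<mu> (y * x)" using A.D_one_dim[of "t \<otimes> r" "y * x" "x * y"] tc by auto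
  have \<mu>\<beta>: "\<mu> \<noteq> \<beta>" using neq \<mu> by auto

  \<comment> \<open>The test polynomial on a largest cell\<close>
  let ?C = "A.cell (blk p) (g p)"
  define S where "S = ?C \<times> ?C"
  define l0 where "l0 = (p, p)"
  have finS: "finite S" by (simp add: S_def)
  obtain Ls where Ls: "set Ls = S" "distinct Ls" using finite_distinct_list[OF finS] by blast
  have l0: "l0 \<in> S" using A.cell_self[OF p] by (simp add: S_def l0_def)
  define W where "W = cword Ls"
  have setW: "set W = clabels S" by (simp add: W_def set_cword Ls)
  have dW: "distinct W" by (simp add: W_def distinct_cword Ls)
  let ?\<iota> = "cswap S" and ?P = "class_perms ccls (clabels S)"
  let ?deg = "A.cdeg t r l0"
  have degH: "?deg v \<in> H" for v using A.cdeg_H[OF t r] .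
  have degc: "?deg v \<in> carrier G" for v using degH A.H_carrier by blast
  obtain idx :: "(nat \<times> nat) clab \<Rightarrow> nat" where idx: "inj_on idx (clabels S)"
    using finite_imp_inj_to_nat_seg[OF finite_clabels[OF finS]] by blast
  define var where "var v = (idx v, ?deg v)" for v
  define iv where "iv = inv_into (clabels S) var"
  have var: "inj_on var (clabels S)" using idx by (auto simp: inj_on_def var_def)
  then have iv: "iv (var v) = v" if "v \<in> clabels S" for v using that by (simp add: iv_def)
  define V where "V = var ` clabels S"
  have V: "V \<subseteq> UNIV \<times> carrier G" "finite V" using degc finite_clabels[OF finS] by (auto simp: V_def var_def)
  have swapP: "\<sigma> \<circ> ?\<iota> permutes clabels S" if "\<sigma> \<in> ?P" for \<sigma>
    by (rule permutes_compose[OF cswap_permutes class_perms_permutes[OF that]])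
  \<comment> \<open>Exchanging the two families costs a factor on the product of the values; the
    weight \<open>- \<beta>\<close> compensates it exactly if this factor is
    \<open>\<beta>\<close>.\<close>
  define f :: "('k, nat \<times> 'g) free_poly" where
    "f = (\<Sum>\<sigma>\<in>?P. Poly_Mapping.single (map (var \<circ> \<sigma>) W) (of_int (sign \<sigma>)) +
       Poly_Mapping.single (map (var \<circ> (\<sigma> \<circ> ?\<iota>)) W) (- \<beta> * of_int (sign \<sigma>)))"
  have word: "distinct (map (var \<circ> \<tau>) W) \<and> set (map (var \<circ> \<tau>) W) = V" if \<tau>: "\<tau> permutes clabels S" for \<tau>
  proof -
    have "\<tau> ` clabels S = clabels S" "inj_on \<tau> (clabels S)" using \<tau>
      by (auto simp: permutes_image intro: permutes_inj_on)
    then have "inj_on (var \<circ> \<tau>) (clabels S)" "(var \<circ> \<tau>) ` clabels S = V"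
      using var by (simp_all only: V_def image_comp[symmetric]) (intro comp_inj_on; simp)
    then show ?thesis using dW setW by (simp add: distinct_map)
  qed
  have keys: "distinct u \<and> set u = V" if u: "u \<in> Poly_Mapping.keys f" for u
  proof -
    obtain \<sigma> where \<sigma>: "\<sigma> \<in> ?P" "u \<in> Poly_Mapping.keys (Poly_Mapping.single (map (var \<circ> \<sigma>) W) (of_int (sign \<sigma>) :: 'k) +
       Poly_Mapping.single (map (var \<circ> (\<sigma> \<circ> ?\<iota>)) W) (- \<beta> * of_int (sign \<sigma>)))"
      using subsetD[OF keys_sum_subset u[unfolded f_def]] by (elim UN_E)
    then have "u = map (var \<circ> \<sigma>) W \<or> u = map (var \<circ> (\<sigma> \<circ> ?\<iota>)) W"
      using subsetD[OF Poly_Mapping.keys_add \<sigma>(2)] by (auto split: if_splits)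
    then show ?thesis using word[OF class_perms_permutes[OF \<sigma>(1)]] word[OF swapP[OF \<sigma>(1)]] by blast
  qed
  have keysG: "set w \<subseteq> UNIV \<times> carrier G" if "w \<in> Poly_Mapping.keys (fpow f N)" for w N
    by (rule keys_fpow[OF that]) (use keys V in auto)

  \<comment> \<open>Its value on the first algebra\<close>
  define e where "e v = (case v of BU l \<Rightarrow> (p, fst l) | BW l \<Rightarrow> (p, fst l) | BP l \<Rightarrow> l | BQ l \<Rightarrow> l
    | BV l \<Rightarrow> (snd l, p) | BT l \<Rightarrow> (snd l, p))" for v :: "(nat \<times> nat) clab"
  let ?c = "cval x y y' l0"
  have cD: "?c v \<in> D (?deg v)" "?c v \<noteq> 0" for v
    by (rule A.cval_D[OF x y y'(1) xy0 y'(2)])+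
  have eC: "fst (e v) \<in> ?C" "snd (e v) \<in> ?C" if "v \<in> clabels S" for v
    using that A.cell_self[OF p] by (auto simp: clabels_def S_def e_def)
  have C: "i < n" "blk i = blk p" "g i = g p" if "i \<in> ?C" for i
    using that normA[OF _ p] by (auto simp: A.cell_def)
  define \<phi> where "\<phi> u = (if u \<in> V then munit n (e (iv u)) (?c (iv u)) else 0\<^sub>m n n)" for u
  have \<phi>: "\<phi> (i, d) \<in> A.comp d" if d: "d \<in> carrier G" for i d
  proof (cases "(i, d) \<in> V")
    case True
    then obtain v where v: "v \<in> clabels S" "(i, d) = var v" by (auto simp: V_def)
    note Cv = C[OF eC(1)[OF v(1)]] C[OF eC(2)[OF v(1)]]
    \<comment> \<open>In the normal form \<open>g\<close> is constant on the cell, so the entry has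
      the degree of the letter itself.\<close>
    have "inv (g (fst (e v))) \<otimes> ?deg v \<otimes> g (snd (e v)) = ?deg v"
      using Cv p degc[of v] by (simp add: A.ab_simps)
    then have "munit n (e v) (?c v) \<in> A.comp (?deg v)"
      using Cv cD(1)[of v] degc by (intro A.munit_comp) auto
    then show ?thesis using v True iv[OF v(1)] by (simp add: \<phi>_def) (simp add: var_def)
  qed (simp add: \<phi>_def A.zero_comp d)
  have \<phi>c: "\<phi> u \<in> carrier_mat n n" for u by (simp add: \<phi>_def)
  have wvalA: "wval n \<phi> (map (var \<circ> \<tau>) W) $$ (a, b) =
      (if walk (e \<circ> \<tau>) a W b then prod_list (map (?c \<circ> \<tau>) W) else 0)"
    if "\<tau> permutes clabels S" "a < n" "b < n" for \<tau> a b
  proof -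
    have m: "\<tau> v \<in> clabels S" if "v \<in> set W" for v
      using that \<open>\<tau> permutes clabels S\<close> setW by (simp add: permutes_in_image)
    show ?thesis unfolding wval_map
    proof (rule wval_munit)
      fix v assume v: "v \<in> set W"
      have "\<phi> (var (\<tau> v)) = munit n (e (\<tau> v)) (?c (\<tau> v))"
        using m[OF v] iv[OF m[OF v]] by (simp add: \<phi>_def V_def)
      then show "(\<phi> \<circ> (var \<circ> \<tau>)) v = munit n ((e \<circ> \<tau>) v) ((?c \<circ> \<tau>) v) \<and> snd ((e \<circ> \<tau>) v) < n"
        using C(1)[OF eC(2)[OF m[OF v]]] by simp
    qed (use that in simp_all)
  qed
  have e\<iota>: "e \<circ> ?\<iota> = e" by (rule ext, rename_tac v, case_tac v) (auto simp: e_def cswap_def)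
  \<comment> \<open>The letters other than \<open>BP\<close> and \<open>BQ\<close> are alone in
    their classes and fix both ends of each remaining edge. The last letter leads back to
    \<open>p\<close>, so row \<open>p\<close> of the value has nothing but its diagonal
    entry.\<close>
  have rigid: "\<sigma> = id \<and> b = p"
    if \<sigma>: "\<sigma> \<in> ?P" and wk: "walk (e \<circ> (\<sigma> \<circ> \<tau>)) a W b" and \<tau>: "\<tau> = id \<or> \<tau> = ?\<iota>" for \<sigma> \<tau> a b
  proof -
    have fixU: "(\<sigma> \<circ> \<tau>) (BU l) = BU l" "(\<sigma> \<circ> \<tau>) (BV l) = BV l" "(\<sigma> \<circ> \<tau>) (BW l) = BW l" "(\<sigma> \<circ> \<tau>) (BT l) = BT l" for l
      using \<tau> class_perms_fix[OF \<sigma>] by (auto simp: cswap_def)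
    have el: "e ((\<sigma> \<circ> \<tau>) (BP l)) = l" "e ((\<sigma> \<circ> \<tau>) (BQ l)) = l" if l: "l \<in> S" for l
    proof -
      obtain Ls1 Ls2 where "Ls = Ls1 @ l # Ls2" using l Ls(1) by (meson split_list)
      then obtain r1 r2 where "walk (e \<circ> (\<sigma> \<circ> \<tau>)) r1 [BU l, BP l, BV l, BW l, BQ l, BT l] r2"
        using wk by (auto simp: W_def cword_append walk_append)
      then have "snd (e ((\<sigma> \<circ> \<tau>) (BU l))) = fst (e ((\<sigma> \<circ> \<tau>) (BP l)))" "snd (e ((\<sigma> \<circ> \<tau>) (BP l))) = fst (e ((\<sigma> \<circ> \<tau>) (BV l)))"
        "snd (e ((\<sigma> \<circ> \<tau>) (BW l))) = fst (e ((\<sigma> \<circ> \<tau>) (BQ l)))" "snd (e ((\<sigma> \<circ> \<tau>) (BQ l))) = fst (e ((\<sigma> \<circ> \<tau>) (BT l)))"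
        by simp_all
      then show "e ((\<sigma> \<circ> \<tau>) (BP l)) = l" "e ((\<sigma> \<circ> \<tau>) (BQ l)) = l"
        unfolding fixU by (auto simp: e_def prod_eq_iff)
    qed
    have \<sigma>l: "e (\<sigma> (BP l)) = l" "e (\<sigma> (BQ l)) = l" if "l \<in> S" for l
      using el[OF that] \<tau> that by (auto simp: cswap_def)
    have "\<sigma> v = v" for v
    proof (cases "v \<in> clabels S")
      case False
      then show ?thesis using class_perms_permutes[OF \<sigma>] by (simp add: permutes_not_in)
    next
      case True
      consider l where "l \<in> S" "v = BP l" | l where "l \<in> S" "v = BQ l" | "\<And>l. v \<noteq> BP l" "\<And>l. v \<noteq> BQ l"
        using True by (auto simp: clabels_def)
      then show ?thesis
      proof cases
        case 1
        then show ?thesis using \<sigma>l(1)[OF 1(1)] class_perms_BP(1)[OF \<sigma> 1(1)] by (auto simp: e_def)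
      next
        case 2
        then show ?thesis using \<sigma>l(2)[OF 2(1)] class_perms_BP(2)[OF \<sigma> 2(1)] by (auto simp: e_def)
      next
        case 3
        then show ?thesis using class_perms_fix[OF \<sigma>] by blast
      qed
    qed
    moreover have "b = p"
    proof -
      have "Ls \<noteq> []" using Ls(1) l0 by auto
      then obtain Ls' l where "Ls = Ls' @ [l]" by (metis rev_exhaust)
      then have "b = snd (e ((\<sigma> \<circ> \<tau>) (BT l)))" using wk by (auto simp: W_def cword_append walk_append)
      then show ?thesis unfolding fixU by (simp add: e_def)
    qed
    ultimately show ?thesis by auto
  qed
  have evA: "ev s n \<phi> f $$ (p, k) = (if k = p then prod_list (map ?c W) - s \<beta> (prod_list (map (?c \<circ> ?\<iota>) W)) else 0)"
    if k: "k < n" for k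
  proof -
    have "ev s n \<phi> f $$ (p, k) = (\<Sum>\<sigma>\<in>?P.
        s (of_int (sign \<sigma>)) (if walk (e \<circ> \<sigma>) p W k then prod_list (map (?c \<circ> \<sigma>) W) else 0) +
        s (- \<beta> * of_int (sign \<sigma>)) (if walk (e \<circ> (\<sigma> \<circ> ?\<iota>)) p W k then prod_list (map (?c \<circ> (\<sigma> \<circ> ?\<iota>)) W) else 0))"
      unfolding f_def A.ev_sum_index[OF p k] A.ev_add_index[OF p k] A.ev_single_index[OF p k]
      by (intro sum.cong refl) (simp only: wvalA[OF class_perms_permutes p k] wvalA[OF swapP p k])
    also have "\<dots> = (\<Sum>\<sigma>\<in>?P. if \<sigma> = id then
        (if k = p then prod_list (map ?c W) - s \<beta> (prod_list (map (?c \<circ> ?\<iota>) W)) else 0) else 0)"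
    proof (rule sum.cong[OF refl])
      fix \<sigma> assume \<sigma>: "\<sigma> \<in> ?P"
      have wk: "walk e p W p" unfolding W_def cword_def
        by (rule walk_concat_closed) (auto simp: e_def)
      show "s (of_int (sign \<sigma>)) (if walk (e \<circ> \<sigma>) p W k then prod_list (map (?c \<circ> \<sigma>) W) else 0) +
        s (- \<beta> * of_int (sign \<sigma>)) (if walk (e \<circ> (\<sigma> \<circ> ?\<iota>)) p W k then prod_list (map (?c \<circ> (\<sigma> \<circ> ?\<iota>)) W) else 0) =
        (if \<sigma> = id then (if k = p then prod_list (map ?c W) - s \<beta> (prod_list (map (?c \<circ> ?\<iota>) W)) else 0) else 0)"
      proof (cases "\<sigma> = id \<and> k = p")
        case True
        then have "\<sigma> = id" "k = p" by auto
        then show ?thesis using wk by (simp add: e\<iota> sign_id)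
      next
        case False
        have "\<not> walk (e \<circ> \<sigma>) p W k" using rigid[OF \<sigma>, of id p k] False by auto
        moreover have "\<not> walk (e \<circ> (\<sigma> \<circ> ?\<iota>)) p W k" using rigid[OF \<sigma>, of ?\<iota> p k] False by auto
        ultimately show ?thesis using False by auto
      qed
    qed
    also have "\<dots> = (if k = p then prod_list (map ?c W) - s \<beta> (prod_list (map (?c \<circ> ?\<iota>) W)) else 0)"
      by (simp add: finite_class_perms finite_clabels finS id_class_perms)
    finally show ?thesis .
  qed
  let ?z = "prod_list (map (?c \<circ> ?\<iota>) W)"
  have "prod_list (map ?c W) = s \<mu> ?z"
    using A.cval_swap[OF y'(2,3) \<mu> Ls(2), of S l0] l0 Ls(1) by (simp add: W_def)
  then have pp: "ev s n \<phi> f $$ (p, p) = s (\<mu> - \<beta>) ?z"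
    using evA[OF p] by (simp add: A.scale_left_diff_distrib)
  have z0: "?z \<noteq> 0"
    by (rule A.prod_list_nonzero[where d = "?deg \<circ> ?\<iota>"]) (use cD degc in auto)
  obtain h where h: "h \<in> carrier G" "?z \<in> D h"
    using A.prod_list_homogeneous[of W "?deg \<circ> ?\<iota>" "?c \<circ> ?\<iota>"] cD degc by auto
  have "s (\<mu> - \<beta>) ?z \<in> D h" "s (\<mu> - \<beta>) ?z \<noteq> 0"
    using h A.D_scale z0 \<mu>\<beta> by auto
  \<comment> \<open>The exponent is the number of blocks of the second algebra, where the value will
    be strictly block-triangular. Here the entry is homogeneous and nonzero, hence invertible, and
    its power survives.\<close>
  then have "s (\<mu> - \<beta>) ?z ^ m' \<noteq> 0" using A.power_nonzero h(1) by blast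
  moreover have "ev s n \<phi> (fpow f m') $$ (p, p) = ev s n \<phi> f $$ (p, p) ^ m'"
    by (rule A.ev_fpow_diagonal) (use \<phi>c p evA in auto)
  ultimately have nz: "ev s n \<phi> (fpow f m') \<noteq> 0\<^sub>m n n" using p pp by auto
  obtain \<psi> where \<psi>: "\<And>i d. d \<in> carrier G \<Longrightarrow> \<psi> (i, d) \<in> B.comp d" "ev s' n' \<psi> (fpow f m') \<noteq> 0\<^sub>m n' n'"
    by (rule nonidentity_transfer[of "fpow f m'" \<phi>]) (use keysG \<phi> nz in blast)+

  \<comment> \<open>Its value on the second algebra\<close>
  have \<psi>V: "\<psi> v \<in> B.comp (snd v)" if "v \<in> V" for v using \<psi>(1)[of "snd v" "fst v"] that V by auto
  \<comment> \<open>A walk never descends, so from \<open>a\<close> to a \<open>b\<close> in a block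
    not above that of \<open>a\<close> it stays in one diagonal block; there it is confined to one
    cell, and the two words cancel.\<close>
  have radical: "ev s' n' \<psi> f $$ (a, b) = 0" if ab: "a < n'" "b < n'" "blk' b \<le> blk' a" for a b
  proof (rule ccontr)
    assume nz: "ev s' n' \<psi> f $$ (a, b) \<noteq> 0"
    obtain e0 b0 where
      eb0: "\<And>v. v \<in> V \<Longrightarrow> B.adm (snd v) (e0 v) \<and> b0 v \<noteq> 0 \<and>
         b0 v \<in> D' (inv (g' (fst (e0 v))) \<otimes> snd v \<otimes> g' (snd (e0 v)))"
      and nz0: "ev s' n' (\<lambda>v. munit n' (e0 v) (b0 v)) f $$ (a, b) \<noteq> 0"
      using B.basis_reduction[OF keys V \<psi>V ab(1,2) nz] by blast
    define e1 where "e1 v = e0 (var v)" for v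
    define b1 where "b1 v = b0 (var v)" for v
    have adm1: "B.adm (?deg v) (e1 v)" "b1 v \<noteq> 0"
      "b1 v \<in> D' (inv (g' (fst (e1 v))) \<otimes> ?deg v \<otimes> g' (snd (e1 v)))" if "v \<in> clabels S" for v
      using eb0[of "var v"] that by (auto simp: V_def e1_def b1_def) (auto simp: var_def)
    have wvalB: "wval n' (\<lambda>v. munit n' (e0 v) (b0 v)) (map (var \<circ> \<tau>) W) $$ (a, b) =
        (if walk (e1 \<circ> \<tau>) a W b then prod_list (map (b1 \<circ> \<tau>) W) else 0)"
      if "\<tau> permutes clabels S" for \<tau>
    proof -
      have "\<tau> v \<in> clabels S" if "v \<in> set W" for v
        using that \<open>\<tau> permutes clabels S\<close> setW by (simp add: permutes_in_image)
      then show ?thesis unfolding wval_map using ab(1,2) adm1(1)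
        by (intro wval_munit) (simp_all add: e1_def b1_def B.adm_def)
    qed
    have evB: "ev s' n' (\<lambda>v. munit n' (e0 v) (b0 v)) f $$ (a, b) = (\<Sum>\<sigma>\<in>?P.
        s' (of_int (sign \<sigma>)) (if walk (e1 \<circ> \<sigma>) a W b then prod_list (map (b1 \<circ> \<sigma>) W) else 0) +
        s' (- \<beta> * of_int (sign \<sigma>)) (if walk (e1 \<circ> (\<sigma> \<circ> ?\<iota>)) a W b then prod_list (map (b1 \<circ> (\<sigma> \<circ> ?\<iota>)) W) else 0))"
      unfolding f_def B.ev_sum_index[OF ab(1,2)] B.ev_add_index[OF ab(1,2)] B.ev_single_index[OF ab(1,2)]
      by (intro sum.cong refl) (simp only: wvalB[OF class_perms_permutes] wvalB[OF swapP])
    obtain \<tau> where \<tau>: "\<tau> permutes clabels S" "walk (e1 \<circ> \<tau>) a W b"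
    proof -
      have "\<exists>\<sigma>\<in>?P. walk (e1 \<circ> \<sigma>) a W b \<or> walk (e1 \<circ> (\<sigma> \<circ> ?\<iota>)) a W b"
      proof (rule ccontr)
        assume "\<not> ?thesis"
        then have "ev s' n' (\<lambda>v. munit n' (e0 v) (b0 v)) f $$ (a, b) = 0"
          unfolding evB by (intro sum.neutral) auto
        with nz0 show False by simp
      qed
      then show ?thesis using that class_perms_permutes swapP by blast
    qed
    have mono: "blk' (fst ((e1 \<circ> \<tau>) v)) \<le> blk' (snd ((e1 \<circ> \<tau>) v))" if "v \<in> set W" for v
      using adm1(1)[of "\<tau> v"] that \<tau>(1) setW by (simp add: B.adm_def permutes_in_image)
    \<comment> \<open>All letters have degrees in \<open>H\<close>, so the walk cannot leave the
      coset of its starting point.\<close>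
    let ?Q = "\<lambda>i. i < n' \<and> inv (g' a) \<otimes> g' i \<in> H"
    have "?Q b \<and> (\<forall>v\<in>set W. ?Q (fst ((e1 \<circ> \<tau>) v)) \<and> ?Q (snd ((e1 \<circ> \<tau>) v)))"
    proof (rule walk_mem_induct[OF \<tau>(2)])
      show "?Q a" using ab(1) subgroup.one_closed[OF A.H_subgroup] by simp
      fix v assume v: "v \<in> set W" "?Q (fst ((e1 \<circ> \<tau>) v))"
      let ?i = "fst (e1 (\<tau> v))" and ?j = "snd (e1 (\<tau> v))"
      have "\<tau> v \<in> clabels S" using v(1) \<tau>(1) setW by (simp add: permutes_in_image)
      from adm1(1)[OF this] have a1: "?i < n'" "?j < n'" "inv (g' ?i) \<otimes> ?deg (\<tau> v) \<otimes> g' ?j \<in> H"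
        unfolding B.adm_def by (simp_all add: HH)
      have ai: "inv (g' a) \<otimes> g' ?i \<in> H" using v(2) by simp
      have "(inv (g' a) \<otimes> g' ?i) \<otimes> ((inv (g' ?i) \<otimes> ?deg (\<tau> v) \<otimes> g' ?j) \<otimes> inv (?deg (\<tau> v))) \<in> H"
        by (rule subgroup.m_closed[OF A.H_subgroup ai
              subgroup.m_closed[OF A.H_subgroup a1(3) subgroup.m_inv_closed[OF A.H_subgroup degH]]])
      also have "(inv (g' a) \<otimes> g' ?i) \<otimes> ((inv (g' ?i) \<otimes> ?deg (\<tau> v) \<otimes> g' ?j) \<otimes> inv (?deg (\<tau> v))) =
          inv (g' a) \<otimes> g' ?j"
        using a1 ab(1) degc[of "\<tau> v"] by (simp add: A.ab_simps)
      finally show "?Q (snd ((e1 \<circ> \<tau>) v))" using a1 by simp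
    qed
    then have Q_all: "\<forall>v\<in>set W. ?Q (fst ((e1 \<circ> \<tau>) v)) \<and> ?Q (snd ((e1 \<circ> \<tau>) v))" by blast
    have Q: "?Q (fst (e1 v))" "?Q (snd (e1 v))" if "v \<in> clabels S" for v
    proof -
      have "v \<in> \<tau> ` clabels S" using that \<tau>(1) by (simp add: permutes_image)
      then obtain u where u: "u \<in> set W" "v = \<tau> u" using setW by auto
      from bspec[OF Q_all u(1)] u(2) show "?Q (fst (e1 v))" "?Q (snd (e1 v))" by simp_all
    qed
    have blk: "blk' (fst (e1 v)) = blk' a" "blk' (snd (e1 v)) = blk' a" if "v \<in> clabels S" for v
    proof -
      have "v \<in> \<tau> ` clabels S" using that \<tau>(1) by (simp add: permutes_image)
      then obtain u where u: "u \<in> set W" "v = \<tau> u" using setW by auto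
      then show "blk' (fst (e1 v)) = blk' a" "blk' (snd (e1 v)) = blk' a"
        using walk_mono_mem[where h = blk', OF \<tau>(2) mono u(1)] mono[OF u(1)] ab(3) by auto
    qed
    have ga: "g' (fst (e1 v)) = g' a" "g' (snd (e1 v)) = g' a" if "v \<in> clabels S" for v
      using normB[OF ab(1), of "fst (e1 v)"] normB[OF ab(1), of "snd (e1 v)"] Q[OF that] blk[OF that] by simp_all
    \<comment> \<open>By \<open>max\<close> the square of this cell has at most as many edges as
      there are labels, which is the size condition of \<open>swap_walks_sum\<close>.\<close>
    let ?C' = "B.cell (blk' a) (g' a)"
    have eT: "e1 v \<in> ?C' \<times> ?C'" if "v \<in> clabels S" for v
    proof -
      have "i \<in> ?C'" if "i < n'" "blk' i = blk' a" "g' i = g' a" for i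
        using that ab(1) subgroup.one_closed[OF B.H_subgroup] by (simp add: B.cell_def)
      then show ?thesis using Q[OF that] blk[OF that] ga[OF that] by (simp add: mem_Times_iff)
    qed
    have b1D: "b1 v \<in> D' (?deg v)" if "v \<in> clabels S" for v
    proof -
      have "inv (g' a) \<otimes> ?deg v \<otimes> g' a = ?deg v" using ab(1) degc[of v] by (simp add: A.ab_simps)
      then show ?thesis using adm1(3)[OF that] ga[OF that] by simp
    qed
    have tr': "t \<in> H'" "r \<in> H'" using t r HH by auto
    obtain X where X: "X \<in> D' t" "X \<noteq> 0" using B.D_nontriv[OF tr'(1)] by blast
    obtain Y where Y: "Y \<in> D' r" "Y \<noteq> 0" using B.D_nontriv[OF tr'(2)] by blast
    obtain Y' where Y': "Y' \<in> D' (inv r)" "Y * Y' = 1" "Y' * Y = 1" using B.D_inverse[OF tc(2) Y] by blast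
    let ?d = "cval X Y Y' l0"
    have dD: "?d v \<in> D' (?deg v)" "?d v \<noteq> 0" for v
      by (rule B.cval_D[OF X(1) Y(1) Y'(1) X(2) Y(2) Y'(2)])+
    \<comment> \<open>By one-dimensionality the values are multiples of model values
      \<open>?d\<close>, and the product of the scalars is common to all rearrangements.\<close>
    have "\<exists>\<xi>. \<forall>v\<in>clabels S. b1 v = s' (\<xi> v) (?d v)"
      using B.D_one_dim[OF degc dD(1) b1D dD(2)] by (intro bchoice) blast
    then obtain \<xi> where \<xi>: "\<And>v. v \<in> clabels S \<Longrightarrow> b1 v = s' (\<xi> v) (?d v)" by blast
    define \<Xi> where "\<Xi> = prod \<xi> (clabels S)"
    have prodB: "prod_list (map (b1 \<circ> \<tau>) W) = s' \<Xi> (prod_list (map (?d \<circ> \<tau>) W))"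
      if "\<tau> permutes clabels S" for \<tau>
    proof -
      have m: "\<tau> v \<in> clabels S" if "v \<in> set W" for v
        using that \<open>\<tau> permutes clabels S\<close> setW by (simp add: permutes_in_image)
      have "map (b1 \<circ> \<tau>) W = map (\<lambda>v. s' ((\<xi> \<circ> \<tau>) v) ((?d \<circ> \<tau>) v)) W"
        using \<xi> m by (intro map_cong) auto
      then have "prod_list (map (b1 \<circ> \<tau>) W) = s' (prod_list (map (\<xi> \<circ> \<tau>) W)) (prod_list (map (?d \<circ> \<tau>) W))"
        by (simp only: B.prod_list_scale)
      also have "prod_list (map (\<xi> \<circ> \<tau>) W) = prod (\<xi> \<circ> \<tau>) (set W)"
        using dW by (simp add: prod.distinct_set_conv_list o_def)
      also have "\<dots> = \<Xi>" unfolding \<Xi>_def setW by (rule prod.permute[OF that, symmetric])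
      finally show ?thesis .
    qed
    let ?B1 = "prod_list (map ?d W)" and ?B2 = "prod_list (map (?d \<circ> ?\<iota>) W)"
    have B12: "?B1 = s' \<beta> ?B2"
      using B.cval_swap[OF Y'(2,3) comm[OF X(1) Y(1)] Ls(2), of S l0] l0 Ls(1) by (simp add: W_def)
    \<comment> \<open>All \<open>BP\<close>-letters carry \<open>X\<close> and all
      \<open>BQ\<close>-letters carry \<open>Y\<close>, so a rearrangement within classes leaves the
      product of the model values unchanged.\<close>
    have d\<sigma>: "?d (\<sigma> v) = ?d v" if "\<sigma> \<in> ?P" "v \<in> clabels S" for \<sigma> v
      using ccls_eqD[OF class_perms_cls[OF that]] by (auto simp: cval_def)
    have D1: "prod_list (map (b1 \<circ> \<sigma>) W) = s' \<Xi> ?B1" and D2: "prod_list (map (b1 \<circ> (\<sigma> \<circ> ?\<iota>)) W) = s' \<Xi> ?B2"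
      if \<sigma>: "\<sigma> \<in> ?P" for \<sigma>
    proof -
      have "map (?d \<circ> \<sigma>) W = map ?d W" using d\<sigma>[OF \<sigma>] setW by (intro map_cong) auto
      then show "prod_list (map (b1 \<circ> \<sigma>) W) = s' \<Xi> ?B1" using prodB[OF class_perms_permutes[OF \<sigma>]] by (simp only:)
      have "map (?d \<circ> (\<sigma> \<circ> ?\<iota>)) W = map (?d \<circ> ?\<iota>) W"
        using d\<sigma>[OF \<sigma>] setW cswap_permutes[of S] by (intro map_cong) (auto simp: permutes_in_image)
      then show "prod_list (map (b1 \<circ> (\<sigma> \<circ> ?\<iota>)) W) = s' \<Xi> ?B2" using prodB[OF swapP[OF \<sigma>]] by (simp only:)
    qed
    let ?k = "s' \<Xi> ?B1"
    have "(\<Sum>\<sigma>\<in>?P. s' (of_int (sign \<sigma>)) (if walk (e1 \<circ> \<sigma>) a W b then ?k else 0)) =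
        (\<Sum>\<sigma>\<in>?P. s' (of_int (sign \<sigma>)) (if walk (e1 \<circ> (\<sigma> \<circ> ?\<iota>)) a W b then ?k else 0))"
    proof (rule B.swap_walks_sum[OF _ finS setW, of "?C' \<times> ?C'"])
      have "card ?C' \<le> card ?C" using max ab(1) by simp
      then show "card (?C' \<times> ?C') \<le> card S" by (simp add: S_def card_cartesian_product mult_mono)
    qed (use eT in \<open>auto simp: clabels_def\<close>)
    moreover have "ev s' n' (\<lambda>v. munit n' (e0 v) (b0 v)) f $$ (a, b) =
        (\<Sum>\<sigma>\<in>?P. s' (of_int (sign \<sigma>)) (if walk (e1 \<circ> \<sigma>) a W b then ?k else 0)) -
        (\<Sum>\<sigma>\<in>?P. s' (of_int (sign \<sigma>)) (if walk (e1 \<circ> (\<sigma> \<circ> ?\<iota>)) a W b then ?k else 0))"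
      unfolding evB sum_subtractf[symmetric]
    proof (rule sum.cong[OF refl])
      fix \<sigma> assume \<sigma>: "\<sigma> \<in> ?P"
      \<comment> \<open>As \<open>?B1\<close> is \<open>\<beta>\<close> times \<open>?B2\<close>,
        the two words have opposite coefficients, and only their sets of walks remain to be
        compared.\<close>
      have "s' (- \<beta> * of_int (sign \<sigma>)) (s' \<Xi> ?B2) = - s' (of_int (sign \<sigma>)) ?k"
        unfolding B12 by (simp add: mult_ac)
      then show "s' (of_int (sign \<sigma>)) (if walk (e1 \<circ> \<sigma>) a W b then prod_list (map (b1 \<circ> \<sigma>) W) else 0) +
        s' (- \<beta> * of_int (sign \<sigma>)) (if walk (e1 \<circ> (\<sigma> \<circ> ?\<iota>)) a W b then prod_list (map (b1 \<circ> (\<sigma> \<circ> ?\<iota>)) W) else 0) =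
        s' (of_int (sign \<sigma>)) (if walk (e1 \<circ> \<sigma>) a W b then ?k else 0) -
        s' (of_int (sign \<sigma>)) (if walk (e1 \<circ> (\<sigma> \<circ> ?\<iota>)) a W b then ?k else 0)"
        unfolding D1[OF \<sigma>] D2[OF \<sigma>] by (cases "walk (e1 \<circ> \<sigma>) a W b"; cases "walk (e1 \<circ> (\<sigma> \<circ> ?\<iota>)) a W b")
          (simp_all only: if_True if_False B.scale_zero_right diff_conv_add_uminus add_0 add_0_right minus_zero)
    qed
    ultimately show False using nz0 by simp
  qed
  have "ev s' n' \<psi> (fpow f m') = 0\<^sub>m n' n'"
  proof (rule B.ev_fpow_zero)
    show "\<psi> v \<in> carrier_mat n' n'" if "w \<in> Poly_Mapping.keys f" "v \<in> set w" for w v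
      using \<psi>V[of v] keys[OF that(1)] that(2) B.comp_carrier by auto
  qed (rule radical)
  with \<psi>(2) show False by simp
qed

end

section \<open>Twisted group algebras with equal commutation factors\<close>

text \<open>A divisible subgroup is a direct factor. Zorn's lemma gives a subgroup \<open>L\<close>
  maximal among those that meet \<open>T\<close> trivially; an element outside the product of
  \<open>L\<close> and \<open>T\<close> would allow an enlargement, if need be after a correction by
  a root in \<open>T\<close>.\<close>

lemma (in comm_group) divisible_complement:
  assumes T: "subgroup T G" and div: "\<And>t n. t \<in> T \<Longrightarrow> 0 < n \<Longrightarrow> \<exists>u\<in>T. u [^] (n::nat) = t"
  shows "\<exists>L. subgroup L G \<and> L \<inter> T = {\<one>} \<and> (\<forall>a\<in>carrier G. \<exists>l\<in>L. \<exists>t\<in>T. a = l \<otimes> t)"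
proof -
  note Tc = subgroup.mem_carrier[OF T]
  define \<A> where "\<A> = {L. subgroup L G \<and> L \<inter> T = {\<one>}}"
  have "\<exists>M\<in>\<A>. \<forall>X\<in>\<A>. M \<subseteq> X \<longrightarrow> X = M"
  proof (rule subset_Zorn_nonempty)
    have "{\<one>} \<in> \<A>" using triv_subgroup subgroup.one_closed[OF T] by (auto simp: \<A>_def)
    then show "\<A> \<noteq> {}" by blast
    fix \<C> assume \<C>: "\<C> \<noteq> {}" "subset.chain \<A> \<C>"
    have sub: "subgroup L G" "L \<inter> T = {\<one>}" if "L \<in> \<C>" for L
      using \<C>(2) that by (auto simp: subset.chain_def \<A>_def)
    note sub_facts = subgroup.mem_carrier[OF sub(1)] subgroup.one_closed[OF sub(1)]
      subgroup.m_inv_closed[OF sub(1)] subgroup.m_closed[OF sub(1)]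
    have "subgroup (\<Union>\<C>) G"
    proof (rule subgroupI)
      show "\<Union>\<C> \<subseteq> carrier G" using sub_facts(1) by blast
      show "\<Union>\<C> \<noteq> {}" using \<C>(1) sub_facts(2) by blast
      show "inv a \<in> \<Union>\<C>" if "a \<in> \<Union>\<C>" for a
        using that sub_facts(3) by blast
      show "a \<otimes> b \<in> \<Union>\<C>" if ab: "a \<in> \<Union>\<C>" "b \<in> \<Union>\<C>" for a b
      proof -
        obtain X Y where XY: "X \<in> \<C>" "Y \<in> \<C>" "a \<in> X" "b \<in> Y" using ab by blast
        then have "X \<subseteq> Y \<or> Y \<subseteq> X" using \<C>(2) by (auto simp: subset.chain_def)
        then obtain Z where "Z \<in> \<C>" "a \<in> Z" "b \<in> Z" using XY by blast
        then show ?thesis using sub_facts(4) by blast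
      qed
    qed
    moreover have "\<Union>\<C> \<inter> T = {\<one>}" using sub(2) \<C>(1) by blast
    ultimately show "\<Union>\<C> \<in> \<A>" by (simp add: \<A>_def)
  qed
  then obtain L where "L \<in> \<A>" and max_\<A>: "\<forall>X\<in>\<A>. L \<subseteq> X \<longrightarrow> X = L" by (elim bexE)
  then have L: "subgroup L G" "L \<inter> T = {\<one>}" by (simp_all add: \<A>_def)
  have max: "X = L" if "subgroup X G" "X \<inter> T = {\<one>}" "L \<subseteq> X" for X
    using max_\<A> that by (simp add: \<A>_def)
  note Lc = subgroup.mem_carrier[OF L(1)]
  \<comment> \<open>Maximality of \<open>L\<close>: an element that creates no new intersection with
    \<open>T\<close> when adjoined already lies in \<open>L\<close>.\<close>
  have extend: "a \<in> L" if a: "a \<in> carrier G"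
    and *: "\<And>l k. l \<in> L \<Longrightarrow> l \<otimes> a [^] (k::int) \<in> T \<Longrightarrow> l \<otimes> a [^] k = \<one>" for a
  proof -
    define X where "X = {l \<otimes> a [^] k | l k. l \<in> L \<and> (k::int) \<in> UNIV}"
    have inX: "l \<otimes> a [^] k \<in> X" if "l \<in> L" for l and k :: int using that by (auto simp: X_def)
    have LX: "L \<subseteq> X"
    proof
      fix l assume l: "l \<in> L"
      have "l \<otimes> a [^] (0::int) = l" using Lc[OF l] by simp
      then show "l \<in> X" using inX[OF l, of 0] by simp
    qed
    have "subgroup X G"
    proof (rule subgroupI)
      show "X \<subseteq> carrier G" using Lc a by (auto simp: X_def)
      show "X \<noteq> {}" using LX subgroup.one_closed[OF L(1)] by blast
      fix x assume "x \<in> X"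
      then obtain l k where x: "x = l \<otimes> a [^] (k::int)" "l \<in> L" by (auto simp: X_def)
      have "inv x = inv l \<otimes> a [^] (- k)" using x Lc a by (simp add: int_pow_neg inv_mult)
      then show "inv x \<in> X" using inX[OF subgroup.m_inv_closed[OF L(1) x(2)], of "- k"] by simp
      fix y assume "y \<in> X"
      then obtain l' k' where y: "y = l' \<otimes> a [^] (k'::int)" "l' \<in> L" by (auto simp: X_def)
      have "x \<otimes> y = (l \<otimes> l') \<otimes> a [^] (k + k')"
        using x y Lc a by (simp add: int_pow_mult m_ac)
      then show "x \<otimes> y \<in> X" using inX[OF subgroup.m_closed[OF L(1) x(2) y(2)], of "k + k'"] by simp
    qed
    moreover have "X \<inter> T = {\<one>}"
      using * LX subgroup.one_closed[OF L(1)] subgroup.one_closed[OF T] by (auto simp: X_def)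
    ultimately have "X = L" using max LX by blast
    moreover have "a = \<one> \<otimes> a [^] (1::int)" using a by simp
    ultimately show "a \<in> L" using inX[OF subgroup.one_closed[OF L(1)], of 1] a by simp
  qed
  define P where "P = {l \<otimes> t | l t. l \<in> L \<and> t \<in> T}"
  have P: "subgroup P G"
  proof (rule subgroupI)
    show "P \<subseteq> carrier G" using Lc Tc by (auto simp: P_def)
    have "\<one> \<otimes> \<one> \<in> P" unfolding P_def using subgroup.one_closed[OF L(1)] subgroup.one_closed[OF T] by blast
    then show "P \<noteq> {}" by blast
    fix x assume "x \<in> P"
    then obtain l t where x: "x = l \<otimes> t" "l \<in> L" "t \<in> T" by (auto simp: P_def)
    have "inv x = inv l \<otimes> inv t" using x Lc Tc by (simp add: inv_mult)
    then show "inv x \<in> P" using x subgroup.m_inv_closed[OF L(1)] subgroup.m_inv_closed[OF T]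
      by (auto simp: P_def)
    fix y assume "y \<in> P"
    then obtain l' t' where y: "y = l' \<otimes> t'" "l' \<in> L" "t' \<in> T" by (auto simp: P_def)
    have "x \<otimes> y = (l \<otimes> l') \<otimes> (t \<otimes> t')" using x y Lc Tc by (simp add: m_ac)
    then show "x \<otimes> y \<in> P" using x y subgroup.m_closed[OF L(1)] subgroup.m_closed[OF T]
      unfolding P_def by blast
  qed
  have LP: "l \<in> P" if "l \<in> L" for l
  proof -
    have "l = l \<otimes> \<one>" using Lc[OF that] by simp
    then show ?thesis unfolding P_def using that subgroup.one_closed[OF T] by blast
  qed
  have TP: "t \<in> P" if "t \<in> T" for t
  proof -
    have "t = \<one> \<otimes> t" using Tc[OF that] by simp
    then show ?thesis unfolding P_def using that subgroup.one_closed[OF L(1)] by blast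
  qed
  have PT: "\<exists>t\<in>T. a [^] k \<otimes> t \<in> L" if "a [^] k \<in> P" "a \<in> carrier G" for a and k :: int
  proof -
    obtain l t where lt: "a [^] k = l \<otimes> t" "l \<in> L" "t \<in> T" using \<open>a [^] k \<in> P\<close> by (auto simp: P_def)
    then have "a [^] k \<otimes> inv t = l" using Lc Tc by (simp add: m_assoc)
    then show ?thesis using lt subgroup.m_inv_closed[OF T] by blast
  qed
  have LT1: "x = \<one>" if "x \<in> L" "x \<in> T" for x using L(2) that by blast
  have lP: "a [^] k \<in> P" if "l \<in> L" "l \<otimes> a [^] k \<in> T" "a \<in> carrier G" for l a and k :: int
  proof -
    have "inv l \<otimes> (l \<otimes> a [^] k) \<in> P"
      using that by (intro subgroup.m_closed[OF P] subgroup.m_inv_closed[OF P] LP TP)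
    then show ?thesis using that Lc by (simp flip: m_assoc)
  qed
  have "a \<in> P" if a: "a \<in> carrier G" for a
  proof (cases "\<exists>n::nat. 0 < n \<and> a [^] int n \<in> P")
    case False
    have 0: "k = 0" if "a [^] k \<in> P" for k :: int
    proof (rule ccontr)
      assume "k \<noteq> 0"
      moreover have "a [^] (- k) \<in> P" using that a subgroup.m_inv_closed[OF P] by (simp add: int_pow_neg)
      ultimately have "0 < nat \<bar>k\<bar> \<and> a [^] int (nat \<bar>k\<bar>) \<in> P" using that by (cases "k < 0") auto
      with False show False by blast
    qed
    have "a \<in> L"
    proof (rule extend[OF a])
      fix l and k :: int assume l: "l \<in> L" "l \<otimes> a [^] k \<in> T"
      then have "k = 0" using 0 lP a by blast
      then have "l \<otimes> a [^] k = l" using Lc[OF l(1)] by simp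
      with l show "l \<otimes> a [^] k = \<one>" using LT1 by simp
    qed
    then show ?thesis by (rule LP)
  next
    case True
    define n where "n = (LEAST n::nat. 0 < n \<and> a [^] int n \<in> P)"
    have n: "0 < n" "a [^] int n \<in> P" using LeastI_ex[OF True] by (auto simp: n_def)
    have min: "\<not> (0 < k \<and> a [^] int k \<in> P)" if "k < n" for k
      using not_less_Least that unfolding n_def by blast
    \<comment> \<open>The exponents of powers lying in \<open>P\<close> form a group of integers,
      generated by its least positive element \<open>n\<close>.\<close>
    have dvd: "int n dvd k" if "a [^] k \<in> P" for k :: int
    proof -
      have "a [^] k \<otimes> inv ((a [^] int n) [^] (k div int n)) \<in> P"
        by (rule subgroup.m_closed[OF P that subgroup.m_inv_closed[OF P subgroup_int_pow_closed[OF P n(2)]]])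
      also have "a [^] k \<otimes> inv ((a [^] int n) [^] (k div int n)) = a [^] (k - int n * (k div int n))"
        using a by (simp add: int_pow_pow int_pow_diff)
      also have "k - int n * (k div int n) = int (nat (k mod int n))"
        using n(1) by (simp add: minus_mult_div_eq_mod)
      finally have "a [^] int (nat (k mod int n)) \<in> P" .
      moreover have "nat (k mod int n) < n" using n(1) by (simp add: nat_less_iff)
      ultimately have "nat (k mod int n) = 0" using min[of "nat (k mod int n)"] by linarith
      moreover have "0 \<le> k mod int n" using n(1) by simp
      ultimately have "k mod int n = 0" by simp
      then show ?thesis by (rule dvd_eq_mod_eq_0[THEN iffD2])
    qed
    \<comment> \<open>The correction \<open>t\<close> that brings \<open>a [^] int n\<close> into
      \<open>L\<close> has an \<open>n\<close>-th root \<open>u\<close> in \<open>T\<close>, so the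
      \<open>n\<close>-th power of \<open>a \<otimes> u\<close> lies in \<open>L\<close>
      itself.\<close>
    obtain t where t: "t \<in> T" "a [^] int n \<otimes> t \<in> L" using PT[OF n(2) a] by blast
    obtain u where u: "u \<in> T" "u [^] n = t" using div[OF t(1) n(1)] by blast
    let ?a = "a \<otimes> u"
    have uc: "u \<in> carrier G" "?a \<in> carrier G" using Tc u a by auto
    have pow: "?a [^] k = a [^] k \<otimes> u [^] k" for k :: int using a uc by (simp add: int_pow_distrib)
    have an: "?a [^] int n \<in> L" using t(2) u(2) unfolding pow by (simp add: int_pow_int)
    have "?a \<in> L"
    proof (rule extend[OF uc(2)])
      fix l and k :: int assume l: "l \<in> L" "l \<otimes> ?a [^] k \<in> T"
      have "?a [^] k \<otimes> inv (u [^] k) \<in> P"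
        by (rule subgroup.m_closed[OF P lP[OF l uc(2)]
              subgroup.m_inv_closed[OF P TP[OF subgroup_int_pow_closed[OF T u(1)]]]])
      also have "?a [^] k \<otimes> inv (u [^] k) = a [^] k" unfolding pow using a uc by (simp add: m_assoc)
      finally obtain j where "k = int n * j" using dvd by (auto elim: dvdE)
      then have "?a [^] k = (?a [^] int n) [^] j" using uc by (simp add: int_pow_pow)
      then have "?a [^] k \<in> L" using subgroup_int_pow_closed[OF L(1) an] by simp
      then have "l \<otimes> ?a [^] k \<in> L" using l(1) subgroup.m_closed[OF L(1)] by blast
      with l(2) show "l \<otimes> ?a [^] k = \<one>" by (intro LT1)
    qed
    then have "?a \<otimes> inv u \<in> P"
      by (rule subgroup.m_closed[OF P LP subgroup.m_inv_closed[OF P TP[OF u(1)]]])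
    then show ?thesis using a uc by (simp add: m_assoc)
  qed
  then have "\<forall>a\<in>carrier G. \<exists>l\<in>L. \<exists>t\<in>T. a = l \<otimes> t" unfolding P_def by blast
  with L show ?thesis by blast
qed

context gda
begin

lemma D_disjoint:
  assumes "d \<in> carrier G" "h \<in> carrier G" "x \<in> D d" "x \<in> D h" "x \<noteq> 0"
  shows "d = h"
proof (rule ccontr)
  assume "d \<noteq> h"
  let ?z = "\<lambda>k. if k = d then x else - x"
  have "?z d = 0"
    by (rule D_independent[of "{d, h}"]) (use assms \<open>d \<noteq> h\<close> D_uminus in auto)
  with assms show False by simp
qed

context
  fixes X :: "'g \<Rightarrow> 'b"
  assumes X: "\<And>h. h \<in> H \<Longrightarrow> X h \<in> D h \<and> X h \<noteq> 0"
begin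

lemma inj_X: "inj_on X H"
  using X D_disjoint by (metis H_carrier inj_onI)

lemma independent_X: "independent (X ` H)"
  unfolding independent_explicit_finite_subsets
proof (intro allI impI ballI)
  fix S u v assume S: "S \<subseteq> X ` H" "finite S" "(\<Sum>v\<in>S. s (u v) v) = 0" "v \<in> S"
  let ?\<delta> = "inv_into H X"
  have \<delta>: "?\<delta> v \<in> H" "X (?\<delta> v) = v" if "v \<in> S" for v
    using S(1) that inv_into_into[of v X H] f_inv_into_f[of v X H] by auto
  have "s (u v) v = 0"
  proof (rule D_independent_image[OF S(2) _ _ _ S(3,4)])
    show "inj_on ?\<delta> S" using \<delta>(2) by (metis inj_onI)
    show "?\<delta> v \<in> carrier G" if "v \<in> S" for v using \<delta>(1)[OF that] by simp
    show "s (u v) v \<in> D (?\<delta> v)" if "v \<in> S" for v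
      using D_scale[of "?\<delta> v" v] X[OF \<delta>(1)[OF that]] \<delta>[OF that] by simp
  qed
  moreover have "v \<noteq> 0" using X \<delta>[OF S(4)] by metis
  ultimately show "u v = 0" by simp
qed

lemma span_X: "x \<in> span (X ` H)"
proof -
  obtain S z where S: "finite S" "S \<subseteq> carrier G" "\<And>h. h \<in> S \<Longrightarrow> z h \<in> D h" "x = (\<Sum>h\<in>S. z h)"
    using D_generate[of x] by blast
  have "z h \<in> span (X ` H)" if h: "h \<in> S" for h
  proof (cases "h \<in> H")
    case True
    then obtain c where "z h = s c (X h)" using D_one_dim[of h "X h" "z h"] X S(3)[OF h] by auto
    then show ?thesis using True by (auto intro: span_scale span_base)
  next
    case False
    then have "z h = 0" using D_outside[of h "z h"] S(2,3) h by auto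
    then show ?thesis by (simp add: span_zero)
  qed
  then show ?thesis unfolding S(4) by (rule span_sum)
qed

lemma D_induct:
  assumes "P 0" "\<And>c h y. h \<in> H \<Longrightarrow> P y \<Longrightarrow> P (s c (X h) + y)"
  shows "P x"
  using span_X[of x]
proof (induction rule: span_induct_alt)
  case (step c v y)
  then show ?case using assms(2) by blast
qed (rule assms(1))

end

end

locale gda_pair = A: gda G s D H + B: gda G s' D' H
  for G :: "'g monoid" (structure)
    and s :: "'k::field_char_0 \<Rightarrow> 'b::ring_1 \<Rightarrow> 'b" and D H
    and s' :: "'k \<Rightarrow> 'c::ring_1 \<Rightarrow> 'c" and D'
begin

lemma exists_linear:
  assumes X: "\<And>h. h \<in> H \<Longrightarrow> X h \<in> D h \<and> X h \<noteq> 0"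
  shows "\<exists>f. (\<forall>x y. f (x + y) = f x + f y) \<and> (\<forall>c x. f (s c x) = s' c (f x)) \<and> (\<forall>h\<in>H. f (X h) = Y h)"
proof -
  interpret vector_space_pair s s' ..
  define f where "f = construct (X ` H) (\<lambda>v. Y (inv_into H X v))"
  have ind: "A.independent (X ` H)" by (rule A.independent_X[OF X])
  have "Vector_Spaces.linear s s' f" unfolding f_def by (rule linear_construct[OF ind])
  then have "f (x + y) = f x + f y" "f (s c x) = s' c (f x)" for x y c
    by (rule linear_add, rule linear_scale)
  moreover have "f (X h) = Y h" if "h \<in> H" for h
    unfolding f_def using that construct_basis[OF ind, of "X h"] A.inj_X[OF X] by simp
  ultimately show ?thesis by blast
qed

end

text \<open>The bases have the same structure constants \<open>\<sigma>\<close>, so linear extension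
  is multiplicative; extension in the opposite direction gives the inverse.\<close>

lemma (in gda_pair) basis_change:
  assumes X: "\<And>h. h \<in> H \<Longrightarrow> X h \<in> D h \<and> X h \<noteq> 0" and X1: "X \<one> = 1"
    and Y: "\<And>h. h \<in> H \<Longrightarrow> Y h \<in> D' h \<and> Y h \<noteq> 0" and Y1: "Y \<one> = 1"
    and mult: "\<And>h k. h \<in> H \<Longrightarrow> k \<in> H \<Longrightarrow>
      X h * X k = s (\<sigma> h k) (X (h \<otimes> k)) \<and> Y h * Y k = s' (\<sigma> h k) (Y (h \<otimes> k))"
  shows "\<exists>f. bij f \<and> (\<forall>x y. f (x + y) = f x + f y) \<and> (\<forall>x y. f (x * y) = f x * f y) \<and> f 1 = 1 \<and>
    (\<forall>c x. f (s c x) = s' c (f x)) \<and> (\<forall>d\<in>carrier G. \<forall>x\<in>D d. f x \<in> D' d)"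
proof -
  interpret rev: gda_pair G s' D' H s D ..
  obtain f where f: "\<And>x y. f (x + y) = f x + f y" "\<And>c x. f (s c x) = s' c (f x)" "\<And>h. h \<in> H \<Longrightarrow> f (X h) = Y h"
    using exists_linear[OF X] by blast
  obtain e where e: "\<And>x y. e (x + y) = e x + e y" "\<And>c x. e (s' c x) = s c (e x)" "\<And>h. h \<in> H \<Longrightarrow> e (Y h) = X h"
    using rev.exists_linear[OF Y] by blast
  have 0: "f 0 = 0" "e 0 = 0" using f(1)[of 0 0] e(1)[of 0 0] by simp_all
  have ef: "e (f x) = x" for x
    by (rule A.D_induct[OF X, of "\<lambda>x. e (f x) = x"]) (simp_all add: 0 f e)
  have fe: "f (e y) = y" for y
    by (rule B.D_induct[OF Y, of "\<lambda>y. f (e y) = y"]) (simp_all add: 0 f e)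
  have "bij f" by (rule bijI'[where f = f]) (metis ef, metis fe)
  moreover have fX: "f (X h * y) = Y h * f y" if h: "h \<in> H" for h y
  proof (rule A.D_induct[OF X, of "\<lambda>y. f (X h * y) = Y h * f y"])
    fix c k y assume k: "k \<in> H" and y: "f (X h * y) = Y h * f y"
    have hk: "h \<otimes> k \<in> H" using h k subgroup.m_closed[OF A.H_subgroup] by blast
    have "X h * (s c (X k) + y) = s c (X h * X k) + X h * y"
      by (simp add: distrib_left A.scale_mult_right)
    then have "f (X h * (s c (X k) + y)) = s' c (f (X h * X k)) + f (X h * y)"
      by (simp only: f(1,2))
    also have "f (X h * X k) = Y h * Y k" using mult[OF h k] f(2,3) hk by simp
    also have "s' c (Y h * Y k) + f (X h * y) = Y h * f (s c (X k) + y)"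
      using y f k by (simp add: distrib_left B.scale_mult_right)
    finally show "f (X h * (s c (X k) + y)) = Y h * f (s c (X k) + y)" .
  qed (simp_all add: 0)
  have "f (x * y) = f x * f y" for x y
  proof (rule A.D_induct[OF X, of "\<lambda>x. f (x * y) = f x * f y"])
    fix c h z assume h: "h \<in> H" and z: "f (z * y) = f z * f y"
    have "(s c (X h) + z) * y = s c (X h * y) + z * y"
      by (simp add: distrib_right A.scale_mult_left)
    then have "f ((s c (X h) + z) * y) = s' c (f (X h * y)) + f (z * y)" by (simp only: f(1,2))
    then show "f ((s c (X h) + z) * y) = f (s c (X h) + z) * f y"
      using z f h by (simp add: fX distrib_right B.scale_mult_left)
  qed (simp_all add: 0)
  moreover have "f 1 = 1" using f(3)[OF subgroup.one_closed[OF A.H_subgroup]] X1 Y1 by simp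
  moreover have "f x \<in> D' d" if d: "d \<in> carrier G" "x \<in> D d" for d x
  proof (cases "d \<in> H")
    case True
    then obtain c where "x = s c (X d)" using A.D_one_dim[OF d(1) _ d(2)] X by blast
    then show ?thesis using f True Y B.D_scale d by simp
  next
    case False
    then show ?thesis using A.D_outside d 0 B.D_zero by metis
  qed
  ultimately show ?thesis using f(1,2) by blast
qed

text \<open>The two twisted group algebras differ by the symmetric cocycle \<open>\<rho>\<close>. It defines an abelian
  extension of \<open>H\<close> by the divisible group of nonzero scalars, which splits.\<close>

lemma (in gda_pair) graded_division_iso:
  assumes roots: "\<And>(c::'k) n. 0 < n \<Longrightarrow> \<exists>d. d ^ n = c"
    and comm: "\<And>t r \<beta>. t \<in> H \<Longrightarrow> r \<in> H \<Longrightarrow> (\<And>x y. x \<in> D' t \<Longrightarrow> y \<in> D' r \<Longrightarrow> x * y = s' \<beta> (y * x)) \<Longrightarrow>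
      (\<And>x y. x \<in> D t \<Longrightarrow> y \<in> D r \<Longrightarrow> x * y = s \<beta> (y * x))"
  shows "\<exists>f. bij f \<and> (\<forall>x y. f (x + y) = f x + f y) \<and> (\<forall>x y. f (x * y) = f x * f y) \<and> f 1 = 1 \<and>
    (\<forall>c x. f (s c x) = s' c (f x)) \<and> (\<forall>d\<in>carrier G. \<forall>x\<in>D d. f x \<in> D' d)"
proof -
  have Hm: "h \<otimes> k \<in> H" if "h \<in> H" "k \<in> H" for h k using subgroup.m_closed[OF A.H_subgroup that] .
  have H1: "\<one> \<in> H" by (rule subgroup.one_closed[OF A.H_subgroup])
  have Hi: "inv h \<in> H" if "h \<in> H" for h using subgroup.m_inv_closed[OF A.H_subgroup that] .
  have "\<exists>X. \<forall>h\<in>H. X h \<in> D h \<and> X h \<noteq> 0" using A.D_nontriv by (intro bchoice) blast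
  then obtain X0 where X0: "\<And>h. h \<in> H \<Longrightarrow> X0 h \<in> D h \<and> X0 h \<noteq> 0" by blast
  have "\<exists>X. \<forall>h\<in>H. X h \<in> D' h \<and> X h \<noteq> 0" using B.D_nontriv by (intro bchoice) blast
  then obtain X0' where X0': "\<And>h. h \<in> H \<Longrightarrow> X0' h \<in> D' h \<and> X0' h \<noteq> 0" by blast
  \<comment> \<open>Normalising at \<open>\<one>\<close> makes both cocycles trivial there, so that
    \<open>(\<one>, 1)\<close> becomes neutral in the extension.\<close>
  define X where "X = X0(\<one> := 1)"
  define X' where "X' = X0'(\<one> := 1)"
  have X: "X h \<in> D h" "X h \<noteq> 0" and X': "X' h \<in> D' h" "X' h \<noteq> 0" if "h \<in> H" for h
    using X0[OF that] X0'[OF that] A.one_D B.one_D by (auto simp: X_def X'_def)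
  have X1: "X \<one> = 1" "X' \<one> = 1" by (simp_all add: X_def X'_def)
  have "\<exists>c. X h * X k = s c (X (h \<otimes> k))" if "h \<in> H" "k \<in> H" for h k
    using A.D_one_dim[of "h \<otimes> k" "X (h \<otimes> k)" "X h * X k"] A.D_mult[of h k "X h" "X k"] X Hm that by simp
  then obtain \<sigma> where \<sigma>: "\<And>h k. h \<in> H \<Longrightarrow> k \<in> H \<Longrightarrow> X h * X k = s (\<sigma> h k) (X (h \<otimes> k))" by metis
  have "\<exists>c. X' h * X' k = s' c (X' (h \<otimes> k))" if "h \<in> H" "k \<in> H" for h k
    using B.D_one_dim[of "h \<otimes> k" "X' (h \<otimes> k)" "X' h * X' k"] B.D_mult[of h k "X' h" "X' k"] X' Hm that by simp
  then obtain \<sigma>' where \<sigma>': "\<And>h k. h \<in> H \<Longrightarrow> k \<in> H \<Longrightarrow> X' h * X' k = s' (\<sigma>' h k) (X' (h \<otimes> k))" by metis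
  have nz: "\<sigma> h k \<noteq> 0" "\<sigma>' h k \<noteq> 0" if "h \<in> H" "k \<in> H" for h k
    using A.D_mult_nonzero[of h "X h" "X k"] B.D_mult_nonzero[of h "X' h" "X' k"] \<sigma>[OF that] \<sigma>'[OF that] X X' that
    by auto
  have canc: "a = b" if "s a (X h) = s b (X h)" "h \<in> H" for a b h
    using that X A.scale_right_imp_eq[of "X h" a b] by simp
  have canc': "a = b" if "s' a (X' h) = s' b (X' h)" "h \<in> H" for a b h
    using that X' B.scale_right_imp_eq[of "X' h" a b] by simp
  have cocycle: "\<sigma> h k * \<sigma> (h \<otimes> k) l = \<sigma> k l * \<sigma> h (k \<otimes> l)"
    "\<sigma>' h k * \<sigma>' (h \<otimes> k) l = \<sigma>' k l * \<sigma>' h (k \<otimes> l)" if "h \<in> H" "k \<in> H" "l \<in> H" for h k l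
  proof -
    have assoc: "h \<otimes> k \<otimes> l = h \<otimes> (k \<otimes> l)" using that by (simp add: A.m_assoc)
    have "(X h * X k) * X l = s (\<sigma> h k * \<sigma> (h \<otimes> k) l) (X (h \<otimes> k \<otimes> l))"
      using that Hm by (simp add: \<sigma> flip: A.scale_mult_left)
    moreover have "X h * (X k * X l) = s (\<sigma> k l * \<sigma> h (k \<otimes> l)) (X (h \<otimes> (k \<otimes> l)))"
      using that Hm by (simp add: \<sigma> flip: A.scale_mult_right)
    ultimately show "\<sigma> h k * \<sigma> (h \<otimes> k) l = \<sigma> k l * \<sigma> h (k \<otimes> l)"
      using canc[of _ "h \<otimes> (k \<otimes> l)"] assoc Hm that by (metis mult.assoc)
    have "(X' h * X' k) * X' l = s' (\<sigma>' h k * \<sigma>' (h \<otimes> k) l) (X' (h \<otimes> k \<otimes> l))"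
      using that Hm by (simp add: \<sigma>' flip: B.scale_mult_left)
    moreover have "X' h * (X' k * X' l) = s' (\<sigma>' k l * \<sigma>' h (k \<otimes> l)) (X' (h \<otimes> (k \<otimes> l)))"
      using that Hm by (simp add: \<sigma>' flip: B.scale_mult_right)
    ultimately show "\<sigma>' h k * \<sigma>' (h \<otimes> k) l = \<sigma>' k l * \<sigma>' h (k \<otimes> l)"
      using canc'[of _ "h \<otimes> (k \<otimes> l)"] assoc Hm that by (metis mult.assoc)
  qed
  have \<sigma>1: "\<sigma> \<one> h = 1" "\<sigma>' \<one> h = 1" if h: "h \<in> H" for h
    using canc[OF _ h, of "\<sigma> \<one> h" 1] canc'[OF _ h, of "\<sigma>' \<one> h" 1] \<sigma>[OF H1 h] \<sigma>'[OF H1 h] X1 h by auto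
  have sym: "\<sigma> h k * \<sigma>' k h = \<sigma>' h k * \<sigma> k h" if hk: "h \<in> H" "k \<in> H" for h k
  proof -
    \<comment> \<open>The commutation factor of \<open>h\<close> and \<open>k\<close> in the second
      algebra. That the first algebra shares it is the symmetry of the quotient of the
      cocycles.\<close>
    define \<beta> where "\<beta> = \<sigma>' h k / \<sigma>' k h"
    have mc: "k \<otimes> h = h \<otimes> k" using hk by (simp add: A.m_comm)
    have "x * y = s' \<beta> (y * x)" if "x \<in> D' h" "y \<in> D' k" for x y
    proof -
      obtain a b where "x = s' a (X' h)" "y = s' b (X' k)"
        using B.D_one_dim[of h "X' h" x] B.D_one_dim[of k "X' k" y] X' hk \<open>x \<in> D' h\<close> \<open>y \<in> D' k\<close> by auto
      then show ?thesis using nz(2)[OF hk(2,1)]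
        by (simp add: B.scale_mult_scale \<sigma>' hk mc \<beta>_def)
    qed
    then have "X h * X k = s \<beta> (X k * X h)" using comm[OF hk _ X(1)[OF hk(1)] X(1)[OF hk(2)]] by blast
    then have "s (\<sigma> h k) (X (h \<otimes> k)) = s (\<beta> * \<sigma> k h) (X (h \<otimes> k))" by (simp add: \<sigma> hk mc)
    then have "\<sigma> h k = \<beta> * \<sigma> k h" using canc Hm[OF hk] by blast
    then show ?thesis using nz(2)[OF hk(2,1)] by (simp add: \<beta>_def)
  qed
  define \<rho> where "\<rho> h k = \<sigma>' h k / \<sigma> h k" for h k
  have \<rho>0: "\<rho> h k \<noteq> 0" if "h \<in> H" "k \<in> H" for h k using nz[OF that] by (simp add: \<rho>_def)
  have \<rho>sym: "\<rho> h k = \<rho> k h" if "h \<in> H" "k \<in> H" for h k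
    using sym[OF that] nz[OF that] nz[OF that(2,1)] by (simp add: \<rho>_def field_simps)
  have \<rho>1: "\<rho> \<one> h = 1" if "h \<in> H" for h using \<sigma>1[OF that] by (simp add: \<rho>_def)
  have \<rho>c: "\<rho> h k * \<rho> (h \<otimes> k) l = \<rho> k l * \<rho> h (k \<otimes> l)" if "h \<in> H" "k \<in> H" "l \<in> H" for h k l
    using cocycle[OF that] by (simp add: \<rho>_def times_divide_times_eq)
  \<comment> \<open>Associativity is the cocycle identity of \<open>\<rho>\<close>, commutativity
    its symmetry.\<close>
  define E :: "('g \<times> 'k) monoid" where
    "E = \<lparr>carrier = H \<times> (UNIV - {0}), mult = (\<lambda>(h, c) (k, d). (h \<otimes> k, c * d * \<rho> h k)), one = (\<one>, 1)\<rparr>"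
  have E_cases: "\<exists>h c. x = (h, c) \<and> h \<in> H \<and> c \<noteq> 0" if "x \<in> carrier E" for x
    using that by (cases x) (simp add: E_def)
  have "comm_group E"
  proof (rule comm_groupI)
    fix x y z assume "x \<in> carrier E" "y \<in> carrier E" "z \<in> carrier E"
    then obtain h c k d l e where xyz: "x = (h, c)" "y = (k, d)" "z = (l, e)" "h \<in> H" "k \<in> H" "l \<in> H" "c \<noteq> 0" "d \<noteq> 0" "e \<noteq> 0"
      using E_cases by metis
    show "x \<otimes>\<^bsub>E\<^esub> y \<in> carrier E" using xyz Hm \<rho>0 by (simp add: E_def)
    show "x \<otimes>\<^bsub>E\<^esub> y = y \<otimes>\<^bsub>E\<^esub> x" using xyz \<rho>sym[of h k] by (simp add: E_def A.m_comm mult_ac)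
    have "c * d * \<rho> h k * e * \<rho> (h \<otimes> k) l = (c * d * e) * (\<rho> h k * \<rho> (h \<otimes> k) l)" by (simp only: mult_ac)
    also have "\<dots> = c * (d * e * \<rho> k l) * \<rho> h (k \<otimes> l)" by (simp only: \<rho>c[OF xyz(4-6)] mult_ac)
    finally show "x \<otimes>\<^bsub>E\<^esub> y \<otimes>\<^bsub>E\<^esub> z = x \<otimes>\<^bsub>E\<^esub> (y \<otimes>\<^bsub>E\<^esub> z)"
      using xyz by (simp add: E_def A.m_assoc)
  next
    show "\<one>\<^bsub>E\<^esub> \<in> carrier E" using H1 by (simp add: E_def)
    fix x assume "x \<in> carrier E"
    then obtain h c where x: "x = (h, c)" "h \<in> H" "c \<noteq> 0" using E_cases by blast
    show "\<one>\<^bsub>E\<^esub> \<otimes>\<^bsub>E\<^esub> x = x" using x \<rho>1 by (simp add: E_def)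
    show "\<exists>y\<in>carrier E. y \<otimes>\<^bsub>E\<^esub> x = \<one>\<^bsub>E\<^esub>"
      by (rule bexI[of _ "(inv h, 1 / (c * \<rho> (inv h) h))"]) (use x Hi \<rho>0 in \<open>auto simp: E_def\<close>)
  qed
  then interpret E: comm_group E .
  define T where "T = {(\<one>, c) | c. c \<noteq> (0::'k)}"
  have T_mult: "(\<one>, c) \<otimes>\<^bsub>E\<^esub> (\<one>, d) = (\<one>, c * d)" for c d using \<rho>1[OF H1] by (simp add: E_def)
  have T_one: "\<one>\<^bsub>E\<^esub> = (\<one>, 1)" by (simp add: E_def)
  have T_carrier: "T \<subseteq> carrier E" using H1 by (auto simp: T_def E_def)
  have "subgroup T E"
  proof (rule E.subgroupI)
    show "T \<subseteq> carrier E" by (rule T_carrier)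
    show "T \<noteq> {}" by (auto simp: T_def intro: exI[of _ 1])
    show "inv\<^bsub>E\<^esub> a \<in> T" if "a \<in> T" for a
    proof -
      obtain c where c: "a = (\<one>, c)" "c \<noteq> 0" using \<open>a \<in> T\<close> by (auto simp: T_def)
      then have i: "(\<one>, 1 / c) \<in> T" by (auto simp: T_def)
      have "inv\<^bsub>E\<^esub> a = (\<one>, 1 / c)"
        by (rule E.inv_equality) (use c i that T_carrier in \<open>auto simp: T_mult T_one\<close>)
      with i show ?thesis by simp
    qed
    show "a \<otimes>\<^bsub>E\<^esub> b \<in> T" if "a \<in> T" "b \<in> T" for a b
      using that by (auto simp: T_def T_mult)
  qed
  moreover have "\<exists>u\<in>T. u [^]\<^bsub>E\<^esub> n = t" if t: "t \<in> T" "0 < n" for t and n :: nat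
  proof -
    obtain c where c: "t = (\<one>, c)" "c \<noteq> 0" using t by (auto simp: T_def)
    obtain d where d: "d ^ n = c" using roots[OF t(2)] by blast
    have "(\<one>, d) [^]\<^bsub>E\<^esub> k = (\<one>, d ^ k)" for k :: nat
      by (induction k) (simp_all add: T_one T_mult mult.commute)
    moreover have "(\<one>, d) \<in> T" using c d t(2) by (auto simp: T_def)
    ultimately show ?thesis using c d by metis
  qed
  ultimately obtain L where L: "subgroup L E" "L \<inter> T = {\<one>\<^bsub>E\<^esub>}"
    "\<And>a. a \<in> carrier E \<Longrightarrow> \<exists>l\<in>L. \<exists>t\<in>T. a = l \<otimes>\<^bsub>E\<^esub> t"
    using E.divisible_complement[of T] by blast
  have Lc: "x \<in> carrier E" if "x \<in> L" for x using subgroup.mem_carrier[OF L(1) that] .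
  \<comment> \<open>Together with \<open>uniq\<close>: a complement of the scalars contains exactly
    one element over each \<open>h\<close>, so it is the graph of a function
    \<open>\<mu>\<close>.\<close>
  have ex: "\<exists>c. (h, c) \<in> L" if h: "h \<in> H" for h
  proof -
    have "(h, 1) \<in> carrier E" using h by (simp add: E_def)
    then obtain l t where lt: "l \<in> L" "t \<in> T" "(h, 1) = l \<otimes>\<^bsub>E\<^esub> t" using L(3) by blast
    obtain k c d where k: "l = (k, c)" "t = (\<one>, d)" "k \<in> H"
      using lt(2) Lc[OF lt(1)] by (cases l) (auto simp: T_def E_def)
    then have "k = h" using lt(3) by (simp add: E_def)
    with k lt(1) show ?thesis by blast
  qed
  have uniq: "c = d" if "(h, c) \<in> L" "(h, d) \<in> L" for h c d
  proof -
    have hc: "h \<in> H" "c \<noteq> 0" "d \<noteq> 0" using Lc[OF that(1)] Lc[OF that(2)] by (auto simp: E_def)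
    define i where "i = inv\<^bsub>E\<^esub> (h, d)"
    have iL: "i \<in> L" using subgroup.m_inv_closed[OF L(1) that(2)] by (simp add: i_def)
    have i1: "i \<otimes>\<^bsub>E\<^esub> (h, d) = \<one>\<^bsub>E\<^esub>" using E.l_inv[OF Lc[OF that(2)]] by (simp add: i_def)
    obtain k e where k: "i = (k, e)" by (cases i)
    have ke: "k \<otimes> h = \<one>" "e * d * \<rho> k h = 1" using i1 by (auto simp: k E_def)
    have "e * \<rho> k h \<noteq> 0" using ke(2) by auto
    have "i \<otimes>\<^bsub>E\<^esub> (h, c) = (\<one>, c * (e * \<rho> k h))" using ke by (simp add: k E_def mult_ac)
    moreover have "i \<otimes>\<^bsub>E\<^esub> (h, c) \<in> L" using subgroup.m_closed[OF L(1) iL that(1)] .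
    moreover have "(\<one>, c * (e * \<rho> k h)) \<in> T" using hc \<open>e * \<rho> k h \<noteq> 0\<close> by (auto simp: T_def)
    ultimately have "(\<one>, c * (e * \<rho> k h)) \<in> L \<inter> T" by simp
    then have "c * (e * \<rho> k h) = 1" unfolding L(2) T_one by simp
    also have "1 = d * (e * \<rho> k h)" using ke(2) by (simp add: mult_ac)
    finally show "c = d" using \<open>e * \<rho> k h \<noteq> 0\<close> by simp
  qed
  obtain \<mu> where \<mu>: "\<And>h. h \<in> H \<Longrightarrow> (h, \<mu> h) \<in> L" using ex by metis
  have \<mu>0: "\<mu> h \<noteq> 0" if "h \<in> H" for h using Lc[OF \<mu>[OF that]] by (simp add: E_def)
  \<comment> \<open>Closedness of \<open>L\<close> under the product of \<open>E\<close> says that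
    \<open>\<rho>\<close> is the coboundary of \<open>\<mu>\<close>.\<close>
  have \<mu>m: "\<mu> (h \<otimes> k) = \<mu> h * \<mu> k * \<rho> h k" if "h \<in> H" "k \<in> H" for h k
    using subgroup.m_closed[OF L(1) \<mu>[OF that(1)] \<mu>[OF that(2)]] uniq[OF \<mu>[OF Hm[OF that]]] by (simp add: E_def)
  have \<mu>1: "\<mu> \<one> = 1" using uniq[OF \<mu>[OF H1]] subgroup.one_closed[OF L(1)] T_one by simp
  \<comment> \<open>Rescaling by \<open>\<mu>\<close> turns the cocycle \<open>\<sigma>'\<close>
    into \<open>\<sigma>\<close>.\<close>
  define Y where "Y h = s' (\<mu> h) (X' h)" for h
  show ?thesis
  proof (rule basis_change[of X Y \<sigma>])
    show "X h \<in> D h \<and> X h \<noteq> 0" if "h \<in> H" for h using X that by blast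
    show "Y h \<in> D' h \<and> Y h \<noteq> 0" if "h \<in> H" for h
      using X'[OF that] \<mu>0[OF that] B.D_scale that by (simp add: Y_def)
    show "X \<one> = 1" "Y \<one> = 1" using X1 \<mu>1 by (simp_all add: Y_def)
    show "X h * X k = s (\<sigma> h k) (X (h \<otimes> k)) \<and> Y h * Y k = s' (\<sigma> h k) (Y (h \<otimes> k))"
      if hk: "h \<in> H" "k \<in> H" for h k
    proof -
      have "\<sigma> h k * \<mu> (h \<otimes> k) = \<mu> h * \<mu> k * \<sigma>' h k"
        using nz(1)[OF hk] by (simp add: \<mu>m[OF hk] \<rho>_def)
      then have "Y h * Y k = s' (\<sigma> h k) (Y (h \<otimes> k))"
        by (simp add: Y_def B.scale_mult_scale \<sigma>'[OF hk])
      with \<sigma>[OF hk] show ?thesis by blast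
    qed
  qed
qed

section \<open>Equal identities imply isomorphism\<close>

sublocale two \<subseteq> pair ..

lemma (in gda) coset_representatives:
  "\<exists>r. (\<forall>x\<in>carrier G. r x \<in> carrier G \<and> inv x \<otimes> r x \<in> H) \<and>
    (\<forall>x\<in>carrier G. \<forall>y\<in>carrier G. inv (r x) \<otimes> r y \<in> H \<longrightarrow> r x = r y)"
proof -
  define r where "r x = (SOME y. y \<in> carrier G \<and> inv x \<otimes> y \<in> H)" for x
  have r: "r x \<in> carrier G \<and> inv x \<otimes> r x \<in> H" if "x \<in> carrier G" for x
    unfolding r_def by (rule someI[of _ x]) (use that coset_refl[OF H_subgroup] in blast)
  have eq: "r x = r y" if xy: "x \<in> carrier G" "y \<in> carrier G" and "inv (r x) \<otimes> r y \<in> H" for x y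
  proof -
    have "inv x \<otimes> r y \<in> H"
      using coset_trans[OF H_subgroup xy(1)] r[OF xy(1)] r[OF xy(2)] that(3) by blast
    then have xy': "inv x \<otimes> y \<in> H"
      using coset_trans[OF H_subgroup xy(1) _ xy(2)] coset_sym[OF H_subgroup xy(2)] r[OF xy(2)] by blast
    have "(z \<in> carrier G \<and> inv x \<otimes> z \<in> H) = (z \<in> carrier G \<and> inv y \<otimes> z \<in> H)" for z
      using coset_diff[OF H_subgroup xy _ xy'] coset_trans[OF H_subgroup xy _ xy'] by blast
    then show ?thesis by (simp add: r_def)
  qed
  show ?thesis by (rule exI[of _ r]) (use r eq in blast)
qed

text \<open>Replacing each \<open>g i\<close> by a representative of its coset gives a graded
  isomorphic algebra, so the identities do not change. Afterwards congruent degrees are equal, as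
  \<open>commutation_transfer\<close> demands.\<close>

lemma (in utg) normal_form:
  "\<exists>\<gamma>. utg G s D H n m blk \<gamma> \<and> (\<forall>i<n. \<forall>j<n. inv (\<gamma> i) \<otimes> \<gamma> j \<in> H \<longrightarrow> \<gamma> i = \<gamma> j) \<and>
    utg.ids G s D n blk \<gamma> = ids"
proof -
  obtain r where r: "\<And>x. x \<in> carrier G \<Longrightarrow> r x \<in> carrier G \<and> inv x \<otimes> r x \<in> H"
    "\<And>x y. x \<in> carrier G \<Longrightarrow> y \<in> carrier G \<Longrightarrow> inv (r x) \<otimes> r y \<in> H \<Longrightarrow> r x = r y"
    using coset_representatives by blast
  let ?\<gamma> = "\<lambda>i. r (g i)"
  interpret N: utg G s D H n m blk ?\<gamma>
    by unfold_locales (use r blk_less blk_surj m_pos in auto)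
  interpret P: pair G s D H n m blk g s D H n m blk ?\<gamma> ..
  have "\<exists>\<Psi>. P.graded_iso \<Psi>"
  proof (rule P.iso_exists[of id id \<one>])
    show "blk (id i) = blk i \<and> inv (r (g (id i))) \<otimes> (g i \<otimes> \<one>) \<in> H" if "i < n" for i
      using r(1)[OF g_carrier[OF that]] coset_sym[OF H_subgroup] that by simp
  qed auto
  then have "N.ids = ids" using P.iso_ids by metis
  then show ?thesis using N.utg_axioms r(2) by (intro exI[of _ ?\<gamma>]) simp
qed

text \<open>The tuples are normalised only to compare the commutation factors; the bijection of
  indices, and with it the isomorphism, is obtained for the original tuples. The type
  \<open>'b\<close> is here that of the scalars.\<close>

lemma (in two_eq) ids_imp_iso:
  assumes roots: "\<And>(c::'b) n. 0 < n \<Longrightarrow> \<exists>d. d ^ n = c"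
  shows "\<exists>\<Psi>. graded_iso \<Psi>"
proof -
  interpret rev: two_eq G s' D' H' n' m' blk' g' s D H n m blk g
    by (intro two_eq.intro rev_two two_eq_axioms.intro ids_sub)
  have HH: "H' = H" using support_subset rev.support_subset by blast
  obtain \<gamma> where \<gamma>: "utg G s D H n m blk \<gamma>" "\<And>i j. i < n \<Longrightarrow> j < n \<Longrightarrow> inv (\<gamma> i) \<otimes> \<gamma> j \<in> H \<Longrightarrow> \<gamma> i = \<gamma> j"
    "utg.ids G s D n blk \<gamma> = A.ids" using A.normal_form by blast
  obtain \<gamma>' where \<gamma>': "utg G s' D' H' n' m' blk' \<gamma>'" "\<And>i j. i < n' \<Longrightarrow> j < n' \<Longrightarrow> inv (\<gamma>' i) \<otimes> \<gamma>' j \<in> H' \<Longrightarrow> \<gamma>' i = \<gamma>' j"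
    "utg.ids G s' D' n' blk' \<gamma>' = B.ids" using B.normal_form by blast
  interpret N: utg G s D H n m blk \<gamma> by (rule \<gamma>(1))
  interpret N': utg G s' D' H' n' m' blk' \<gamma>' by (rule \<gamma>'(1))
  interpret NN: two G s D H n m blk \<gamma> s' D' H' n' m' blk' \<gamma>'
    by unfold_locales (simp add: \<gamma>(3) \<gamma>'(3) ids_sub)
  interpret NN': two G s' D' H' n' m' blk' \<gamma>' s D H n m blk \<gamma>
    by unfold_locales (simp add: \<gamma>(3) \<gamma>'(3) ids_sup)
  obtain p where p: "p < n" "\<And>b u. u \<in> carrier G \<Longrightarrow> card (N.cell b u) \<le> card (N.cell (blk p) (\<gamma> p))"
    using N.exists_largest_cell by blast
  obtain p' where p': "p' < n'" "\<And>b u. u \<in> carrier G \<Longrightarrow> card (N'.cell b u) \<le> card (N'.cell (blk' p') (\<gamma>' p'))"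
    using N'.exists_largest_cell by blast
  \<comment> \<open>A largest cell of the second algebra is transferred back with
    \<open>t = \<one>\<close>, which bounds all its cells by the largest cell of the first.\<close>
  have max: "card (N'.cell b u) \<le> card (N.cell (blk p) (\<gamma> p))" if u: "u \<in> carrier G" for b u
  proof -
    obtain k v where kv: "v \<in> carrier G" "card (N'.cell (blk' p') (\<gamma>' p')) \<le> card (N.cell k v)"
      using NN'.cell_transfer[OF p'(1) subgroup.one_closed[OF B.H_subgroup]] by blast
    note p'(2)[OF u, of b]
    also note kv(2)
    also note p(2)[OF kv(1), of k]
    finally show ?thesis .
  qed
  have comm: "x * y = s \<beta> (y * x)"
    if "t \<in> H" "r \<in> H" "\<And>x y. x \<in> D' t \<Longrightarrow> y \<in> D' r \<Longrightarrow> x * y = s' \<beta> (y * x)" "x \<in> D t" "y \<in> D r"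
    for t r \<beta> x y
    by (rule NN.commutation_transfer[OF HH _ _ p(1) max that]) (use \<gamma>(2) \<gamma>'(2) HH in blast)+
  interpret B': gda G s' D' H using B.gda_axioms unfolding HH .
  interpret DD: gda_pair G s D H s' D' ..
  have "\<exists>f. bij f \<and> (\<forall>x y. f (x + y) = f x + f y) \<and> (\<forall>x y. f (x * y) = f x * f y) \<and> f 1 = 1 \<and>
    (\<forall>c x. f (s c x) = s' c (f x)) \<and> (\<forall>d\<in>carrier G. \<forall>x\<in>D d. f x \<in> D' d)"
  proof (rule DD.graded_division_iso)
    show "\<exists>d. d ^ k = c" if "0 < k" for c :: 'b and k using roots[OF that] .
    fix t r \<beta> x y
    assume "t \<in> H" "r \<in> H" "\<And>x y. x \<in> D' t \<Longrightarrow> y \<in> D' r \<Longrightarrow> x * y = s' \<beta> (y * x)" "x \<in> D t" "y \<in> D r"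
    then show "x * y = s \<beta> (y * x)" by (rule comm)
  qed
  then obtain f where f: "bij f" "\<And>x y. f (x + y) = f x + f y" "\<And>x y. f (x * y) = f x * f y" "f 1 = 1"
    "\<And>c x. f (s c x) = s' c (f x)" "\<And>d x. d \<in> carrier G \<Longrightarrow> x \<in> D d \<Longrightarrow> f x \<in> D' d"
    by blast
  obtain \<pi> \<theta> where \<pi>: "bij_betw \<pi> {..<n} {..<n'}" "\<theta> \<in> carrier G"
    "\<And>i. i < n \<Longrightarrow> blk' (\<pi> i) = blk i \<and> inv (g' (\<pi> i)) \<otimes> (g i \<otimes> \<theta>) \<in> H"
    using index_bijection[OF HH] by blast
  have "blk' (\<pi> i) = blk i \<and> inv (g' (\<pi> i)) \<otimes> (g i \<otimes> \<theta>) \<in> H'" if "i < n" for i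
    unfolding HH by (rule \<pi>(3)[OF that])
  with f \<pi>(1,2) show ?thesis by (intro iso_exists)
qed

section \<open>Translation to the records\<close>

context unital_algebra
begin

lemma alg_of_finsum: "finite S \<Longrightarrow> finsum (alg_of scale) c S = sum c S"
proof (induction S rule: finite_induct)
  case empty
  interpret abelian_monoid "alg_of scale" by (rule abelian_monoidI) (simp_all add: alg_of_def add_ac)
  show ?case by (simp add: finsum_empty) (simp add: alg_of_def)
next
  case (insert x F)
  interpret abelian_monoid "alg_of scale" by (rule abelian_monoidI) (simp_all add: alg_of_def add_ac)
  have "c \<in> F \<rightarrow> carrier (alg_of scale)" "c x \<in> carrier (alg_of scale)" by (simp_all add: alg_of_def)
  then show ?case using insert by (simp add: finsum_insert) (simp add: alg_of_def)
qed

end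

text \<open>\<open>is_grading\<close> says nothing on the unit or on inverses. That \<open>1\<close>
  has degree \<open>\<one>\<close> and that inverses are homogeneous is derived by comparing
  components.\<close>

lemma gda_of_graded_division_algebra:
  fixes G :: "'g monoid" and s :: "'k::field_char_0 \<Rightarrow> 'b::ring_1 \<Rightarrow> 'b"
  assumes G: "comm_group G" and K: "subgroup K G"
    and gd: "graded_division_algebra (G\<lparr>carrier := K\<rparr>) s \<Gamma>"
  defines "D \<equiv> extend_grading K (alg_of s) \<Gamma>"
  shows "gda G s D (supp G (alg_of s) D)"
proof -
  interpret G: comm_group G by (rule G)
  interpret unital_algebra s using gd by (simp add: graded_division_algebra_def)
  let ?A = "alg_of s" and ?H = "supp G (alg_of s) D"
  have Kc: "k \<in> K \<Longrightarrow> k \<in> carrier G" for k using K by (rule subgroup.mem_carrier)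
  have Km: "h \<in> K \<Longrightarrow> k \<in> K \<Longrightarrow> h \<otimes>\<^bsub>G\<^esub> k \<in> K" for h k using K by (rule subgroup.m_closed)
  have D: "D g = (if g \<in> K then \<Gamma> g else {0})" for g by (simp add: D_def extend_grading_def alg_of_def)
  have gr: "is_grading (G\<lparr>carrier := K\<rparr>) ?A \<Gamma>" using gd by (simp add: graded_division_algebra_def)
  have sub: "submodule (\<Gamma> g) field_rec ?A" if "g \<in> K" for g
    using gr that by (simp add: is_grading_def)
  have zero: "0 \<in> D g" for g
    using subgroup.one_closed[of "\<Gamma> g" "add_monoid ?A"] sub[of g]
    by (auto simp: D submodule_def alg_of_def)
  have add: "x + y \<in> D g" if "x \<in> D g" "y \<in> D g" for g x y
    using subgroup.m_closed[of "\<Gamma> g" "add_monoid ?A" x y] sub[of g] that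
    by (auto simp: D submodule_def alg_of_def split: if_splits)
  have scl: "s c x \<in> D g" if "x \<in> D g" for c g x
    using submodule.smult_closed[OF sub[of g], of c x] that
    by (auto simp: D field_rec_def alg_of_def split: if_splits)
  have mul: "x * y \<in> D (g \<otimes>\<^bsub>G\<^esub> h)" if gh: "g \<in> carrier G" "h \<in> carrier G" "x \<in> D g" "y \<in> D h" for g h x y
  proof (cases "g \<in> K \<and> h \<in> K")
    case True
    then have "x * y \<in> \<Gamma> (g \<otimes>\<^bsub>G\<^esub> h)" using gr that by (simp add: is_grading_def D alg_of_def)
    with True show ?thesis using Km by (simp add: D)
  next
    case False
    then have "x * y = 0" using that by (auto simp: D)
    then show ?thesis using zero by simp
  qed
  have dec: "\<exists>!c. (\<forall>g\<in>K. c g \<in> \<Gamma> g) \<and> (\<forall>g. g \<notin> K \<longrightarrow> c g = 0) \<and> finite {g. c g \<noteq> 0} \<and>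
      x = sum c {g. c g \<noteq> 0}" for x
  proof -
    have "\<exists>!c. (\<forall>g\<in>K. c g \<in> \<Gamma> g) \<and> (\<forall>g. g \<notin> K \<longrightarrow> c g = 0) \<and> finite {g. c g \<noteq> 0} \<and>
        x = finsum ?A c {g. c g \<noteq> 0}"
      using gr by (simp add: is_grading_def alg_of_def)
    moreover have "(finite {g. c g \<noteq> 0} \<and> x = finsum ?A c {g. c g \<noteq> 0}) \<longleftrightarrow>
        (finite {g. c g \<noteq> 0} \<and> x = sum c {g. c g \<noteq> 0})" for c :: "'g \<Rightarrow> 'b"
      using alg_of_finsum[of "{g. c g \<noteq> 0}" c] by auto
    ultimately show ?thesis by (simp only:)
  qed
  have gen: "\<exists>S z. finite S \<and> S \<subseteq> carrier G \<and> (\<forall>h\<in>S. z h \<in> D h) \<and> x = (\<Sum>h\<in>S. z h)" for x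
  proof -
    obtain c where c: "\<forall>g\<in>K. c g \<in> \<Gamma> g" "\<forall>g. g \<notin> K \<longrightarrow> c g = 0" "finite {g. c g \<noteq> 0}"
      "x = sum c {g. c g \<noteq> 0}" using dec[of x] by blast
    show ?thesis
      by (rule exI[of _ "{g. c g \<noteq> 0}"], rule exI[of _ c]) (use c Kc in \<open>auto simp: D\<close>)
  qed
  have indep: "z h = 0" if S: "finite S" "S \<subseteq> carrier G" "\<And>h. h \<in> S \<Longrightarrow> z h \<in> D h" "(\<Sum>h\<in>S. z h) = 0" "h \<in> S"
    for S and z :: "'g \<Rightarrow> 'b" and h
  proof -
    \<comment> \<open>Extended by zero, the family is a decomposition of \<open>0\<close>, as is the
      zero function; decompositions are unique.\<close>
    define c where "c g = (if g \<in> S then z g else 0)" for g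
    let ?P = "\<lambda>c. (\<forall>g\<in>K. c g \<in> \<Gamma> g) \<and> (\<forall>g. g \<notin> K \<longrightarrow> c g = 0) \<and> finite {g. c g \<noteq> 0} \<and>
      0 = sum c {g. c g \<noteq> 0}"
    have "sum c {g. c g \<noteq> 0} = sum c S"
      using S(1) by (intro sum.mono_neutral_left) (auto simp: c_def)
    also have "\<dots> = 0" using S(4) by (simp add: c_def)
    finally have sum0: "sum c {g. c g \<noteq> 0} = 0" .
    have cD: "c g \<in> D g" for g using S(3) zero by (simp add: c_def)
    have "c g \<in> \<Gamma> g" if "g \<in> K" for g using cD[of g] that by (simp add: D)
    moreover have "c g = 0" if "g \<notin> K" for g using cD[of g] that by (simp add: D)
    moreover have "finite {g. c g \<noteq> 0}" by (rule finite_subset[OF _ S(1)]) (auto simp: c_def)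
    ultimately have 1: "?P c" using sum0 by simp
    have "0 \<in> \<Gamma> g" if "g \<in> K" for g using zero[of g] that by (simp add: D)
    then have 2: "?P (\<lambda>_. 0)" by simp
    have "c = (\<lambda>_. 0)"
      using the1_equality[OF dec[of 0], of c, OF 1] the1_equality[OF dec[of 0], of "\<lambda>_. 0", OF 2] by simp
    with S(5) show ?thesis by (metis c_def)
  qed
  have indep': "z t = 0" if T: "finite T" "inj_on \<delta> T" "\<And>t. t \<in> T \<Longrightarrow> \<delta> t \<in> carrier G"
      "\<And>t. t \<in> T \<Longrightarrow> z t \<in> D (\<delta> t)" "(\<Sum>t\<in>T. z t) = 0" "t \<in> T"
    for T and \<delta> :: "'g \<Rightarrow> 'g" and z :: "'g \<Rightarrow> 'b" and t
  proof -
    let ?i = "inv_into T \<delta>"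
    have "z (?i (\<delta> t)) = 0"
    proof (rule indep[of "\<delta> ` T" "\<lambda>h. z (?i h)"])
      show "(\<Sum>h\<in>\<delta> ` T. z (?i h)) = 0" using T by (simp add: sum.reindex)
    qed (use T in auto)
    then show ?thesis using T by simp
  qed
  have diff: "x - y \<in> D g" if "x \<in> D g" "y \<in> D g" for g x y
    using add[OF that(1) scl[OF that(2), of "-1"]] by simp
  have unit: "\<exists>y. x * y = 1 \<and> y * x = 1" if "g \<in> carrier G" "x \<in> D g" "x \<noteq> 0" for g x
  proof -
    have "g \<in> K" "x \<in> \<Gamma> g" using that by (auto simp: D split: if_splits)
    then have "x \<in> Units ?A" using gd that(3) by (simp add: graded_division_algebra_def)
    then show ?thesis by (auto simp: Units_def alg_of_def)
  qed
  have H: "?H = {g \<in> carrier G. \<exists>x\<in>D g. x \<noteq> 0}"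
    using zero by (auto simp: supp_def alg_of_def)
  \<comment> \<open>In \<open>1 = (\<Sum>h\<in>S. e h)\<close> some \<open>e h\<close> is nonzero,
    hence invertible. Multiplication by it and comparison of components give
    \<open>e k * e h = 0\<close> for \<open>k\<close> other than \<open>\<one>\<close>, so
    \<open>e k = 0\<close>.\<close>
  have one: "1 \<in> D \<one>\<^bsub>G\<^esub>"
  proof -
    obtain S e where S: "finite S" "S \<subseteq> carrier G" "\<And>h. h \<in> S \<Longrightarrow> e h \<in> D h" "1 = (\<Sum>h\<in>S. e h)"
      using gen[of 1] by blast
    have "\<exists>h\<in>S. e h \<noteq> 0"
    proof (rule ccontr)
      assume "\<not> ?thesis"
      then have "(1::'b) = 0" unfolding S(4) by (intro sum.neutral) simp
      then show False by simp
    qed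
    then obtain h where h: "h \<in> S" "e h \<noteq> 0" by blast
    have hc: "h \<in> carrier G" using h S by blast
    obtain y where y: "e h * y = 1" using unit[OF hc S(3)[OF h(1)] h(2)] by blast
    let ?z = "\<lambda>k. (if k \<in> S then e k * e h else 0) - (if k = \<one>\<^bsub>G\<^esub> then e h else 0)"
    have z0: "?z k = 0" if "k \<in> insert \<one>\<^bsub>G\<^esub> S" for k
    proof (rule indep'[of "insert \<one>\<^bsub>G\<^esub> S" "\<lambda>k. k \<otimes>\<^bsub>G\<^esub> h" ?z])
      show "inj_on (\<lambda>k. k \<otimes>\<^bsub>G\<^esub> h) (insert \<one>\<^bsub>G\<^esub> S)"
        using S(2) hc by (intro inj_onI) (auto simp: subset_iff)
      show "?z t \<in> D (t \<otimes>\<^bsub>G\<^esub> h)" if t: "t \<in> insert \<one>\<^bsub>G\<^esub> S" for t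
      proof (rule diff)
        show "(if t \<in> S then e t * e h else 0) \<in> D (t \<otimes>\<^bsub>G\<^esub> h)"
          using mul[of t h "e t" "e h"] S h hc zero t by auto
        show "(if t = \<one>\<^bsub>G\<^esub> then e h else 0) \<in> D (t \<otimes>\<^bsub>G\<^esub> h)"
          using S(3)[OF h(1)] hc zero by auto
      qed
      have "(\<Sum>k\<in>insert \<one>\<^bsub>G\<^esub> S. if k \<in> S then e k * e h else 0) = (\<Sum>k\<in>S. e k * e h)"
        using S(1) by (intro sum.mono_neutral_cong_right) auto
      also have "\<dots> = e h" using S(4) by (simp flip: sum_distrib_right)
      finally show "(\<Sum>k\<in>insert \<one>\<^bsub>G\<^esub> S. ?z k) = 0" using S(1) by (simp only: sum_subtractf) simp
    qed (use S hc that in auto)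
    have "e k = 0" if "k \<in> S" "k \<noteq> \<one>\<^bsub>G\<^esub>" for k
    proof -
      have "e k * e h = 0" using z0[of k] that by simp
      then have "e k * (e h * y) = 0" by (simp flip: mult.assoc)
      then show ?thesis using y by simp
    qed
    then have "1 = (\<Sum>k\<in>S. if k = \<one>\<^bsub>G\<^esub> then e \<one>\<^bsub>G\<^esub> else 0)"
      unfolding S(4) by (intro sum.cong) auto
    also have "\<dots> = (if \<one>\<^bsub>G\<^esub> \<in> S then e \<one>\<^bsub>G\<^esub> else 0)" using S(1) by simp
    also have "\<dots> \<in> D \<one>\<^bsub>G\<^esub>" using S(3) zero by simp
    finally show ?thesis .
  qed
  \<comment> \<open>Likewise \<open>x * y = 1\<close> shows that \<open>x\<close> annihilates each
    component of \<open>y\<close> whose degree is not \<open>inv g\<close>, and \<open>x\<close> can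
    be cancelled.\<close>
  have inverse: "\<exists>y\<in>D (inv\<^bsub>G\<^esub> g). x * y = 1 \<and> y * x = 1" if g: "g \<in> carrier G" and x: "x \<in> D g" "x \<noteq> 0" for g x
  proof -
    obtain y where y: "x * y = 1" "y * x = 1" using unit[OF g x] by blast
    obtain S c where S: "finite S" "S \<subseteq> carrier G" "\<And>h. h \<in> S \<Longrightarrow> c h \<in> D h" "y = (\<Sum>h\<in>S. c h)"
      using gen[of y] by blast
    let ?i = "inv\<^bsub>G\<^esub> g"
    let ?z = "\<lambda>k. (if k \<in> S then x * c k else 0) - (if k = ?i then 1 else 0)"
    have z0: "?z k = 0" if "k \<in> insert ?i S" for k
    proof (rule indep'[of "insert ?i S" "\<lambda>k. g \<otimes>\<^bsub>G\<^esub> k" ?z])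
      show "inj_on (\<lambda>k. g \<otimes>\<^bsub>G\<^esub> k) (insert ?i S)"
        using S(2) g by (intro inj_onI) (metis G.Units_l_cancel G.Units_eq G.inv_closed insertE subsetD)
      show "?z t \<in> D (g \<otimes>\<^bsub>G\<^esub> t)" if t: "t \<in> insert ?i S" for t
      proof (rule diff)
        show "(if t \<in> S then x * c t else 0) \<in> D (g \<otimes>\<^bsub>G\<^esub> t)"
          using mul[of g t x "c t"] S g x zero t by auto
        show "(if t = ?i then 1 else 0) \<in> D (g \<otimes>\<^bsub>G\<^esub> t)"
          using one g zero by auto
      qed
      have "(\<Sum>k\<in>insert ?i S. if k \<in> S then x * c k else 0) = (\<Sum>k\<in>S. x * c k)"
        using S(1) by (intro sum.mono_neutral_cong_right) auto
      also have "\<dots> = 1" using S(4) y(1) by (simp flip: sum_distrib_left)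
      finally show "(\<Sum>k\<in>insert ?i S. ?z k) = 0" using S(1) by (simp only: sum_subtractf) simp
    qed (use S g that in auto)
    have "c k = 0" if "k \<in> S" "k \<noteq> ?i" for k
    proof -
      have "x * c k = 0" using z0[of k] that by simp
      then have "(y * x) * c k = 0" by (simp add: mult.assoc)
      then show ?thesis using y by simp
    qed
    then have "y = (\<Sum>k\<in>S. if k = ?i then c ?i else 0)"
      unfolding S(4) by (intro sum.cong) auto
    also have "\<dots> = (if ?i \<in> S then c ?i else 0)" using S(1) by simp
    also have "\<dots> \<in> D ?i" using S(3) zero by simp
    finally show ?thesis using y by blast
  qed
  have Hsub: "subgroup ?H G"
  proof (rule G.subgroupI)
    show "?H \<subseteq> carrier G" by (auto simp: H)
    show "?H \<noteq> {}" using one by (auto simp: H intro!: exI[of _ "\<one>\<^bsub>G\<^esub>"] bexI[of _ 1])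
    show "inv\<^bsub>G\<^esub> a \<in> ?H" if a: "a \<in> ?H" for a
    proof -
      obtain x where x: "a \<in> carrier G" "x \<in> D a" "x \<noteq> 0" using a by (auto simp: H)
      obtain y where y: "y \<in> D (inv\<^bsub>G\<^esub> a)" "x * y = 1" using inverse[OF x] by blast
      then have "y \<noteq> 0" by auto
      with y x(1) show ?thesis by (auto simp: H)
    qed
    show "a \<otimes>\<^bsub>G\<^esub> b \<in> ?H" if ab: "a \<in> ?H" "b \<in> ?H" for a b
    proof -
      obtain x y where x: "a \<in> carrier G" "x \<in> D a" "x \<noteq> 0" and y: "b \<in> carrier G" "y \<in> D b" "y \<noteq> 0"
        using ab by (auto simp: H)
      obtain x' where "x' * x = 1" using unit[OF x] by blast
      then have "x * y \<noteq> 0" using y(3) by (metis mult.assoc mult_1 mult_zero_right)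
      then show ?thesis using mul[OF x(1) y(1) x(2) y(2)] x(1) y(1) by (auto simp: H)
    qed
  qed
  show ?thesis
  proof (intro gda.intro gda_axioms.intro)
    show "comm_group G" by (rule G)
    show "unital_algebra s" by (rule unital_algebra_axioms)
    show "\<exists>c. y = s c x" if g: "g \<in> carrier G" "x \<in> D g" "y \<in> D g" "x \<noteq> 0" for g x y
    proof -
      \<comment> \<open>Off \<open>K\<close> the extended components are zero, so a nonzero
        \<open>x\<close> forces \<open>g\<close> into \<open>K\<close>.\<close>
      have gK: "g \<in> K" "x \<in> \<Gamma> g" "y \<in> \<Gamma> g" using g by (auto simp: D split: if_splits)
      have "g \<in> supp (G\<lparr>carrier := K\<rparr>) ?A \<Gamma>" using gK g(4) by (auto simp: supp_def alg_of_def)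
      then have "dim (\<Gamma> g) = 1" using gd by (simp add: graded_division_algebra_def)
      then obtain B where B: "\<Gamma> g \<subseteq> span B" "card B = 1" using basis_exists[of "\<Gamma> g"] by metis
      then obtain z where "B = {z}" by (metis card_1_singletonE)
      then obtain a b where ab: "x = s a z" "y = s b z"
        using subsetD[OF B(1) gK(2)] subsetD[OF B(1) gK(3)] by (auto simp: span_singleton)
      then have "a \<noteq> 0" using g(4) by auto
      then have "y = s (b / a) x" using ab by simp
      then show ?thesis by blast
    qed
    show "x = 0" if "g \<in> carrier G" "g \<notin> ?H" "x \<in> D g" for g x using that by (auto simp: H)
    show "\<exists>x\<in>D h. x \<noteq> 0" if "h \<in> ?H" for h using that by (simp add: H)
    show "subgroup ?H G" by (rule Hsub)
    show "0 \<in> D g" for g by (rule zero)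
    show "x + y \<in> D g" if "x \<in> D g" "y \<in> D g" for g x y by (rule add[OF that])
    show "s c x \<in> D g" if "x \<in> D g" for g c x by (rule scl[OF that])
    show "x * y \<in> D (g \<otimes>\<^bsub>G\<^esub> h)" if "g \<in> carrier G" "h \<in> carrier G" "x \<in> D g" "y \<in> D h" for g h x y
      by (rule mul[OF that])
    show "\<exists>y\<in>D (inv\<^bsub>G\<^esub> g). x * y = 1 \<and> y * x = 1" if "g \<in> carrier G" "x \<in> D g" "x \<noteq> 0" for g x
      by (rule inverse[OF that])
    show "\<exists>S z. finite S \<and> S \<subseteq> carrier G \<and> (\<forall>h\<in>S. z h \<in> D h) \<and> x = (\<Sum>h\<in>S. z h)" for x by (rule gen)
    show "z h = 0" if "finite S" "S \<subseteq> carrier G" "\<And>h. h \<in> S \<Longrightarrow> z h \<in> D h" "(\<Sum>h\<in>S. z h) = 0" "h \<in> S"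
      for S and z :: "'g \<Rightarrow> 'b" and h
      by (rule indep[OF that])
  qed
qed

lemma sum_list_take_mono: "a \<le> b \<Longrightarrow> sum_list (take a ds) \<le> sum_list (take b (ds :: nat list))"
  by (metis append_take_drop_id le_add1 min.absorb1 sum_list_append take_take)

lemma block_less: "i < sum_list ds \<Longrightarrow> block ds i < length ds"
proof -
  assume i: "i < sum_list ds"
  then have "ds \<noteq> []" by auto
  then have "i < sum_list (take (Suc (length ds - 1)) ds)" using i by simp
  then have "block ds i \<le> length ds - 1" unfolding block_def by (rule Least_le)
  with \<open>ds \<noteq> []\<close> show ?thesis by (cases ds) auto
qed

lemma block_surj:
  assumes "\<forall>d\<in>set ds. 0 < d" "b < length ds"
  shows "\<exists>i<sum_list ds. block ds i = b"
proof (intro exI conjI)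
  \<comment> \<open>The first index of block \<open>b\<close>, which exists because the block has
    positive size.\<close>
  let ?i = "sum_list (take b ds)"
  have Suc: "sum_list (take (Suc b) ds) = ?i + ds ! b" using assms(2) by (simp add: take_Suc_conv_app_nth)
  moreover have "0 < ds ! b" using assms by simp
  ultimately have lt: "?i < sum_list (take (Suc b) ds)" by simp
  also have "\<dots> \<le> sum_list ds" using sum_list_take_mono[of "Suc b" "length ds" ds] assms(2) by simp
  finally show "?i < sum_list ds" .
  show "block ds ?i = b" unfolding block_def
  proof (rule Least_equality)
    show "?i < sum_list (take (Suc b) ds)" by (rule lt)
    fix y assume "?i < sum_list (take (Suc y) ds)"
    then show "b \<le> y" using sum_list_take_mono[of "Suc y" b ds] by (meson not_less not_less_eq_eq)
  qed
qed

context unital_algebra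
begin

lemma mat_alg_add_group: "comm_group (add_monoid (mat_alg scale n))"
proof (rule comm_groupI; simp add: mat_alg_def)
  fix x :: "'b mat" assume x: "x \<in> carrier_mat n n"
  show "\<exists>y\<in>carrier_mat n n. y + x = 0\<^sub>m n n"
    using x by (intro bexI[of _ "-x"]) auto
qed (auto simp: comm_add_mat)

lemma mat_alg_inv:
  assumes "x \<in> carrier_mat n n"
  shows "inv\<^bsub>add_monoid (mat_alg scale n)\<^esub> x = - x"
proof -
  interpret comm_group "add_monoid (mat_alg scale n)" by (rule mat_alg_add_group)
  show ?thesis using assms by (intro inv_equality) (auto simp: mat_alg_def)
qed

lemma mat_alg_submoduleI:
  assumes "N \<subseteq> carrier_mat n n" "0\<^sub>m n n \<in> N" "\<And>x y. x \<in> N \<Longrightarrow> y \<in> N \<Longrightarrow> x + y \<in> N"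
    "\<And>c x. x \<in> N \<Longrightarrow> map_mat (scale c) x \<in> N"
  shows "submodule N field_rec (mat_alg scale n)"
proof -
  interpret comm_group "add_monoid (mat_alg scale n)" by (rule mat_alg_add_group)
  have neg: "- x \<in> N" if "x \<in> N" for x
  proof -
    have "- x = map_mat (scale (-1)) x" by (auto intro!: eq_matI)
    then show ?thesis using assms(4)[OF that] by simp
  qed
  show ?thesis unfolding submodule_def submodule_axioms_def
  proof (intro conjI subgroupI allI impI)
    show "inv\<^bsub>add_monoid (mat_alg scale n)\<^esub> x \<in> N" if "x \<in> N" for x
      using mat_alg_inv[of x n] that neg assms(1) by auto
  qed (use assms in \<open>auto simp: mat_alg_def\<close>)
qed

lemma submodule_sum_munits:
  assumes N: "submodule N field_rec (mat_alg scale n)" and M: "M \<in> carrier_mat n n"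
    and u: "\<And>i j. i < n \<Longrightarrow> j < n \<Longrightarrow> munit n (i, j) (M $$ (i, j)) \<in> N"
  shows "M \<in> N"
proof -
  have grp: "subgroup N (add_monoid (mat_alg scale n))" using N by (simp add: submodule_def)
  have add: "x + y \<in> N" if "x \<in> N" "y \<in> N" for x y
    using subgroup.m_closed[OF grp that] by (simp add: mat_alg_def)
  have zero: "0\<^sub>m n n \<in> N" using subgroup.one_closed[OF grp] by (simp add: mat_alg_def)
  have "mat n n (\<lambda>p. if p \<in> P then M $$ p else 0) \<in> N"
    if "finite P" "P \<subseteq> {..<n} \<times> {..<n}" for P
    using that
  proof (induction P)
    case empty
    have "mat n n (\<lambda>p. if p \<in> {} then M $$ p else 0) = 0\<^sub>m n n" by auto
    with zero show ?case by simp
  next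
    case (insert p P)
    obtain i j where p: "p = (i, j)" "i < n" "j < n" using insert by (cases p) auto
    have "mat n n (\<lambda>q. if q \<in> insert p P then M $$ q else 0) =
        munit n p (M $$ p) + mat n n (\<lambda>q. if q \<in> P then M $$ q else 0)"
      using insert.hyps by (auto intro!: eq_matI simp: munit_def)
    moreover have "mat n n (\<lambda>q. if q \<in> P then M $$ q else 0) \<in> N" using insert by simp
    ultimately show ?case using add u[OF p(2,3)] p(1) by simp
  qed
  from this[of "{..<n} \<times> {..<n}"]
  have "mat n n (\<lambda>p. if p \<in> {..<n} \<times> {..<n} then M $$ p else 0) \<in> N" by simp
  moreover have "mat n n (\<lambda>p. if p \<in> {..<n} \<times> {..<n} then M $$ p else 0) = M" using M by auto
  ultimately show "M \<in> N" by simp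
qed

lemma pure_tensor_mat_unit: "pure_tensor scale (mat_unit n i j) b = munit n (i, j) b"
  by (auto intro!: eq_matI simp: pure_tensor_def mat_unit_def munit_def)

end

lemma mat_unit_UT:
  assumes "i < sum_list ds" "j < sum_list ds"
  shows "(mat_unit (sum_list ds) i j :: 'k::field mat) \<in> carrier (UT ds) \<longleftrightarrow> block ds i \<le> block ds j"
  using assms by (auto simp: UT_def mat_unit_def not_less)

context utg
begin

lemma comp_submodule: "d \<in> carrier G \<Longrightarrow> submodule (comp d) field_rec (mat_alg s n)"
proof (rule mat_alg_submoduleI)
  assume d: "d \<in> carrier G"
  show "comp d \<subseteq> carrier_mat n n" using comp_carrier by blast
  show "0\<^sub>m n n \<in> comp d" by (rule zero_comp[OF d])
  fix x assume x: "x \<in> comp d"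
  note xc = comp_carrier[OF x]
  show "map_mat (s c) x \<in> comp d" for c
    using x xc utc_scale[OF comp_utc[OF x]] d by (simp add: comp_def D_scale)
  fix y assume y: "y \<in> comp d"
  show "x + y \<in> comp d"
    using x y xc comp_carrier[OF y] utc_add[OF comp_utc[OF x] comp_utc[OF y]] d by (simp add: comp_def D_add)
qed

lemma comp_subset:
  assumes d: "d \<in> carrier G" and N: "submodule N field_rec (mat_alg s n)"
    and u: "\<And>i j b. i < n \<Longrightarrow> j < n \<Longrightarrow> blk i \<le> blk j \<Longrightarrow> b \<in> D (inv (g i) \<otimes> d \<otimes> g j) \<Longrightarrow> munit n (i, j) b \<in> N"
  shows "comp d \<subseteq> N"
proof
  fix M assume M: "M \<in> comp d"
  show "M \<in> N"
  proof (rule submodule_sum_munits[OF N comp_carrier[OF M]])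
    fix i j assume ij: "i < n" "j < n"
    show "munit n (i, j) (M $$ (i, j)) \<in> N"
    proof (cases "blk i \<le> blk j")
      case True
      then show ?thesis using u ij M by (simp add: comp_def)
    next
      case False
      then have "M $$ (i, j) = 0" using ij M by (simp add: comp_def utc_def)
      then have "munit n (i, j) (M $$ (i, j)) = 0\<^sub>m n n" by (auto intro!: eq_matI simp: munit_def)
      moreover have "0\<^sub>m n n \<in> N"
        using subgroup.one_closed[of N "add_monoid (mat_alg s n)"] N by (simp add: submodule_def mat_alg_def)
      ultimately show ?thesis by simp
    qed
  qed
qed

end

locale ut_tensor = gda G s D H
  for G :: "'g monoid" (structure) and s :: "'k::field_char_0 \<Rightarrow> 'b::ring_1 \<Rightarrow> 'b"
    and D :: "'g \<Rightarrow> 'b set" and H :: "'g set" +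
  fixes ds :: "nat list" and gs :: "'g list"
  assumes ds: "ds \<noteq> []" "\<forall>d\<in>set ds. 0 < d"
    and gs: "length gs = sum_list ds" "set gs \<subseteq> carrier G"
begin

sublocale utg G s D H "sum_list ds" "length ds" "block ds" "(!) gs"
  by unfold_locales (use ds gs block_less block_surj in auto)

lemma carrier_eq: "carrier (UT_tensor ds s) = utc"
  unfolding carrier_UT_tensor utc_def ..

text \<open>The tensor of the matrix unit at \<open>(i, j)\<close> with \<open>b\<close> has degree
  \<open>d\<close> exactly if \<open>b\<close> has degree
  \<open>inv (gs ! i) \<otimes> d \<otimes> gs ! j\<close>, so the span of the homogeneous pure
  tensors has an entrywise description.\<close>

lemma grading_eq:
  assumes d: "d \<in> carrier G"
  shows "tensor_grading G ds gs s D d = comp d"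
proof -
  let ?n = "sum_list ds"
  let ?S = "{pure_tensor s (mat_unit ?n i j) b | i j h b.
        i < ?n \<and> j < ?n \<and> mat_unit ?n i j \<in> carrier (UT ds :: ('k, 'k mat) module) \<and>
        h \<in> carrier G \<and> b \<in> D h \<and> gs ! i \<otimes> h \<otimes> inv (gs ! j) = d}"
  have solve: "h = inv (gs ! i) \<otimes> (gs ! i \<otimes> h \<otimes> inv (gs ! j)) \<otimes> gs ! j" if "i < ?n" "j < ?n" "h \<in> carrier G" for i j h
    using that by (simp add: ab_simps)
  have S: "?S \<subseteq> comp d"
  proof
    fix M assume "M \<in> ?S"
    then obtain i j h b where M: "M = pure_tensor s (mat_unit ?n i j) b" "i < ?n" "j < ?n"
      "(mat_unit ?n i j :: 'k mat) \<in> carrier (UT ds)" "h \<in> carrier G" "b \<in> D h" "gs ! i \<otimes> h \<otimes> inv (gs ! j) = d"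
      by blast
    then have "b \<in> D (inv (gs ! i) \<otimes> d \<otimes> gs ! j)" using solve[OF M(2,3,5)] by simp
    then show "M \<in> comp d"
      using M mat_unit_UT[OF M(2,3), where 'k = 'k] munit_comp[OF d, of "(i, j)" b] by (simp add: pure_tensor_mat_unit)
  qed
  have "comp d \<subseteq> N" if N: "submodule N field_rec (mat_alg s ?n)" "?S \<subseteq> N" for N
  proof (rule comp_subset[OF d N(1)])
    fix i j b assume ij: "i < ?n" "j < ?n" "block ds i \<le> block ds j" "b \<in> D (inv (gs ! i) \<otimes> d \<otimes> gs ! j)"
    have "gs ! i \<otimes> (inv (gs ! i) \<otimes> d \<otimes> gs ! j) \<otimes> inv (gs ! j) = d" "inv (gs ! i) \<otimes> d \<otimes> gs ! j \<in> carrier G"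
      using ij d by (simp_all add: ab_simps)
    then have S': "pure_tensor s (mat_unit ?n i j) b \<in> ?S"
      using ij mat_unit_UT[OF ij(1,2), where 'k = 'k] by blast
    show "munit ?n (i, j) b \<in> N"
      using subsetD[OF N(2) S'] unfolding pure_tensor_mat_unit .
  qed
  then show ?thesis unfolding tensor_grading_def lin_span_def using comp_submodule[OF d] S by blast
qed

lemma UT_tensor_sel:
  "x \<oplus>\<^bsub>UT_tensor ds s\<^esub> y = x + y" "x \<otimes>\<^bsub>UT_tensor ds s\<^esub> y = x * y"
  "\<zero>\<^bsub>UT_tensor ds s\<^esub> = 0\<^sub>m (sum_list ds) (sum_list ds)" "\<one>\<^bsub>UT_tensor ds s\<^esub> = 1\<^sub>m (sum_list ds)"
  "c \<odot>\<^bsub>UT_tensor ds s\<^esub> x = map_mat (s c) x"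
  by (simp_all add: UT_tensor_def mat_alg_def)

lemma finsum_eq:
  assumes "finite S" "\<And>w. w \<in> S \<Longrightarrow> F w \<in> utc"
  shows "finsum (UT_tensor ds s) F S = mat (sum_list ds) (sum_list ds) (\<lambda>p. \<Sum>w\<in>S. F w $$ p)"
proof -
  let ?n = "sum_list ds"
  interpret R: abelian_monoid "UT_tensor ds s"
    by (rule abelian_monoidI; unfold carrier_eq UT_tensor_sel)
      (auto simp: utc_add utc_zero intro: utc_carrier left_add_zero_mat
        comm_add_mat[of _ "sum_list ds" "sum_list ds"] assoc_add_mat[of _ "sum_list ds" "sum_list ds"])
  show ?thesis using assms
  proof (induction S)
    case empty
    then show ?case by (auto simp: R.finsum_empty UT_tensor_sel)
  next
    case (insert w S)
    have "F \<in> S \<rightarrow> carrier (UT_tensor ds s)" "F w \<in> carrier (UT_tensor ds s)"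
      using insert.prems by (auto simp: carrier_eq)
    then have "finsum (UT_tensor ds s) F (insert w S) = F w + mat ?n ?n (\<lambda>p. \<Sum>w\<in>S. F w $$ p)"
      using insert by (simp add: R.finsum_insert UT_tensor_sel)
    also have "\<dots> = mat ?n ?n (\<lambda>p. \<Sum>w\<in>insert w S. F w $$ p)"
      using insert.hyps utc_carrier[OF insert.prems[of w]] by (auto intro!: eq_matI)
    finally show ?case .
  qed
qed

lemma eval_poly_eq:
  assumes "\<And>w v. w \<in> Poly_Mapping.keys f \<Longrightarrow> v \<in> set w \<Longrightarrow> \<phi> v \<in> utc"
  shows "eval_poly (UT_tensor ds s) \<phi> f = ev s (sum_list ds) \<phi> f"
proof -
  let ?n = "sum_list ds"
  let ?F = "\<lambda>w. map_mat (s (Poly_Mapping.lookup f w)) (wval ?n \<phi> w)"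
  have W: "wval ?n \<phi> w \<in> utc" if "w \<in> Poly_Mapping.keys f" for w
    using assms that by (intro utc_wval) blast
  have "eval_poly (UT_tensor ds s) \<phi> f = finsum (UT_tensor ds s) ?F (Poly_Mapping.keys f)"
    by (simp add: eval_poly_def UT_tensor_sel wval_def)
  also have "\<dots> = mat ?n ?n (\<lambda>p. \<Sum>w\<in>Poly_Mapping.keys f. ?F w $$ p)"
    by (rule finsum_eq) (use W utc_scale in auto)
  also have "\<dots> = ev s ?n \<phi> f"
    unfolding ev_def by (rule eq_matI) (auto intro!: sum.cong dest!: W utc_carrier)
  finally show ?thesis .
qed

lemma identities_eq: "graded_identities G (UT_tensor ds s) (tensor_grading G ds gs s D) = ids"
proof -
  have "eval_poly (UT_tensor ds s) \<phi> f = ev s (sum_list ds) \<phi> f"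
    if f: "\<forall>w\<in>Poly_Mapping.keys f. set w \<subseteq> UNIV \<times> carrier G" and \<phi>: "\<forall>i. \<forall>d\<in>carrier G. \<phi> (i, d) \<in> comp d"
    for \<phi> and f :: "('k, nat \<times> 'g) free_poly"
  proof (rule eval_poly_eq)
    fix w v assume "w \<in> Poly_Mapping.keys f" "v \<in> set w"
    then have "v \<in> UNIV \<times> carrier G" using f by blast
    then show "\<phi> v \<in> utc" using \<phi> comp_utc by (cases v) auto
  qed
  then show ?thesis
    unfolding graded_identities_def ids_def UT_tensor_sel by (auto simp: grading_eq)
qed

end

locale ut_tensor_pair = A: ut_tensor G s D H ds gs + B: ut_tensor G s' D' H' ds' gs'
  for G :: "'g monoid" (structure)
    and s :: "'k::field_char_0 \<Rightarrow> 'b::ring_1 \<Rightarrow> 'b" and D H ds gs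
    and s' :: "'k \<Rightarrow> 'c::ring_1 \<Rightarrow> 'c" and D' H' ds' gs'
begin

sublocale pair G s D H "sum_list ds" "length ds" "block ds" "(!) gs"
  s' D' H' "sum_list ds'" "length ds'" "block ds'" "(!) gs'" ..

lemma isomorphic_eq:
  "graded_isomorphic G (UT_tensor ds s) (tensor_grading G ds gs s D)
     (UT_tensor ds' s') (tensor_grading G ds' gs' s' D') \<longleftrightarrow> (\<exists>\<Psi>. graded_iso \<Psi>)"
proof -
  have "(\<Psi> \<in> ring_iso (UT_tensor ds s) (UT_tensor ds' s') \<and>
      (\<forall>c. \<forall>x\<in>carrier (UT_tensor ds s). \<Psi> (c \<odot>\<^bsub>UT_tensor ds s\<^esub> x) = c \<odot>\<^bsub>UT_tensor ds' s'\<^esub> \<Psi> x) \<and>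
      (\<forall>d\<in>carrier G. \<Psi> ` tensor_grading G ds gs s D d \<subseteq> tensor_grading G ds' gs' s' D' d)) \<longleftrightarrow> graded_iso \<Psi>" for \<Psi>
    unfolding graded_iso_def ring_iso_def ring_hom_def A.UT_tensor_sel B.UT_tensor_sel A.carrier_eq B.carrier_eq
    by (auto simp: A.grading_eq B.grading_eq bij_betw_def)
  then show ?thesis unfolding graded_isomorphic_def by blast
qed

end

theorem corollary5:
  fixes G :: "'g monoid" and K :: "'g set"
    and ds ds' :: "nat list" and gs gs' :: "'g list"
    and s :: "'k::{alg_closed_field, field_char_0} \<Rightarrow> 'b::ring_1 \<Rightarrow> 'b"
    and s' :: "'k \<Rightarrow> 'c::ring_1 \<Rightarrow> 'c"
    and \<Gamma> :: "'g \<Rightarrow> 'b set" and \<Gamma>' :: "'g \<Rightarrow> 'c set"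
  defines "B \<equiv> alg_of s" and "B' \<equiv> alg_of s'"
  defines "\<Delta> \<equiv> extend_grading K B \<Gamma>" and "\<Delta>' \<equiv> extend_grading K B' \<Gamma>'"
  defines "R \<equiv> UT_tensor ds s" and "R' \<equiv> UT_tensor ds' s'"
  defines "\<R> \<equiv> tensor_grading G ds gs s \<Delta>" and "\<R>' \<equiv> tensor_grading G ds' gs' s' \<Delta>'"
  defines "H \<equiv> supp G B \<Delta>"
  defines "\<alpha> \<equiv> (\<lambda>g. H #>\<^bsub>G\<^esub> g)"
  assumes "comm_group G"
    and "ds \<noteq> []" and "\<forall>d\<in>set ds. 0 < d"
    and "ds' \<noteq> []" and "\<forall>d\<in>set ds'. 0 < d"
    and "length gs = sum_list ds" and "set gs \<subseteq> carrier G"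
    and "length gs' = sum_list ds'" and "set gs' \<subseteq> carrier G"
    and "subgroup K G" and "\<exists>S. finite S \<and> S \<subseteq> carrier G \<and> K = generate G S"
    and "graded_division_algebra (G\<lparr>carrier := K\<rparr>) s \<Gamma>"
    and "graded_division_algebra (G\<lparr>carrier := K\<rparr>) s' \<Gamma>'"
    and "is_pi B" and "is_pi B'"
    and "pi_degree B = pi_degree B'"
    and "length ds \<le> 2 \<or>
         (\<exists>k<length ds. invariance_subgroup (G Mod H) (block_part ds k (map \<alpha> gs))
            = {\<one>\<^bsub>G Mod H\<^esub>})"
  shows "graded_isomorphic G R \<R> R' \<R>' \<longleftrightarrow>
         graded_identities G R \<R> = graded_identities G R' \<R>'"
proof -
  interpret A: gda G s \<Delta> H
    unfolding H_def \<Delta>_def B_def by (rule gda_of_graded_division_algebra) fact+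
  interpret B: gda G s' \<Delta>' "supp G B' \<Delta>'"
    unfolding \<Delta>'_def B'_def by (rule gda_of_graded_division_algebra) fact+
  interpret ut_tensor_pair G s \<Delta> H ds gs s' \<Delta>' "supp G B' \<Delta>'" ds' gs'
    by unfold_locales fact+
  show ?thesis
    unfolding R_def R'_def \<R>_def \<R>'_def isomorphic_eq A.identities_eq B.identities_eq
  proof
    assume "\<exists>\<Psi>. graded_iso \<Psi>"
    then show "A.ids = B.ids" using iso_ids by blast
  next
    assume ids: "A.ids = B.ids"
    interpret two_eq G s \<Delta> H "sum_list ds" "length ds" "block ds" "(!) gs"
      s' \<Delta>' "supp G B' \<Delta>'" "sum_list ds'" "length ds'" "block ds'" "(!) gs'"
      by unfold_locales (simp_all add: ids)
    \<comment> \<open>Roots in the algebraically closed field make the group of nonzero scalars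
      divisible.\<close>
    show "\<exists>\<Psi>. graded_iso \<Psi>" by (rule ids_imp_iso[OF nth_root_exists])
  qed
qed

end
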